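(* Let $((\mathbf A_t,\mathbf B_t))_{t\in\mathbb Z}$ be an i.i.d. sequence with $$\mathbf A_t=\begin{pmatrix}A_{1,t}&A_{2,t}\\ 0&A_{4,t}\end{pmatrix},\qquad \mathbf B_t=\begin{pmatrix}B_{1,t}\\ B_{2,t}\end{pmatrix},$$ where $A_{1,t},A_{2,t},A_{4,t},B_{1,t},B_{2,t}>0$ a.s. Write $A_i,B_i$ for generic copies of $A_{i,t},B_{i,t}$. Assume that $\log A_1$ and $\log A_4$ are non-arithmetic and that there exist $0<\alpha_1<\alpha_2$ with $$\mathbb E A_1^{\alpha_1}=1,\quad \mathbb E A_1^{\alpha_1}\log^+A_1<\infty,\quad \mathbb E B_1^{\alpha_1}<\infty,$$ $$\mathbb E A_4^{\alpha_2}=1,\quad \mathbb E A_4^{\alpha_2}\log^+A_4<\infty,\quad \mathbb E B_2^{\alpha_2}<\infty,$$ and $\mathbb E A_2^{\alpha_1}<\infty$. Let $\mathbf W_t=(W_{1,t},W_{2,t})'$, $t\in\mathbb Z$, be the strictly stationary causal solution of $\mathbf W_t=\mathbf A_t\mathbf W_{t-1}+\mathbf B_t$. Then the strictly stationary series $(W_{1,t})$ and $(W_{2,t})$ are regularly varying with indices $\alpha_1$ and $\alpha_2$ respectively, i.e. for every $h\ge1$ and $i=1,2$ the vector $(W_{i,1},\dots,W_{i,h})$ is multivariate regularly varying with index $\alpha_i$, and its spectral measure is $$\mathbb P(\boldsymbol\Theta_{i,h}\in\cdot)=\frac{\mathbb E\big[|\boldsymbol\Xi^{(i)}_h|^{\alpha_i}\,\mathbf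 1(\boldsymbol\Xi^{(i)}_h/|\boldsymbol\Xi^{(i)}_h|\in\cdot)\big]}{\mathbb E|\boldsymbol\Xi^{(i)}_h|^{\alpha_i}},$$ where $\boldsymbol\Theta_{i,h}$ takes values in the unit sphere $\mathbb S^{h-1}$ of $\mathbb R^h$, $$\boldsymbol\Xi^{(1)}_h=(\Pi^{(1)}_1,\dots,\Pi^{(1)}_h),\qquad \boldsymbol\Xi^{(2)}_h=(\Pi^{(4)}_1,\dots,\Pi^{(4)}_h),\qquad \Pi^{(j)}_\ell=\prod_{k=1}^\ell A_{j,k}\quad (j=1,4).$$
   Context: The strictly stationary causal solution is the a.s. unique one, $\mathbf W_t=\sum_{i=-\infty}^t\boldsymbol\Pi_{t,i+1}\mathbf B_i$, where $\boldsymbol\Pi_{t,s}=\mathbf A_t\cdots\mathbf A_s$ for $t\ge s$ and the identity for $t<s$ (the series converges a.s. under the hypotheses). $|\cdot|$ is the Euclidean norm, $\log^+x=\max(\log x,0)$. A random variable is non-arithmetic if its law is not supported on $h\mathbb Z$ for any $h\ge0$. An $\mathbb R^h$-valued random vector $\mathbf X$ is multivariate regularly varying with index $\alpha>0$ if there is a random vector $\boldsymbol\Theta$ on $\mathbb S^{h-1}$ such that for every $u>0$, as $x\to\infty$, $$\frac{\mathbb P(|\mathbf X|>ux,\ \mathbf X/|\mathbf X|\in\cdot)}{\mathbb P(|\mathbf X|>x)}\xrightarrow{v}u^{-\alpha}\,\mathbb P(\boldsymbol\Theta\in\cdot)$$ (vague convergence of measures on the sphere); the law of $\boldsymbol\Theta$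 is the spectral measure of $\mathbf X$. A univariate strictly stationary series is regularly varying with index $\alpha$ if all its finite-dimensional distributions are. *)

theory Defs
  imports "HOL-Probability.Probability"
begin

text \<open>
  Euclidean space of dimension \<open>h\<close> is represented, as in \<^theory>\<open>HOL-Analysis.Abstract_Euclidean_Space\<close>,
  by the sequences \<open>x :: nat \<Rightarrow> real\<close> that vanish from index \<open>h\<close> on; the sphere of dimension \<open>h - 1\<close>
  is \<^term>\<open>nsphere (h - 1)\<close>, which is used below only for \<open>h \<ge> 1\<close>. The Borel \<open>\<sigma>\<close>-algebra on
  \<open>nat \<Rightarrow> real\<close> is that of the product topology, so its trace on these subsets is the usual one.
\<close>

definition vec_norm :: "nat \<Rightarrow> (nat \<Rightarrow> real) \<Rightarrow> real" where
  "vec_norm h x = L2_set x {..<h}"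

definition vec_dir :: "nat \<Rightarrow> (nat \<Rightarrow> real) \<Rightarrow> nat \<Rightarrow> real" where
  "vec_dir h x = (\<lambda>i. x i / vec_norm h x)"

text \<open>The point \<open>(f 1, \<dots>, f h)\<close>; coordinates of the point are numbered from 0.\<close>
definition tuple :: "nat \<Rightarrow> (nat \<Rightarrow> real) \<Rightarrow> nat \<Rightarrow> real" where
  "tuple h f = (\<lambda>i. if i < h then f (Suc i) else 0)"

definition sphere_borel :: "nat \<Rightarrow> (nat \<Rightarrow> real) measure" where
  "sphere_borel h = restrict_space borel (topspace (nsphere (h - 1)))"

definition random_vector :: "'a measure \<Rightarrow> nat \<Rightarrow> ('a \<Rightarrow> nat \<Rightarrow> real) \<Rightarrow> bool" where
  "random_vector M h X \<longleftrightarrow> X \<in> borel_measurable M \<and> (\<forall>\<omega>\<in>space M. X \<omega> \<in> topspace (Euclidean_space h))"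

text \<open>Vague convergence: convergence of integrals of compactly supported continuous functions.\<close>
definition vague_limit ::
  "'b topology \<Rightarrow> ('c \<Rightarrow> 'b measure) \<Rightarrow> 'b measure \<Rightarrow> 'c filter \<Rightarrow> bool" where
  "vague_limit T \<mu> \<nu> F \<longleftrightarrow>
     (\<forall>f :: 'b \<Rightarrow> real. continuous_map T euclideanreal f \<and>
          compactin T (T closure_of {x \<in> topspace T. f x \<noteq> 0}) \<longrightarrow>
        ((\<lambda>x. integral\<^sup>L (\<mu> x) f) \<longlongrightarrow> integral\<^sup>L \<nu> f) F)"

text \<open>The measure \<open>E \<mapsto> P (|X| > u x, X / |X| \<in> E) / P (|X| > x)\<close> on the sphere.\<close>
definition exceedance_measure ::
  "'a measure \<Rightarrow> nat \<Rightarrow> ('a \<Rightarrow> nat \<Rightarrow> real) \<Rightarrow> real \<Rightarrow> real \<Rightarrow> (nat \<Rightarrow> real) measure" where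
  "exceedance_measure M h X u x =
     scale_measure (ennreal (1 / measure M {\<omega> \<in> space M. vec_norm h (X \<omega>) > x}))
       (distr (restrict_space M {\<omega> \<in> space M. vec_norm h (X \<omega>) > u * x}) (sphere_borel h)
          (\<lambda>\<omega>. vec_dir h (X \<omega>)))"

text \<open>\<open>S\<close> is the law of the random vector \<open>\<Theta>\<close> on the sphere.\<close>
definition has_spectral_measure ::
  "'a measure \<Rightarrow> nat \<Rightarrow> ('a \<Rightarrow> nat \<Rightarrow> real) \<Rightarrow> real \<Rightarrow> (nat \<Rightarrow> real) measure \<Rightarrow> bool" where
  "has_spectral_measure M h X \<alpha> S \<longleftrightarrow>
     h \<ge> 1 \<and> \<alpha> > 0 \<and> random_vector M h X \<and>
     prob_space S \<and> sets S = sets (sphere_borel h) \<and>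
     (\<forall>u>0. vague_limit (nsphere (h - 1)) (exceedance_measure M h X u)
               (scale_measure (ennreal (u powr (- \<alpha>))) S) at_top)"

definition multivariate_regularly_varying ::
  "'a measure \<Rightarrow> nat \<Rightarrow> ('a \<Rightarrow> nat \<Rightarrow> real) \<Rightarrow> real \<Rightarrow> bool" where
  "multivariate_regularly_varying M h X \<alpha> \<longleftrightarrow> (\<exists>S. has_spectral_measure M h X \<alpha> S)"

definition strictly_stationary ::
  "'a measure \<Rightarrow> (int \<Rightarrow> 'a \<Rightarrow> 'b::topological_space) \<Rightarrow> bool" where
  "strictly_stationary M X \<longleftrightarrow>
     (\<forall>t. X t \<in> borel_measurable M) \<and>
     (\<forall>J k. finite J \<longrightarrow>
        distr M (\<Pi>\<^sub>M t\<in>J. borel) (\<lambda>\<omega>. \<lambda>t\<in>J. X (t + k) \<omega>) =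
        distr M (\<Pi>\<^sub>M t\<in>J. borel) (\<lambda>\<omega>. \<lambda>t\<in>J. X t \<omega>))"

definition regularly_varying_series :: "'a measure \<Rightarrow> (int \<Rightarrow> 'a \<Rightarrow> real) \<Rightarrow> real \<Rightarrow> bool" where
  "regularly_varying_series M X \<alpha> \<longleftrightarrow>
     strictly_stationary M X \<and>
     (\<forall>h\<ge>1. multivariate_regularly_varying M h (\<lambda>\<omega>. tuple h (\<lambda>k. X (int k) \<omega>)) \<alpha>)"

definition iid_sequence :: "'a measure \<Rightarrow> (int \<Rightarrow> 'a \<Rightarrow> 'b::topological_space) \<Rightarrow> bool" where
  "iid_sequence M X \<longleftrightarrow>
     prob_space.indep_vars M (\<lambda>_. borel) X UNIV \<and>
     (\<forall>t. distr M borel (X t) = distr M borel (X 0))"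

definition non_arithmetic :: "'a measure \<Rightarrow> ('a \<Rightarrow> real) \<Rightarrow> bool" where
  "non_arithmetic M X \<longleftrightarrow> \<not> (\<exists>h\<ge>0. AE \<omega> in M. \<exists>k::int. X \<omega> = h * of_int k)"

text \<open>Causality: \<open>W t\<close> is a.s. a measurable function of \<open>(A s, B s)\<close>, \<open>s \<le> t\<close>.\<close>
definition stationary_causal_solution ::
  "'a measure \<Rightarrow> (int \<Rightarrow> 'a \<Rightarrow> real^2^2) \<Rightarrow> (int \<Rightarrow> 'a \<Rightarrow> real^2) \<Rightarrow> (int \<Rightarrow> 'a \<Rightarrow> real^2) \<Rightarrow> bool" where
  "stationary_causal_solution M A B W \<longleftrightarrow>
     strictly_stationary M W \<and>
     (\<forall>t. \<exists>g \<in> borel_measurable (\<Pi>\<^sub>M s\<in>{..t}. borel).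
        AE \<omega> in M. W t \<omega> = g (\<lambda>s\<in>{..t}. (A s \<omega>, B s \<omega>))) \<and>
     (\<forall>t. AE \<omega> in M. W t \<omega> = A t \<omega> *v W (t - 1) \<omega> + B t \<omega>)"

text \<open>\<open>back_prod A t n = A t ** A (t - 1) ** \<dots> ** A (t - n + 1)\<close>, that is, \<open>\<Pi>\<^bsub>t,t-n+1\<^esub>\<close>.\<close>
primrec back_prod :: "(int \<Rightarrow> real^2^2) \<Rightarrow> int \<Rightarrow> nat \<Rightarrow> real^2^2" where
  "back_prod A t 0 = mat 1"
| "back_prod A t (Suc n) = back_prod A t n ** A (t - int n)"

definition forward_products :: "(int \<Rightarrow> 'a \<Rightarrow> real) \<Rightarrow> nat \<Rightarrow> 'a \<Rightarrow> nat \<Rightarrow> real" where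
  "forward_products a h \<omega> = tuple h (\<lambda>l. \<Prod>k=1..l. a (int k) \<omega>)"

text \<open>\<open>S\<close> is the law \<open>E \<mapsto> E[|Y|^\<alpha> 1(Y/|Y| \<in> E)] / E|Y|^\<alpha>\<close> on the sphere.\<close>
definition is_tilted_direction_law ::
  "'a measure \<Rightarrow> nat \<Rightarrow> ('a \<Rightarrow> nat \<Rightarrow> real) \<Rightarrow> real \<Rightarrow> (nat \<Rightarrow> real) measure \<Rightarrow> bool" where
  "is_tilted_direction_law M h Y \<alpha> S \<longleftrightarrow>
     sets S = sets (sphere_borel h) \<and> prob_space S \<and>
     integrable M (\<lambda>\<omega>. vec_norm h (Y \<omega>) powr \<alpha>) \<and>
     (\<forall>E \<in> sets S. measure S E =
        (\<integral>\<omega>. vec_norm h (Y \<omega>) powr \<alpha> * indicator E (vec_dir h (Y \<omega>)) \<partial>M) /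
        (\<integral>\<omega>. vec_norm h (Y \<omega>) powr \<alpha> \<partial>M))"

end

theory Submission
  imports Defs
begin

text \<open>
  Both components solve a scalar recursion \<open>X\<^sub>t = a\<^sub>t X\<^sub>t\<^sub>-\<^sub>1 + Q\<^sub>t\<close>; for the first one \<open>Q\<^sub>t\<close> contains the
  second component, which has moments of every order below \<open>\<alpha>2\<close>, in particular of some order above
  \<open>\<alpha>1\<close>. With \<open>r t = exp (\<alpha> t) P (X > exp t)\<close> and the law \<open>\<eta>\<close> of \<open>ln a\<close> under the tilted measure with
  density \<open>a powr \<alpha>\<close>, the recursion becomes a renewal equation \<open>r = r * \<eta> + g\<close>, where \<open>g \<ge> 0\<close> is
  integrable and nonzero because \<open>Q > 0\<close>. A second moment bound for the number of visits to an interval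
  shows that \<open>r\<close> is bounded, the Choquet-Deny argument that the increments of a smoothed \<open>r\<close> vanish at
  infinity, and integrating the equation over a half-line identifies the limit as \<open>\<integral> g\<close> divided by the
  drift of \<open>\<eta>\<close>. Hence
  \<open>x powr \<alpha> * P (X > x)\<close> has a positive limit. Finally \<open>(X\<^sub>1, \<dots>, X\<^sub>h)\<close> is \<open>X\<^sub>0\<close> times the independent
  vector of products, up to a remainder with finite moment of order \<open>\<alpha>\<close>, so Breiman's lemma gives the
  spectral measure.
\<close>

section \<open>Renewal equations on the real line\<close>

text \<open>The term \<open>Q\<close> may depend on the previous value \<open>X\<close>: in the
  first component both contain the past of the second. The renewal equation uses only that the
  factor \<open>a\<close> is independent of the past; \<open>g t\<close> weighs the probability that
  \<open>exp t\<close> lies between \<open>a X\<close> and \<open>a X + Q\<close>. As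
  \<open>x powr \<alpha> * P (X > x)\<close> has a positive limit, the moment of order \<alpha> is
  infinite, so the integral of \<open>g\<close> is controlled through the mean of (a X + Q)^\<alpha>
  - (a X)^\<alpha>; its finiteness is where the gap between the two orders enters. The positive
  drift, the visit counts and the decay of \<open>r\<close> at minus infinity come from one order
  \<beta> < \<alpha>: convexity gives E a^\<beta> < 1, the Laplace transform of \<eta> at \<alpha> -
  \<beta>, and Markov's inequality gives r t \<le> C exp ((\<alpha> - \<beta>) t). A stationary
  solution comes without moments; they hold for the increasing limits of the partial sums, with
  which tightness identifies it. Since \<open>r\<close> may jump and \<open>g\<close> need not
  vanish at infinity, limits are taken for averages over short intervals, and monotonicity of the
  tail removes the averaging.\<close>

lemma closed_subgroup_real_cases:
  fixes G :: "real set"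
  assumes zero: "0 \<in> G" and diff: "\<And>x y. x \<in> G \<Longrightarrow> y \<in> G \<Longrightarrow> x - y \<in> G" and "closed G"
  obtains "G = UNIV" | h where "h \<ge> 0" "\<And>x. x \<in> G \<Longrightarrow> \<exists>k::int. x = h * of_int k"
proof -
  have neg: "- x \<in> G" if "x \<in> G" for x
    using diff[OF zero that] by simp
  have add: "x + y \<in> G" if "x \<in> G" "y \<in> G" for x y
    using diff[OF that(1) neg[OF that(2)]] by simp
  have nat_mult: "of_nat n * x \<in> G" if "x \<in> G" for x and n :: nat
    by (induction n) (use zero add that in \<open>auto simp: algebra_simps\<close>)
  have int_mult: "of_int k * x \<in> G" if "x \<in> G" for x and k :: int
    by (cases k rule: int_cases2) (use nat_mult[OF that] neg in \<open>auto simp del: of_nat_Suc\<close>)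
  show thesis
  proof (cases "\<exists>h>0. \<forall>x\<in>G. x > 0 \<longrightarrow> x \<ge> h")
    \<comment> \<open>There are arbitrarily small positive elements, and the integer multiples of
      one below \<open>e\<close> come within \<open>e\<close> of every point.\<close>
    case False
    have "x \<in> closure G" for x
    proof (unfold closure_approachable, intro allI impI)
      fix e :: real assume "e > 0"
      with False obtain y where y: "y \<in> G" "y > 0" "y < e" by force
      have "of_int \<lfloor>x / y\<rfloor> * y \<le> x" "x < (of_int \<lfloor>x / y\<rfloor> + 1) * y"
        using y(2) by (simp_all add: floor_divide_lower floor_divide_upper)
      then have "dist (of_int \<lfloor>x / y\<rfloor> * y) x < e"
        using y by (simp add: dist_real_def algebra_simps)
      then show "\<exists>z\<in>G. dist z x < e" using int_mult[OF y(1)] by blast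
    qed
    then have "G = UNIV" using \<open>closed G\<close> by auto
    then show thesis by (rule that(1))
  next
    case True
    then obtain d where d: "d > 0" "\<And>x. x \<in> G \<Longrightarrow> x > 0 \<Longrightarrow> x \<ge> d" by blast
    show thesis
    proof (cases "\<exists>x\<in>G. x > 0")
      case False
      \<comment> \<open>The trivial group is covered by \<open>h = 0\<close>, a degenerate lattice
        that \<open>non_arithmetic\<close> excludes as well.\<close>
      have "x = 0" if "x \<in> G" for x
      proof -
        have "\<not> x > 0" "\<not> - x > 0" using False neg[OF that] that by blast+
        then show ?thesis by simp
      qed
      then show thesis by (intro that(2)[of 0]) auto
    next
      case True
      define P where "P = {x\<in>G. x > 0}"
      have "P \<noteq> {}" using True by (auto simp: P_def)
      have bdd: "bdd_below P" by (auto simp: P_def intro!: bdd_belowI[of _ 0])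
      define h where "h = Inf P"
      have h: "h \<ge> d" unfolding h_def by (rule cInf_greatest) (use \<open>P \<noteq> {}\<close> d in \<open>auto simp: P_def\<close>)
      obtain x where x: "x \<in> P" "x < h + d"
        using cInf_lessD[OF \<open>P \<noteq> {}\<close>, of "h + d"] d(1) unfolding h_def by auto
      have lb: "h \<le> y" if "y \<in> P" for y unfolding h_def by (rule cInf_lower[OF that bdd])
      \<comment> \<open>Distinct elements of \<open>G\<close> differ by at least \<open>d\<close>,
        so [h, h + d) holds at most one of them and the infimum is attained.\<close>
      have "x = h"
      proof (rule ccontr)
        assume "x \<noteq> h"
        then have "\<exists>y\<in>P. y < x"
          using cInf_lessD[OF \<open>P \<noteq> {}\<close>, of x] lb[OF x(1)] unfolding h_def by auto
        then obtain y where y: "y \<in> P" "y < x" by blast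
        then have "x - y \<in> G" "x - y > 0" using diff x by (auto simp: P_def)
        then have "x - y \<ge> d" by (rule d(2))
        then show False using lb[OF y(1)] x(2) by simp
      qed
      then have hG: "h \<in> G" "h > 0" using x(1) by (auto simp: P_def)
      show thesis
      proof (rule that(2)[of h])
        fix y assume y: "y \<in> G"
        define k where "k = \<lfloor>y / h\<rfloor>"
        have k: "of_int k * h \<le> y" "y < (of_int k + 1) * h"
          using hG(2) unfolding k_def by (simp_all add: floor_divide_lower floor_divide_upper)
        have "y - of_int k * h \<in> G" using diff[OF y int_mult[OF hG(1)]] .
        moreover have "y - of_int k * h < h" using k by (simp add: algebra_simps)
        ultimately have "\<not> 0 < y - of_int k * h"
          using lb[of "y - of_int k * h"] by (auto simp: P_def)
        then have "y = h * of_int k" using k(1) by (simp add: mult.commute)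
        then show "\<exists>k::int. y = h * of_int k" by blast
      qed (use hG in auto)
    qed
  qed
qed

section \<open>Truncated potentials of a random walk on the line\<close>

context real_distribution
begin

lemma nn_integral_square_le:
  assumes [measurable]: "f \<in> borel_measurable borel"
  shows "(\<integral>\<^sup>+s. f s \<partial>M)\<^sup>2 \<le> (\<integral>\<^sup>+s. (f s)\<^sup>2 \<partial>M)"
  using Cauchy_Schwarz_nn_integral[of f M "\<lambda>_. 1"] by (simp add: emeasure_space_1[simplified])

text \<open>Powers of the transition operator: if \<open>S n\<close> is the random walk with steps
  of law \<open>M\<close>, this is the mean of \<open>f (t + S n)\<close>.\<close>

primrec shift_iter :: "(real \<Rightarrow> ennreal) \<Rightarrow> nat \<Rightarrow> real \<Rightarrow> ennreal" where
  "shift_iter f 0 = f"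
| "shift_iter f (Suc n) = (\<lambda>t. \<integral>\<^sup>+s. shift_iter f n (t + s) \<partial>M)"

lemma measurable_shift_iter [measurable]:
  assumes [measurable]: "f \<in> borel_measurable borel"
  shows "shift_iter f n \<in> borel_measurable borel"
  by (induction n) (simp, simp, measurable)

text \<open>The truncated Green operator; for the indicator of a set it is the mean number of visits
  at times below \<open>N\<close>. The truncation keeps it finite, so that a quadratic inequality
  can be divided by it.\<close>

definition potential :: "nat \<Rightarrow> (real \<Rightarrow> ennreal) \<Rightarrow> real \<Rightarrow> ennreal" where
  "potential N f t = (\<Sum>n<N. shift_iter f n t)"

lemma measurable_potential [measurable]:
  assumes [measurable]: "f \<in> borel_measurable borel"
  shows "potential N f \<in> borel_measurable borel"
  unfolding potential_def by measurable

lemma shift_iter_mono: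
  assumes "\<And>t. f t \<le> g t" shows "shift_iter f n t \<le> shift_iter g n t"
  by (induction n arbitrary: t) (auto intro!: nn_integral_mono assms)

lemma shift_iter_cmult:
  assumes [measurable]: "f \<in> borel_measurable borel"
  shows "shift_iter (\<lambda>t. c * f t) n t = c * shift_iter f n t"
  by (induction n arbitrary: t) (auto simp: nn_integral_cmult)

lemma potential_Suc:
  assumes [measurable]: "f \<in> borel_measurable borel"
  shows "potential (Suc N) f t = f t + (\<integral>\<^sup>+s. potential N f (t + s) \<partial>M)"
  unfolding potential_def sum.lessThan_Suc_shift by (simp add: nn_integral_sum)

lemma potential_mono: "(\<And>t. f t \<le> g t) \<Longrightarrow> potential N f t \<le> potential N g t"
  unfolding potential_def by (intro sum_mono shift_iter_mono)

text \<open>The analytic form of the second moment of the number of visits: a pair of visits is counted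
  at the earlier one.\<close>

lemma potential_square_le:
  assumes [measurable]: "f \<in> borel_measurable borel"
  shows "(potential N f t)\<^sup>2 \<le> 2 * potential N (\<lambda>t. f t * potential N f t) t"
proof (induction N arbitrary: t)
  case 0
  then show ?case by (simp add: potential_def)
next
  case (Suc N)
  let ?v = "potential N f" and ?w = "potential (Suc N) f"
  let ?P = "\<integral>\<^sup>+s. ?v (t + s) \<partial>M"
  have vw: "?v t \<le> ?w t" for t
    by (simp add: potential_def)
  have "?P\<^sup>2 \<le> (\<integral>\<^sup>+s. (?v (t + s))\<^sup>2 \<partial>M)"
    by (rule nn_integral_square_le) measurable
  also have "\<dots> \<le> (\<integral>\<^sup>+s. 2 * potential N (\<lambda>t. f t * ?v t) (t + s) \<partial>M)"
    by (intro nn_integral_mono Suc)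
  also have "\<dots> \<le> (\<integral>\<^sup>+s. 2 * potential N (\<lambda>t. f t * ?w t) (t + s) \<partial>M)"
    by (intro nn_integral_mono mult_left_mono potential_mono vw) auto
  also have "\<dots> = 2 * (\<integral>\<^sup>+s. potential N (\<lambda>t. f t * ?w t) (t + s) \<partial>M)"
    by (rule nn_integral_cmult) measurable
  finally have P: "?P\<^sup>2 \<le> 2 * (\<integral>\<^sup>+s. potential N (\<lambda>t. f t * ?w t) (t + s) \<partial>M)" .
  \<comment> \<open>Doubling \<open>f t * f t\<close> lets it combine with the mixed term into
    \<open>2 * (f t * ?w t)\<close>, the contribution of time 0 to the potential on the right-hand
    side.\<close>
  have "(f t + ?P)\<^sup>2 = f t * f t + 2 * (f t * ?P) + ?P\<^sup>2"
    by (simp add: power2_eq_square algebra_simps mult_2)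
  also have "\<dots> \<le> 2 * (f t * f t) + 2 * (f t * ?P) + ?P\<^sup>2"
    by (intro add_mono order_refl) (simp add: mult_2)
  also have "\<dots> = 2 * (f t * ?w t) + ?P\<^sup>2"
    by (simp add: potential_Suc algebra_simps)
  finally have "(?w t)\<^sup>2 \<le> 2 * (f t * ?w t) + 2 * (\<integral>\<^sup>+s. potential N (\<lambda>t. f t * ?w t) (t + s) \<partial>M)"
    using P by (simp add: potential_Suc add_left_mono order_trans)
  also have "\<dots> = 2 * potential (Suc N) (\<lambda>t. f t * ?w t) t"
    by (subst (3) potential_Suc) (simp_all add: distrib_left)
  finally show ?case .
qed

text \<open>The function exp (- lam t) is an eigenfunction of one step of the walk, with the Laplace
  transform of \<open>M\<close> at \<open>lam\<close> as eigenvalue; each step therefore costs at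
  most a factor \<theta>.\<close>

lemma shift_iter_exp_le:
  assumes \<theta>: "(\<integral>\<^sup>+s. ennreal (exp (- lam * s)) \<partial>M) \<le> ennreal \<theta>" "\<theta> \<ge> 0"
    and f: "\<And>t. f t \<le> ennreal (c * exp (- lam * t))" "c \<ge> 0"
  shows "shift_iter f n t \<le> ennreal (c * \<theta> ^ n * exp (- lam * t))"
proof (induction n arbitrary: t)
  case (Suc n)
  have "shift_iter f (Suc n) t \<le> (\<integral>\<^sup>+s. ennreal (c * \<theta> ^ n * exp (- lam * t)) * ennreal (exp (- lam * s)) \<partial>M)"
    unfolding shift_iter.simps
    by (intro nn_integral_mono order.trans[OF Suc])
       (simp add: ennreal_mult'[symmetric] exp_add[symmetric] algebra_simps)
  also have "\<dots> \<le> ennreal (c * \<theta> ^ n * exp (- lam * t)) * ennreal \<theta>"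
    by (subst nn_integral_cmult) (use \<theta> in \<open>auto intro!: mult_left_mono\<close>)
  also have "\<dots> = ennreal (c * \<theta> ^ Suc n * exp (- lam * t))"
    using \<theta>(2) f(2) by (simp add: ennreal_mult'[symmetric] algebra_simps)
  finally show ?case .
qed (use f in auto)

lemma shift_iter_le_1: "(\<And>t. f t \<le> 1) \<Longrightarrow> shift_iter f n t \<le> 1"
proof (induction n arbitrary: t)
  case (Suc n)
  then have "shift_iter f (Suc n) t \<le> (\<integral>\<^sup>+s. 1 \<partial>M)"
    unfolding shift_iter.simps by (intro nn_integral_mono) auto
  then show ?case using emeasure_space_1 by simp
qed auto

text \<open>For a start inside the interval an exponential majorant and a geometric series bound the
  visits. Other starts would call for the first entrance time and the strong Markov property;
  \<open>potential_square_le\<close> replaces them at the price of a factor 2.\<close>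

lemma potential_interval_le:
  assumes \<theta>: "(\<integral>\<^sup>+s. ennreal (exp (- lam * s)) \<partial>M) \<le> ennreal \<theta>" "0 \<le> \<theta>" "\<theta> < 1" and "lam > 0"
  shows "potential N (indicator {T..T+1}) t \<le> ennreal (2 * exp lam / (1 - \<theta>))"
proof -
  let ?f = "indicator {T..T+1} :: real \<Rightarrow> ennreal"
  let ?K = "exp lam / (1 - \<theta>)"
  let ?v = "potential N ?f"
  have f_le: "?f t \<le> ennreal (exp (lam * (T + 1)) * exp (- lam * t))" for t
  proof (cases "t \<in> {T..T+1}")
    case True
    have "1 \<le> exp (lam * (T + 1)) * exp (- lam * t)"
      using mult_left_mono[of t "T + 1" lam] True \<open>lam > 0\<close>
      by (simp add: exp_add[symmetric] algebra_simps)
    then show ?thesis using True by (simp add: ennreal_leI flip: ennreal_1)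
  qed auto
  have v_le: "?v t \<le> ennreal ?K" if "t \<in> {T..T+1}" for t
  proof -
    have "?v t \<le> (\<Sum>n<N. ennreal (exp (lam * (T + 1)) * \<theta> ^ n * exp (- lam * t)))"
      unfolding potential_def using \<theta> by (intro sum_mono shift_iter_exp_le f_le) auto
    also have "\<dots> = ennreal (\<Sum>n<N. exp (lam * (T + 1)) * \<theta> ^ n * exp (- lam * t))"
      using \<theta> by (intro sum_ennreal) auto
    also have "\<dots> \<le> ennreal ?K"
    proof (rule ennreal_leI)
      have e: "exp (lam * (T + 1)) * exp (- lam * t) = exp (lam * (T + 1 - t))"
        by (simp add: exp_add[symmetric] algebra_simps)
      have "(\<Sum>n<N. exp (lam * (T + 1)) * \<theta> ^ n * exp (- lam * t)) =
        exp (lam * (T + 1 - t)) * (\<Sum>n<N. \<theta> ^ n)"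
        unfolding e[symmetric] sum_distrib_left by (intro sum.cong) (auto simp: mult_ac)
      also have "\<dots> \<le> exp lam * (1 / (1 - \<theta>))"
      proof (rule mult_mono)
        show "exp (lam * (T + 1 - t)) \<le> exp lam"
          using that \<open>lam > 0\<close> by (simp add: mult_le_cancel_left1)
        show "(\<Sum>n<N. \<theta> ^ n) \<le> 1 / (1 - \<theta>)"
          using \<theta> by (simp add: sum_gp_strict divide_right_mono)
      qed (use \<theta> in \<open>auto intro!: sum_nonneg\<close>)
      finally show "(\<Sum>n<N. exp (lam * (T + 1)) * \<theta> ^ n * exp (- lam * t)) \<le> ?K" by simp
    qed
    finally show ?thesis .
  qed
  have "(?v t)\<^sup>2 \<le> 2 * potential N (\<lambda>t. ?f t * ?v t) t"
    by (rule potential_square_le) measurable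
  \<comment> \<open>Where the indicator does not vanish, the start lies in the interval and the
    bound \<open>v_le\<close> applies.\<close>
  also have "\<dots> \<le> 2 * potential N (\<lambda>t. ennreal ?K * ?f t) t"
    by (intro mult_left_mono potential_mono) (auto simp: v_le split: split_indicator)
  also have "\<dots> = 2 * ennreal ?K * ?v t"
    by (simp add: potential_def shift_iter_cmult sum_distrib_left mult_ac)
  also have "2 * ennreal ?K = ennreal (2 * ?K)"
    using ennreal_mult'[of 2 ?K] by (simp del: times_divide_eq_right)
  finally have sq: "?v t * ?v t \<le> ennreal (2 * ?K) * ?v t"
    unfolding power2_eq_square .
  \<comment> \<open>A crude bound that depends on \<open>N\<close>; it only serves to cancel one
    factor \<open>?v t\<close> in the quadratic inequality.\<close>
  have "?v t \<le> (\<Sum>n<N. 1)"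
    unfolding potential_def by (intro sum_mono shift_iter_le_1) (simp split: split_indicator)
  then have "?v t \<noteq> \<top>" by (auto simp: top_unique)
  then obtain r where r: "?v t = ennreal r" "r \<ge> 0" by (cases "?v t") auto
  have "r * r \<le> 2 * ?K * r"
    using sq r \<theta> by (simp add: ennreal_mult'[symmetric] del: times_divide_eq_right)
  then have "r \<le> 2 * ?K"
    using r(2) \<theta> mult_right_le_imp_le[of r r "2 * ?K"] by (cases "r = 0") (simp_all del: times_divide_eq_right)
  then show ?thesis using r by (simp add: ennreal_leI)
qed

section \<open>Increments that vanish at infinity\<close>

text \<open>It suffices to avoid the countably many null intervals with rational end points.\<close>

lemma AE_in_support: "AE s in M. \<forall>d>0. measure M {s-d<..<s+d} > 0"
proof -
  have "AE s in M. measure M {of_rat p<..<of_rat q} = 0 \<longrightarrow> s \<notin> {of_rat p<..<of_rat q}" for p q :: rat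
  proof (cases "measure M {of_rat p<..<of_rat q} = 0")
    case True
    then have "{of_rat p<..<of_rat q} \<in> null_sets M"
      by (auto simp: null_sets_def emeasure_eq_measure)
    then have "AE s in M. s \<notin> {of_rat p<..<of_rat q}" by (rule AE_not_in)
    then show ?thesis by auto
  qed auto
  then have "AE s in M. \<forall>p q :: rat. measure M {of_rat p<..<of_rat q} = 0 \<longrightarrow> s \<notin> {of_rat p<..<of_rat q}"
    by (simp add: AE_all_countable)
  then show ?thesis
  proof eventually_elim
    case (elim s)
    show ?case
    proof (intro allI impI)
      fix d :: real assume "d > 0"
      obtain p :: rat where p: "s - d < of_rat p" "of_rat p < s"
        using of_rat_dense[of "s - d" s] \<open>d > 0\<close> by auto
      obtain q :: rat where q: "s < of_rat q" "of_rat q < s + d"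
        using of_rat_dense[of s "s + d"] \<open>d > 0\<close> by auto
      have "measure M {of_rat p<..<of_rat q} \<noteq> 0" using elim p q by auto
      moreover have "measure M {of_rat p<..<of_rat q} \<le> measure M {s-d<..<s+d}"
        using p q by (intro finite_measure_mono) auto
      moreover have "measure M {of_rat p<..<of_rat q} \<ge> 0" by simp
      ultimately show "measure M {s-d<..<s+d} > 0" by linarith
    qed
  qed
qed

lemma tendsto_measure_greaterThan: "((\<lambda>t. measure M {t<..}) \<longlongrightarrow> 0) at_top"
proof -
  have "measure M {t<..} = 1 - cdf M t" for t
    unfolding cdf_def using prob_compl[of "{..t}"] by (simp add: Compl_eq_Diff_UNIV[symmetric] Compl_atMost)
  moreover have "((\<lambda>t. 1 - cdf M t) \<longlongrightarrow> 1 - 1) at_top"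
    by (intro tendsto_intros cdf_lim_at_top_prob)
  ultimately show ?thesis by simp
qed

text \<open>The asymptotic form of the argument of Choquet and Deny: if \<open>f t - f (t - a)\<close> has a positive
  limit superior \<open>L\<close>, then values near \<open>L\<close> propagate from \<open>t\<close> to points near \<open>t - a\<close>, \<open>t - 2 a\<close>, \dots,
  so that \<open>f\<close> would be unbounded.\<close>

lemma eventually_increment_less:
  fixes f :: "real \<Rightarrow> real"
  assumes bounded: "\<And>t. \<bar>f t\<bar> \<le> B" and uc: "uniformly_continuous_on UNIV f"
    and lim: "((\<lambda>t. f t - (\<integral>s. f (t - s) \<partial>M)) \<longlongrightarrow> 0) at_top"
    and supp: "\<And>d. d > 0 \<Longrightarrow> measure M {a-d<..<a+d} > 0" and "e > 0"
  shows "eventually (\<lambda>t. f t - f (t - a) < e) at_top"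
proof (rule ccontr)
  assume not_ev: "\<not> ?thesis"
  define u where "u t = f t - f (t - a)" for t
  have meas [measurable]: "f \<in> borel_measurable borel"
    by (intro borel_measurable_continuous_onI uniformly_continuous_imp_continuous uc)
  have [measurable]: "u \<in> borel_measurable borel" unfolding u_def by measurable
  have u_bound: "\<bar>u t\<bar> \<le> 2 * B" for t
    using bounded[of t] bounded[of "t - a"] by (auto simp: u_def abs_le_iff)
  have B: "B \<ge> 0" using bounded[of 0] by linarith
  have freq: "frequently (\<lambda>t. u t \<ge> e) at_top"
    using not_ev by (simp add: frequently_def u_def not_le)
  \<comment> \<open>The infimum of the eventual upper bounds is the limit superior \<open>L\<close>
    of the increments \<open>u\<close>; it is a real number because \<open>f\<close> is
    bounded.\<close>
  define S where "S = {y. eventually (\<lambda>t. u t \<le> y) at_top}"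
  have S_ge: "y \<ge> e" if "y \<in> S" for y
  proof -
    have "frequently (\<lambda>t. u t \<ge> e \<and> u t \<le> y) at_top"
      using frequently_eventually_frequently[OF freq, of "\<lambda>t. u t \<le> y"] that by (simp add: S_def)
    then show ?thesis by (auto dest: frequently_ex)
  qed
  have S_ne: "2 * B \<in> S" using u_bound by (auto simp: S_def abs_le_iff)
  have S_bdd: "bdd_below S" using S_ge by (rule bdd_belowI)
  define L where "L = Inf S"
  have L: "L \<ge> e" unfolding L_def using S_ne S_ge by (intro cInf_greatest) auto
  have L_upper: "eventually (\<lambda>t. u t \<le> L + eps) at_top" if "eps > 0" for eps
  proof -
    have "S \<noteq> {}" using S_ne by auto
    then obtain y where y: "y \<in> S" "y < L + eps"
      using cInf_lessD[of S "L + eps"] \<open>eps > 0\<close> unfolding L_def by auto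
    then have "eventually (\<lambda>t. u t \<le> y) at_top" by (simp add: S_def)
    then show ?thesis by eventually_elim (use y in auto)
  qed
  have L_lower: "frequently (\<lambda>t. u t > L - eps) at_top" if "eps > 0" for eps
  proof -
    have "L - eps \<notin> S" using cInf_lower[OF _ S_bdd, of "L - eps"] that unfolding L_def by auto
    then show ?thesis by (simp add: S_def frequently_def not_less)
  qed
  \<comment> \<open>With this \<open>d\<close>, a move from \<open>t\<close> to a point within
    \<open>d\<close> of \<open>t - a\<close> still gains at least \<open>L / 2\<close>: the
    increment is above \<open>L - L / 4\<close> and the deviation costs less than
    \<open>L / 4\<close>.\<close>
  obtain d where d: "d > 0" "\<And>x y. \<bar>x - y\<bar> < d \<Longrightarrow> \<bar>f x - f y\<bar> < L / 4"
  proof -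
    have "L / 4 > 0" using L \<open>e > 0\<close> by simp
    with uc show thesis
      unfolding uniformly_continuous_on_def dist_real_def using that by (metis UNIV_I abs_minus_commute)
  qed
  define p where "p = measure M {a-d<..<a+d}"
  have p: "p > 0" using supp[OF d(1)] by (simp add: p_def)
  have int [simp]: "integrable M (\<lambda>s. f (t - s))" for t
    by (rule integrable_const_bound[of _ B]) (use bounded in auto)
  have int_u [simp]: "integrable M (\<lambda>s. u (t - s))" for t
    by (rule integrable_const_bound[of _ "2 * B"]) (use u_bound in auto)
  have int_ind [simp]: "integrable M (indicat_real A)" if "A \<in> sets borel" for A
    using that by (intro integrable_real_indicator) (auto simp: less_top[symmetric])
  define g where "g t = u t - (\<integral>s. u (t - s) \<partial>M)" for t
  have g_lim: "(g \<longlongrightarrow> 0) at_top"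
  proof -
    have shift: "filterlim (\<lambda>t. t - a) at_top at_top"
      by (rule filterlim_tendsto_add_at_top[of "\<lambda>_. -a" "-a", OF _ filterlim_ident, simplified])
    have geq: "g t = (f t - (\<integral>s. f (t - s) \<partial>M)) - (f (t - a) - (\<integral>s. f (t - a - s) \<partial>M))" for t
    proof -
      have "(\<integral>s. u (t - s) \<partial>M) = (\<integral>s. f (t - s) - f (t - a - s) \<partial>M)"
        by (simp add: u_def diff_diff_eq add.commute)
      then show ?thesis by (simp add: g_def u_def)
    qed
    have "((\<lambda>t. (f t - (\<integral>s. f (t - s) \<partial>M)) - (f (t - a) - (\<integral>s. f (t - a - s) \<partial>M))) \<longlongrightarrow> 0 - 0) at_top"
      by (intro tendsto_diff[of _ 0 _ _ 0] lim filterlim_compose[OF lim shift])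
    then show ?thesis unfolding geq[abs_def] by simp
  qed
  \<comment> \<open>If \<open>u t\<close> were almost \<open>L\<close> while
    \<open>u (t - s)\<close> stayed below \<open>L - eps\<close> for all \<open>s\<close> near
    \<open>a\<close>, the mass \<open>p\<close> near \<open>a\<close> would lower the mean of
    \<open>u (t - s)\<close> by \<open>eps * p\<close>; but that mean is asymptotically
    \<open>u t\<close>.\<close>
  have step: "\<exists>eps'>0. \<exists>T. \<forall>t\<ge>T. u t > L - eps' \<longrightarrow> (\<exists>s. \<bar>s - a\<bar> < d \<and> u (t - s) > L - eps)"
    if "eps > 0" for eps
  proof -
    \<comment> \<open>A quarter of the deficit \<open>eps * p\<close>: the three errors, from the
      upper bound \<open>L + k\<close>, the lower bound \<open>L - k\<close> and the vanishing
      terms, add up to \<open>3 * k\<close> only.\<close>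
    define k where "k = p * eps / 4"
    have k: "k > 0" using p that by (simp add: k_def)
    \<comment> \<open>Compensates for the jumps beyond \<open>t - T0\<close>, after which only the
      crude bound \<open>2 * B\<close> on \<open>u\<close> is known.\<close>
    define C where "C = 2 * B + L + eps"
    have C: "C > 0" using B L \<open>e > 0\<close> that by (simp add: C_def)
    obtain T0 where T0: "\<And>t. t \<ge> T0 \<Longrightarrow> u t \<le> L + k"
      using L_upper[OF k] by (auto simp: eventually_at_top_linorder)
    have "((\<lambda>t. C * measure M {t - T0<..} + g t) \<longlongrightarrow> C * 0 + 0) at_top"
      by (intro tendsto_intros g_lim filterlim_compose[OF tendsto_measure_greaterThan]
          filterlim_tendsto_add_at_top[of "\<lambda>_. -T0" "-T0", OF _ filterlim_ident, simplified])
    then have "eventually (\<lambda>t. C * measure M {t - T0<..} + g t < k) at_top"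
      using k by (intro order_tendstoD(2)[where a = k]) auto
    then obtain T where T: "\<And>t. t \<ge> T \<Longrightarrow> C * measure M {t - T0<..} + g t < k"
      by (auto simp: eventually_at_top_linorder)
    have "\<exists>s. \<bar>s - a\<bar> < d \<and> u (t - s) > L - eps" if t: "t \<ge> T" "u t > L - k" for t
    proof (rule ccontr)
      assume "\<not> ?thesis"
      then have le: "u (t - s) \<le> L - eps" if "s \<in> {a-d<..<a+d}" for s
        using that by (force simp: not_less abs_less_iff)
      have "u (t - s) \<le> (L + k) - eps * indicator {a-d<..<a+d} s + C * indicator {t - T0<..} s" for s
        using le[of s] T0[of "t - s"] u_bound[of "t - s"] C k L \<open>e > 0\<close> \<open>eps > 0\<close>
        by (auto simp: C_def abs_le_iff split: split_indicator)
      then have "(\<integral>s. u (t - s) \<partial>M) \<le>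
          (\<integral>s. (L + k) - eps * indicator {a-d<..<a+d} s + C * indicator {t - T0<..} s \<partial>M)"
        by (intro integral_mono Bochner_Integration.integrable_add Bochner_Integration.integrable_diff
            integrable_mult_right int_ind int_u integrable_const) auto
      also have "\<dots> = (L + k) - eps * p + C * measure M {t - T0<..}"
        by (simp add: p_def prob_space[simplified])
      finally have "u t \<le> L + k - eps * p + (C * measure M {t - T0<..} + g t)"
        by (simp add: g_def)
      with T[OF t(1)] have "u t < L + 2 * k - eps * p" by simp
      with t(2) have "eps * p < 3 * k" by simp
      then show False using p \<open>eps > 0\<close> by (simp add: k_def mult.commute)
    qed
    then show ?thesis using k by blast
  qed
  \<comment> \<open>The tolerances are chosen backwards: how close to \<open>L\<close> the start has
    to be is dictated by the closeness required one step later.\<close>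
  have chain: "\<exists>eps'>0. \<exists>T. \<forall>t\<ge>T. u t > L - eps' \<longrightarrow> (\<exists>t'. u t' > L - eps \<and> f t - f t' \<ge> of_nat n * (L / 2))"
    if "eps > 0" for eps n
  proof (induction n)
    case 0
    then show ?case using that by (intro exI[of _ eps]) auto
  next
    case (Suc n)
    then obtain eps1 T1 where 1: "eps1 > 0"
      "\<And>t. t \<ge> T1 \<Longrightarrow> u t > L - eps1 \<Longrightarrow> \<exists>t'. u t' > L - eps \<and> f t - f t' \<ge> of_nat n * (L / 2)"
      by blast
    obtain eps2 T2 where 2: "eps2 > 0"
      "\<And>t. t \<ge> T2 \<Longrightarrow> u t > L - eps2 \<Longrightarrow> \<exists>s. \<bar>s - a\<bar> < d \<and> u (t - s) > L - eps1"
      using step[OF 1(1)] by blast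
    have pos: "min eps2 (L / 4) > 0" using 2(1) L \<open>e > 0\<close> by simp
    have main: "\<exists>t'. u t' > L - eps \<and> f t - f t' \<ge> of_nat (Suc n) * (L / 2)"
      if t: "t \<ge> max T2 (T1 + \<bar>a\<bar> + d)" "u t > L - min eps2 (L / 4)" for t
    proof -
      have "t \<ge> T2" "u t > L - eps2" "u t > L - L / 4" using t by linarith+
      then obtain s where s: "\<bar>s - a\<bar> < d" "u (t - s) > L - eps1"
        using 2(2) by blast
      moreover have "t - s \<ge> T1" using s(1) t(1) by linarith
      ultimately obtain t' where t': "u t' > L - eps" "f (t - s) - f t' \<ge> of_nat n * (L / 2)"
        using 1(2) by blast
      have "\<bar>f (t - a) - f (t - s)\<bar> < L / 4" using s(1) by (intro d(2)) simp
      moreover have "f t - f (t - a) > L - L / 4" using \<open>u t > L - L / 4\<close> by (simp add: u_def)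
      ultimately have "f t - f (t - s) \<ge> L / 2" by linarith
      then have "f t - f t' \<ge> of_nat (Suc n) * (L / 2)" using t'(2) by (simp add: distrib_right add_divide_distrib)
      then show ?thesis using t'(1) by blast
    qed
    show ?case
      by (rule exI[of _ "min eps2 (L / 4)"], rule conjI[OF pos], rule exI[of _ "max T2 (T1 + \<bar>a\<bar> + d)"])
         (use main in blast)
  qed
  obtain n :: nat where n: "of_nat n * (L / 2) > 2 * B"
  proof -
    have "L / 2 > 0" using L \<open>e > 0\<close> by simp
    then show thesis using reals_Archimedean3[of "L / 2"] that by blast
  qed
  obtain eps' T where T: "eps' > 0"
    "\<And>t. t \<ge> T \<Longrightarrow> u t > L - eps' \<Longrightarrow> \<exists>t'. u t' > L - 1 \<and> f t - f t' \<ge> of_nat n * (L / 2)"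
    using chain[OF zero_less_one, of n] by blast
  have "frequently (\<lambda>t. u t > L - eps' \<and> t \<ge> T) at_top"
    using L_lower[OF T(1)] eventually_ge_at_top[of T] by (rule frequently_eventually_frequently)
  then obtain t where "u t > L - eps'" "t \<ge> T" by (auto dest: frequently_ex)
  then obtain t' where "f t - f t' \<ge> of_nat n * (L / 2)" using T(2) by blast
  then show False using n bounded[of t] bounded[of t'] by (auto simp: abs_le_iff)
qed

text \<open>The shifts whose increments vanish form a subgroup, closed by uniform continuity of
  \<open>f\<close>, that carries all mass of \<open>M\<close>. If it were not the whole line, it
  would lie in a lattice.\<close>

lemma tendsto_increment:
  fixes f :: "real \<Rightarrow> real"
  assumes nonarith: "\<not> (\<exists>h\<ge>0. AE s in M. \<exists>k::int. s = h * of_int k)"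
    and bounded: "\<And>t. \<bar>f t\<bar> \<le> B" and uc: "uniformly_continuous_on UNIV f"
    and lim: "((\<lambda>t. f t - (\<integral>s. f (t - s) \<partial>M)) \<longlongrightarrow> 0) at_top"
  shows "((\<lambda>t. f t - f (t - a)) \<longlongrightarrow> 0) at_top"
proof -
  define G where "G = {a. ((\<lambda>t. f t - f (t - a)) \<longlongrightarrow> 0) at_top}"
  have shift: "filterlim (\<lambda>t. t - c) at_top at_top" for c :: real
    by (rule filterlim_tendsto_add_at_top[of "\<lambda>_. -c" "-c", OF _ filterlim_ident, simplified])
  have diff: "x - y \<in> G" if "x \<in> G" "y \<in> G" for x y
  proof -
    have x: "((\<lambda>t. f t - f (t - x)) \<longlongrightarrow> 0) at_top" and y: "((\<lambda>t. f t - f (t - y)) \<longlongrightarrow> 0) at_top"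
      using that by (auto simp: G_def)
    have "((\<lambda>t. (f t - f (t - x)) - (f (t - (x - y)) - f (t - (x - y) - y))) \<longlongrightarrow> 0 - 0) at_top"
      by (intro tendsto_diff[of _ 0 _ _ 0] x filterlim_compose[OF y shift])
    then show ?thesis by (simp add: G_def)
  qed
  have closed: "closed G"
  proof (subst closure_subset_eq[symmetric], intro subsetI)
    fix x assume x: "x \<in> closure G"
    have "eventually (\<lambda>t. dist (f t - f (t - x)) 0 < e) at_top" if "e > 0" for e
    proof -
      obtain d where d: "d > 0" "\<And>x y. \<bar>x - y\<bar> < d \<Longrightarrow> \<bar>f x - f y\<bar> < e / 2"
        using uc \<open>e > 0\<close> unfolding uniformly_continuous_on_def dist_real_def
        by (metis UNIV_I abs_minus_commute half_gt_zero)
      obtain y where y: "y \<in> G" "\<bar>y - x\<bar> < d"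
        using x d(1) unfolding closure_approachable dist_real_def by blast
      have "((\<lambda>t. f t - f (t - y)) \<longlongrightarrow> 0) at_top" using y(1) by (simp add: G_def)
      then have "eventually (\<lambda>t. dist (f t - f (t - y)) 0 < e / 2) at_top"
        using \<open>e > 0\<close> by (intro tendstoD) auto
      then show ?thesis
      proof eventually_elim
        case (elim t)
        have "\<bar>f (t - x) - f (t - y)\<bar> < e / 2" using y(2) by (intro d(2)) simp
        with elim show ?case unfolding dist_real_def by linarith
      qed
    qed
    then show "x \<in> G" by (auto simp: G_def tendsto_iff)
  qed
  have "0 \<in> G" by (simp add: G_def)
  have "AE s in M. s \<in> G"
    using AE_in_support
  proof eventually_elim
    case (elim s)
    have "eventually (\<lambda>t. f t - f (t - s) < e) at_top" if "e > 0" for e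
      using elim that by (intro eventually_increment_less[OF bounded uc lim]) auto
    \<comment> \<open>The same one-sided bound for \<open>- f\<close> takes care of the limit
      inferior.\<close>
    moreover have "eventually (\<lambda>t. (- f t) - (- f (t - s)) < e) at_top" if "e > 0" for e
    proof (rule eventually_increment_less[where B = B])
      show "uniformly_continuous_on UNIV (\<lambda>t. - f t)" using uc by (rule uniformly_continuous_on_minus)
      show "((\<lambda>t. - f t - (\<integral>s. - f (t - s) \<partial>M)) \<longlongrightarrow> 0) at_top"
        using tendsto_minus[OF lim] by simp
    qed (use bounded elim that in auto)
    ultimately have "eventually (\<lambda>t. dist (f t - f (t - s)) 0 < e) at_top" if "e > 0" for e
      using eventually_conj[of "\<lambda>t. f t - f (t - s) < e" at_top "\<lambda>t. - f t - - f (t - s) < e"] that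
      by (force simp: dist_real_def abs_less_iff elim: eventually_mono)
    then show ?case by (simp add: G_def tendsto_iff)
  qed
  have "G = UNIV"
    using \<open>0 \<in> G\<close> diff closed
  proof (rule closed_subgroup_real_cases)
    fix h :: real assume h: "h \<ge> 0" "\<And>x. x \<in> G \<Longrightarrow> \<exists>k::int. x = h * of_int k"
    have "AE s in M. \<exists>k::int. s = h * of_int k"
      using \<open>AE s in M. s \<in> G\<close> by eventually_elim (rule h(2))
    then show ?thesis using nonarith h(1) by blast
  qed
  then show ?thesis by (auto simp: G_def)
qed

end

section \<open>The renewal equation integrated over half-lines\<close>

text \<open>Substitution x = T - s v. One formula covers both signs of \<open>s\<close>, as the
  steps of the walk may have either sign, and the factor \<open>s\<close> in front turns into the
  drift when integrated over \<open>M\<close>.\<close>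

lemma integral_increment_eq:
  fixes f :: "real \<Rightarrow> real"
  assumes int: "\<And>T. set_integrable lborel {..T} f" and [measurable]: "f \<in> borel_measurable borel"
  shows "(LINT x:{..T}|lborel. f x) - (LINT x:{..T-s}|lborel. f x) =
    s * (LINT v:{0..1}|lborel. f (T - s * v))"
proof (cases s "0 :: real" rule: linorder_cases)
  case equal
  then show ?thesis by simp
next
  case greater
  have "{..T} = {..T-s} \<union> {T-s<..T}" using greater by auto
  then have "(LINT x:{..T}|lborel. f x) = (LINT x:{..T-s}|lborel. f x) + (LINT x:{T-s<..T}|lborel. f x)"
    by (simp only:) (intro set_integral_Un int set_integrable_subset[OF int[of T]], auto)
  also have "(LINT x:{T-s<..T}|lborel. f x) = s * (LINT v:{0..<1}|lborel. f (T - s * v))"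
  proof -
    have "indicator {T-s<..T} (T + - s * v) = (indicator {0..<1} v :: real)" for v
      using greater by (auto simp: indicator_def zero_le_mult_iff)
    then show ?thesis
      unfolding set_lebesgue_integral_def using greater
      by (subst lborel_integral_real_affine[of "-s" _ T]) auto
  qed
  also have "(LINT v:{0..<1}|lborel. f (T - s * v)) = (LINT v:{0..1}|lborel. f (T - s * v))"
  proof (rule set_integral_cong_set)
    show "AE x in lborel. x \<in> {0..1::real} \<longleftrightarrow> x \<in> {0..<1}"
      using AE_lborel_singleton[of "1::real"] by eventually_elim auto
  qed (auto simp: set_borel_measurable_def)
  finally show ?thesis by simp
next
  case less
  have "{..T-s} = {..T} \<union> {T<..T-s}" using less by auto
  then have "(LINT x:{..T-s}|lborel. f x) = (LINT x:{..T}|lborel. f x) + (LINT x:{T<..T-s}|lborel. f x)"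
    by (simp only:) (intro set_integral_Un int set_integrable_subset[OF int[of "T - s"]], auto)
  also have "(LINT x:{T<..T-s}|lborel. f x) = - s * (LINT v:{0<..1}|lborel. f (T - s * v))"
  proof -
    have "indicator {T<..T-s} (T + - s * v) = (indicator {0<..1} v :: real)" for v
      using less by (auto simp: indicator_def mult_less_0_iff)
    then show ?thesis
      unfolding set_lebesgue_integral_def using less
      by (subst lborel_integral_real_affine[of "-s" _ T]) auto
  qed
  also have "(LINT v:{0<..1}|lborel. f (T - s * v)) = (LINT v:{0..1}|lborel. f (T - s * v))"
  proof (rule set_integral_cong_set)
    show "AE x in lborel. x \<in> {0..1::real} \<longleftrightarrow> x \<in> {0<..1}"
      using AE_lborel_singleton[of "0::real"] by eventually_elim auto
  qed (auto simp: set_borel_measurable_def)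
  finally show ?thesis by simp
qed

lemma set_integrable_unit_bounded:
  fixes f :: "real \<Rightarrow> real"
  assumes [measurable]: "f \<in> borel_measurable borel" and bounded: "\<And>t. \<bar>f t\<bar> \<le> B"
  shows "set_integrable lborel {0..1} f"
  unfolding set_integrable_def
  by (rule Bochner_Integration.integrable_bound[of _ "\<lambda>v. B * indicator {0..1} v"])
     (use bounded in \<open>auto split: split_indicator intro: order.trans[OF _ abs_ge_self]\<close>)

lemma integral_unit_increment_tendsto:
  fixes f :: "real \<Rightarrow> real"
  assumes [measurable]: "f \<in> borel_measurable borel" and bounded: "\<And>t. \<bar>f t\<bar> \<le> B"
    and lim: "\<And>a. ((\<lambda>t. f t - f (t - a)) \<longlongrightarrow> 0) at_top"
  shows "((\<lambda>T. (LINT v:{0..1}|lborel. f (T - s * v)) - f T) \<longlongrightarrow> 0) at_top"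
proof -
  have int: "set_integrable lborel {0..1} (\<lambda>v. f (T - s * v))" for T
    by (rule set_integrable_unit_bounded) (use bounded in auto)
  have "(LINT v:{0..1}|lborel. f (T - s * v)) - f T = - (LINT v:{0..1}|lborel. f T - f (T - s * v))" for T
  proof -
    have "set_integrable lborel {0..1::real} (\<lambda>v. f T)"
      unfolding set_integrable_def by simp
    moreover have "(LINT v:{0..1::real}|lborel. f T) = f T" by (simp add: set_lebesgue_integral_def)
    ultimately show ?thesis by (subst set_integral_diff(2)) (use int in auto)
  qed
  moreover have "((\<lambda>T. LINT v:{0..1}|lborel. f T - f (T - s * v)) \<longlongrightarrow> (LINT v:{0..1::real}|lborel. 0)) at_top"
    unfolding set_lebesgue_integral_def
  proof (rule integral_dominated_convergence_at_top[where w = "\<lambda>v. 2 * B * indicator {0..1} v"])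
    show "AE v in lborel. ((\<lambda>T. indicat_real {0..1} v *\<^sub>R (f T - f (T - s * v))) \<longlongrightarrow> indicat_real {0..1} v *\<^sub>R 0) at_top"
      by (intro AE_I2 tendsto_scaleR tendsto_const lim)
    have "norm (indicat_real {0..1} v *\<^sub>R (f T - f (T - s * v))) \<le> 2 * B * indicator {0..1} v" for T v
      using bounded[of T] bounded[of "T - s * v"] by (auto split: split_indicator simp: abs_le_iff)
    then show "\<forall>\<^sub>F T in at_top. AE v in lborel. norm (indicat_real {0..1} v *\<^sub>R (f T - f (T - s * v))) \<le> 2 * B * indicator {0..1} v"
      by (intro always_eventually allI AE_I2)
  qed simp_all
  ultimately show ?thesis
    using tendsto_minus[of "\<lambda>T. LINT v:{0..1}|lborel. f T - f (T - s * v)" 0] by simp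
qed

lemma nn_integral_translate:
  fixes f :: "real \<Rightarrow> ennreal"
  assumes "f \<in> borel_measurable borel"
  shows "(\<integral>\<^sup>+t. f (t + s) \<partial>lborel) = (\<integral>\<^sup>+t. f t \<partial>lborel)"
  using nn_integral_real_affine[OF assms, of 1 s] by (simp add: add.commute)

lemma nn_integral_exp_atMost:
  assumes "lam > (0::real)"
  shows "(\<integral>\<^sup>+t. ennreal (exp (lam * t)) * indicator {..T} t \<partial>lborel) = ennreal (exp (lam * T) / lam)"
proof -
  have "(\<integral>\<^sup>+t. ennreal (exp (lam * t)) * indicator {..T} t \<partial>lborel) =
      (\<integral>\<^sup>+t. ennreal (exp (- lam * t)) * indicator {- T..} t \<partial>lborel)"
  proof (subst nn_integral_real_affine[of _ "-1" 0])
    show "ennreal \<bar>-1\<bar> * (\<integral>\<^sup>+ x. ennreal (exp (lam * (0 + - 1 * x))) * indicator {..T} (0 + - 1 * x) \<partial>lborel) =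
      (\<integral>\<^sup>+ t. ennreal (exp (- lam * t)) * indicator {- T..} t \<partial>lborel)"
      by (auto intro!: nn_integral_cong split: split_indicator)
  qed auto
  also have "\<dots> = ennreal (0 - (- exp (- lam * (- T)) / lam))"
  proof (rule nn_integral_FTC_atLeast)
    show "((\<lambda>t. - exp (- lam * t) / lam) \<longlongrightarrow> 0) at_top"
    proof -
      have "filterlim (\<lambda>t. - lam * t) at_bot at_top"
        using assms by (intro filterlim_tendsto_neg_mult_at_bot[OF tendsto_const _ filterlim_ident]) auto
      then have "((\<lambda>t. exp (- lam * t)) \<longlongrightarrow> 0) at_top" by (rule filterlim_compose[OF exp_at_bot])
      then have "((\<lambda>t. - exp (- lam * t) / lam) \<longlongrightarrow> - 0 / lam) at_top"
        by (intro tendsto_intros) (use assms in auto)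
      then show ?thesis by simp
    qed
  qed (use assms in \<open>auto intro!: derivative_eq_intros\<close>)
  finally show ?thesis by simp
qed

context real_distribution
begin

sublocale pair_lborel: pair_sigma_finite M lborel ..

text \<open>Fubini and translation invariance move the convolution to the test function; with an
  indicator as \<open>h\<close> this evaluates integrals of the convolution over intervals.\<close>

lemma nn_integral_convolution_dual:
  assumes [measurable]: "f \<in> borel_measurable borel" "h \<in> borel_measurable borel"
  shows "(\<integral>\<^sup>+t. (\<integral>\<^sup>+s. f (t - s) \<partial>M) * h t \<partial>lborel) = (\<integral>\<^sup>+s. (\<integral>\<^sup>+t. f t * h (t + s) \<partial>lborel) \<partial>M)"
proof -
  have "(\<integral>\<^sup>+t. (\<integral>\<^sup>+s. f (t - s) \<partial>M) * h t \<partial>lborel) = (\<integral>\<^sup>+t. (\<integral>\<^sup>+s. f (t - s) * h t \<partial>M) \<partial>lborel)"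
    by (intro nn_integral_cong nn_integral_multc[symmetric]) simp
  also have "\<dots> = (\<integral>\<^sup>+s. (\<integral>\<^sup>+t. f (t - s) * h t \<partial>lborel) \<partial>M)"
    by (rule pair_lborel.Fubini') simp
  also have "\<dots> = (\<integral>\<^sup>+s. (\<integral>\<^sup>+t. f t * h (t + s) \<partial>lborel) \<partial>M)"
  proof (rule nn_integral_cong)
    fix s
    show "(\<integral>\<^sup>+t. f (t - s) * h t \<partial>lborel) = (\<integral>\<^sup>+t. f t * h (t + s) \<partial>lborel)"
      using nn_integral_translate[of "\<lambda>t. f (t - s) * h t" s] by simp
  qed
  finally show ?thesis .
qed

text \<open>The adjoint of convolution with \<open>M\<close> is the one-step operator behind
  \<open>shift_iter\<close>.\<close>

lemma nn_integral_convolution_dual':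
  assumes [measurable]: "f \<in> borel_measurable borel" "h \<in> borel_measurable borel"
  shows "(\<integral>\<^sup>+t. (\<integral>\<^sup>+s. f (t - s) \<partial>M) * h t \<partial>lborel) = (\<integral>\<^sup>+t. f t * (\<integral>\<^sup>+s. h (t + s) \<partial>M) \<partial>lborel)"
proof -
  have "(\<integral>\<^sup>+t. f t * (\<integral>\<^sup>+s. h (t + s) \<partial>M) \<partial>lborel) = (\<integral>\<^sup>+t. (\<integral>\<^sup>+s. f t * h (t + s) \<partial>M) \<partial>lborel)"
    by (intro nn_integral_cong nn_integral_cmult[symmetric]) simp
  also have "\<dots> = (\<integral>\<^sup>+s. (\<integral>\<^sup>+t. f t * h (t + s) \<partial>lborel) \<partial>M)"
    by (rule pair_lborel.Fubini') simp
  finally show ?thesis by (simp add: nn_integral_convolution_dual)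
qed

text \<open>Integrating the equation over \<open>{..T}\<close> gives on the left the mean, over \<open>s\<close>, of the integral of
  \<open>f\<close> from \<open>T - s\<close> to \<open>T\<close>; it is asymptotically \<open>s * f T\<close> because the increments of \<open>f\<close> vanish at
  infinity.\<close>

lemma smooth_renewal:
  fixes f g :: "real \<Rightarrow> real"
  assumes nonarith: "\<not> (\<exists>h\<ge>0. AE s in M. \<exists>k::int. s = h * of_int k)"
    and int_M: "integrable M (\<lambda>s. s)"
    and uc: "uniformly_continuous_on UNIV f"
    and f: "\<And>t. 0 \<le> f t" "\<And>t. f t \<le> B"
    and fin: "\<And>T. (\<integral>\<^sup>+t. ennreal (f t) * indicator {..T} t \<partial>lborel) < \<infinity>"
    and g: "\<And>t. 0 \<le> g t" "integrable lborel g" "(g \<longlongrightarrow> 0) at_top"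
    and renewal: "\<And>t. ennreal (f t) = (\<integral>\<^sup>+s. ennreal (f (t - s)) \<partial>M) + ennreal (g t)"
  shows "((\<lambda>T. (\<integral>s. s \<partial>M) * f T) \<longlongrightarrow> (\<integral>t. g t \<partial>lborel)) at_top"
proof -
  have [measurable]: "f \<in> borel_measurable borel"
    by (intro borel_measurable_continuous_onI uniformly_continuous_imp_continuous uc)
  have [measurable]: "g \<in> borel_measurable borel" using g(2) by (auto dest: borel_measurable_integrable)
  have B: "B \<ge> 0" using f[of 0] by linarith
  have f_abs: "\<bar>f t\<bar> \<le> B" for t using f[of t] by simp
  have int_f: "integrable M (\<lambda>s. f (t - s))" for t
    by (rule integrable_const_bound[of _ B]) (use f_abs in auto)
  have f_eq: "f t = (\<integral>s. f (t - s) \<partial>M) + g t" for t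
  proof -
    have "ennreal (f t) = ennreal (\<integral>s. f (t - s) \<partial>M) + ennreal (g t)"
      unfolding renewal[of t] using int_f[of t] f by (subst nn_integral_eq_integral) auto
    also have "\<dots> = ennreal ((\<integral>s. f (t - s) \<partial>M) + g t)"
      using f g by (intro ennreal_plus[symmetric]) auto
    finally show ?thesis using f g by (subst (asm) ennreal_inj) (auto intro!: add_nonneg_nonneg)
  qed
  have incr: "((\<lambda>t. f t - f (t - a)) \<longlongrightarrow> 0) at_top" for a
  proof (rule tendsto_increment[OF nonarith f_abs uc])
    have "f t - (\<integral>s. f (t - s) \<partial>M) = g t" for t using f_eq[of t] by simp
    then show "((\<lambda>t. f t - (\<integral>s. f (t - s) \<partial>M)) \<longlongrightarrow> 0) at_top" using g(3) by simp
  qed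
  have set_int: "set_integrable lborel {..T} f" for T
    unfolding set_integrable_def
  proof (rule integrableI_nonneg)
    have "ennreal (indicat_real {..T} x *\<^sub>R f x) = ennreal (f x) * indicator {..T} x" for x
      by (auto split: split_indicator)
    then show "(\<integral>\<^sup>+ x. ennreal (indicat_real {..T} x *\<^sub>R f x) \<partial>lborel) < \<infinity>" using fin[of T] by simp
  qed (use f in auto)
  define F where "F T = (LINT x:{..T}|lborel. f x)" for T
  have F_nn: "(\<integral>\<^sup>+t. ennreal (f t) * indicator {..T} t \<partial>lborel) = ennreal (F T)" for T
  proof -
    have "ennreal (indicat_real {..T} x *\<^sub>R f x) = ennreal (f x) * indicator {..T} x" for x
      by (auto split: split_indicator)
    then show ?thesis
      unfolding F_def set_lebesgue_integral_def using set_int[of T] f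
      by (subst nn_integral_eq_integral[symmetric]) (auto simp: set_integrable_def)
  qed
  have F_nonneg: "F T \<ge> 0" for T
    unfolding F_def set_lebesgue_integral_def using f by (intro Bochner_Integration.integral_nonneg) auto
  have F_meas [measurable]: "F \<in> borel_measurable borel"
  proof -
    have "mono F"
    proof (rule monoI)
      fix x y :: real assume "x \<le> y"
      then show "F x \<le> F y" unfolding F_def set_lebesgue_integral_def
        using f set_int by (intro integral_mono) (auto simp: set_integrable_def split: split_indicator)
    qed
    then show ?thesis by (rule borel_measurable_mono)
  qed
  have incF: "F T - F (T - s) = s * (LINT v:{0..1}|lborel. f (T - s * v))" for T s
    unfolding F_def by (rule integral_increment_eq) (use set_int in auto)
  have avg: "\<bar>LINT v:{0..1}|lborel. f (T - s * v)\<bar> \<le> B" for T s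
  proof -
    have "norm (LINT v:{0..1}|lborel. f (T - s * v)) \<le> (LINT v:{0..1::real}|lborel. B)"
      unfolding set_lebesgue_integral_def
      unfolding real_norm_def
    proof (rule integral_abs_bound_integral)
      show "integrable lborel (\<lambda>v. indicat_real {0..1} v *\<^sub>R f (T - s * v))"
        using set_integrable_unit_bounded[of "\<lambda>v. f (T - s * v)" B] f_abs by (simp add: set_integrable_def)
    qed (use f_abs in \<open>auto split: split_indicator\<close>)
    then show ?thesis by (simp add: set_lebesgue_integral_def)
  qed
  \<comment> \<open>\<open>F\<close> is Lipschitz, and \<open>M\<close> has a first moment; hence
    \<open>F (T - s)\<close> is integrable in \<open>s\<close> and may be subtracted in the
    integrated equation.\<close>
  have inc_bound: "\<bar>F T - F (T - s)\<bar> \<le> B * \<bar>s\<bar>" for T s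
    unfolding incF abs_mult mult.commute[of B] by (intro mult_left_mono avg) auto
  have int_abs: "integrable M (\<lambda>s. c * \<bar>s\<bar>)" for c using int_M by auto
  have int_inc: "integrable M (\<lambda>s. F T - F (T - s))" for T
    by (rule Bochner_Integration.integrable_bound[OF int_abs[of B]]) (use inc_bound B in \<open>auto simp: abs_mult\<close>)
  have int_F: "integrable M (\<lambda>s. F (T - s))" for T
    using Bochner_Integration.integrable_diff[OF integrable_const[of "F T"] int_inc[of T]] by simp
  have set_int_g: "set_integrable lborel {..T} g" for T
    unfolding set_integrable_def using g(2) by (intro integrable_mult_indicator) auto
  have main: "(\<integral>s. F T - F (T - s) \<partial>M) = (LINT t:{..T}|lborel. g t)" for T
  proof -
    have "ennreal (F T) = (\<integral>\<^sup>+t. ((\<integral>\<^sup>+s. ennreal (f (t - s)) \<partial>M) + ennreal (g t)) * indicator {..T} t \<partial>lborel)"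
      unfolding F_nn[symmetric] by (simp only: renewal[symmetric])
    also have "\<dots> = (\<integral>\<^sup>+t. (\<integral>\<^sup>+s. ennreal (f (t - s)) \<partial>M) * indicator {..T} t \<partial>lborel) +
        (\<integral>\<^sup>+t. ennreal (g t) * indicator {..T} t \<partial>lborel)"
      by (simp add: distrib_right nn_integral_add)
    also have "(\<integral>\<^sup>+t. (\<integral>\<^sup>+s. ennreal (f (t - s)) \<partial>M) * indicator {..T} t \<partial>lborel) =
        (\<integral>\<^sup>+s. (\<integral>\<^sup>+t. ennreal (f t) * indicator {..T} (t + s) \<partial>lborel) \<partial>M)"
      by (rule nn_integral_convolution_dual) auto
    also have "\<dots> = (\<integral>\<^sup>+s. ennreal (F (T - s)) \<partial>M)"
      unfolding F_nn[symmetric] by (intro nn_integral_cong) (auto split: split_indicator)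
    also have "\<dots> = ennreal (\<integral>s. F (T - s) \<partial>M)"
      using int_F F_nonneg by (intro nn_integral_eq_integral) auto
    also have "(\<integral>\<^sup>+t. ennreal (g t) * indicator {..T} t \<partial>lborel) = ennreal (LINT t:{..T}|lborel. g t)"
    proof -
      have "ennreal (indicat_real {..T} x *\<^sub>R g x) = ennreal (g x) * indicator {..T} x" for x
        by (auto split: split_indicator)
      then show ?thesis
        unfolding set_lebesgue_integral_def using set_int_g[of T] g
        by (subst nn_integral_eq_integral[symmetric]) (auto simp: set_integrable_def)
    qed
    also have "ennreal (\<integral>s. F (T - s) \<partial>M) + ennreal (LINT t:{..T}|lborel. g t) =
        ennreal ((\<integral>s. F (T - s) \<partial>M) + (LINT t:{..T}|lborel. g t))"
      using F_nonneg g unfolding set_lebesgue_integral_def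
      by (intro ennreal_plus[symmetric] Bochner_Integration.integral_nonneg) auto
    finally have "F T = (\<integral>s. F (T - s) \<partial>M) + (LINT t:{..T}|lborel. g t)"
      using F_nonneg g unfolding set_lebesgue_integral_def
      by (subst (asm) ennreal_inj) (auto intro!: add_nonneg_nonneg Bochner_Integration.integral_nonneg)
    then show ?thesis using int_F by (simp add: prob_space[simplified])
  qed
  have lim1: "((\<lambda>T. LINT t:{..T}|lborel. g t) \<longlongrightarrow> (\<integral>t. g t \<partial>lborel)) at_top"
    unfolding set_lebesgue_integral_def
  proof (rule integral_dominated_convergence_at_top[where w = "\<lambda>t. norm (g t)"])
    have "((\<lambda>T. indicat_real {..T} t *\<^sub>R g t) \<longlongrightarrow> g t) at_top" for t
    proof (rule tendsto_eventually)
      show "\<forall>\<^sub>F T in at_top. indicat_real {..T} t *\<^sub>R g t = g t"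
        using eventually_ge_at_top[of t] by eventually_elim auto
    qed
    then show "AE t in lborel. ((\<lambda>T. indicat_real {..T} t *\<^sub>R g t) \<longlongrightarrow> g t) at_top" by simp
    show "\<forall>\<^sub>F T in at_top. AE t in lborel. norm (indicat_real {..T} t *\<^sub>R g t) \<le> norm (g t)"
      by (intro always_eventually allI AE_I2) (auto split: split_indicator)
  qed (use g in auto)
  \<comment> \<open>The averages differ from \<open>f T\<close> by a quantity that vanishes for
    every fixed \<open>s\<close>; the first moment of \<open>M\<close> provides the dominating
    function.\<close>
  have lim2: "((\<lambda>T. \<integral>s. s * ((LINT v:{0..1}|lborel. f (T - s * v)) - f T) \<partial>M) \<longlongrightarrow> (\<integral>s. 0 \<partial>M)) at_top"
  proof (rule integral_dominated_convergence_at_top[where w = "\<lambda>s. 2 * B * \<bar>s\<bar>"])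
    show "(\<lambda>s. s * ((LINT v:{0..1}|lborel. f (T - s * v)) - f T)) \<in> borel_measurable M" for T
      unfolding set_lebesgue_integral_def by measurable
    have "((\<lambda>T. s * ((LINT v:{0..1}|lborel. f (T - s * v)) - f T)) \<longlongrightarrow> s * 0) at_top" for s
      by (intro tendsto_mult tendsto_const integral_unit_increment_tendsto[OF _ f_abs] incr) auto
    then show "AE s in M. ((\<lambda>T. s * ((LINT v:{0..1}|lborel. f (T - s * v)) - f T)) \<longlongrightarrow> 0) at_top"
      by simp
    have "norm (s * ((LINT v:{0..1}|lborel. f (T - s * v)) - f T)) \<le> 2 * B * \<bar>s\<bar>" for s T
    proof -
      have "\<bar>(LINT v:{0..1}|lborel. f (T - s * v)) - f T\<bar> \<le> 2 * B"
        using avg[of T s] f_abs[of T] by linarith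
      then show ?thesis by (simp add: abs_mult mult_right_mono mult.commute[of s] mult.commute[of "\<bar>s\<bar>"])
    qed
    then show "\<forall>\<^sub>F T in at_top. AE s in M. norm (s * ((LINT v:{0..1}|lborel. f (T - s * v)) - f T)) \<le> 2 * B * \<bar>s\<bar>"
      by (intro always_eventually allI AE_I2)
  qed (use int_abs in auto)
  have "(\<integral>s. s * ((LINT v:{0..1}|lborel. f (T - s * v)) - f T) \<partial>M) = (LINT t:{..T}|lborel. g t) - (\<integral>s. s \<partial>M) * f T" for T
  proof -
    have "(\<integral>s. s * ((LINT v:{0..1}|lborel. f (T - s * v)) - f T) \<partial>M) = (\<integral>s. (F T - F (T - s)) - s * f T \<partial>M)"
      by (simp add: incF right_diff_distrib)
    also have "\<dots> = (\<integral>s. F T - F (T - s) \<partial>M) - (\<integral>s. s * f T \<partial>M)"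
      using int_M by (intro Bochner_Integration.integral_diff int_inc) auto
    finally show ?thesis by (simp add: main)
  qed
  then have "((\<lambda>T. (LINT t:{..T}|lborel. g t) - ((LINT t:{..T}|lborel. g t) - (\<integral>s. s \<partial>M) * f T)) \<longlongrightarrow> (\<integral>t. g t \<partial>lborel) - 0) at_top"
    using lim2 by (intro tendsto_diff lim1) simp
  then show ?thesis by simp
qed

section \<open>The renewal theorem for exponentially weighted tails\<close>

context
  fixes r g :: "real \<Rightarrow> real" and C lam \<theta> \<alpha> :: real
  assumes nonarith: "\<not> (\<exists>h\<ge>0. AE s in M. \<exists>k::int. s = h * of_int k)"
    and int_M: "integrable M (\<lambda>s. s)"
    and \<theta>: "(\<integral>\<^sup>+s. ennreal (exp (- lam * s)) \<partial>M) \<le> ennreal \<theta>" "0 \<le> \<theta>" "\<theta> < 1" and lam: "lam > 0"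
    and [measurable]: "r \<in> borel_measurable borel"
    and r: "\<And>t. 0 \<le> r t" "\<And>t. r t \<le> C * exp (lam * t)"
    and decr: "\<And>t u. t \<le> u \<Longrightarrow> exp (- \<alpha> * u) * r u \<le> exp (- \<alpha> * t) * r t" and \<alpha>: "\<alpha> > 0"
    and g: "\<And>t. 0 \<le> g t" "integrable lborel g"
    and renewal: "\<And>t. ennreal (r t) = (\<integral>\<^sup>+s. ennreal (r (t - s)) \<partial>M) + ennreal (g t)"
begin

lemma C_nonneg: "C \<ge> 0"
  using r[of 0] by simp

lemma g_meas [measurable]: "g \<in> borel_measurable borel"
  using g(2) by (auto dest: borel_measurable_integrable)

text \<open>Integrating 1 - lam s \<le> exp (- lam s) gives 1 - lam * drift \<le> \<theta> <
  1.\<close>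

lemma drift_pos: "(\<integral>s. s \<partial>M) > 0"
proof -
  have int_exp: "integrable M (\<lambda>s. exp (- lam * s))"
    using \<theta>(1) by (intro integrableI_nonneg) (auto intro: order.strict_trans1)
  have "ennreal (\<integral>s. exp (- lam * s) \<partial>M) \<le> ennreal \<theta>"
    using \<theta>(1) by (subst nn_integral_eq_integral[OF int_exp, symmetric]) auto
  then have "(\<integral>s. exp (- lam * s) \<partial>M) \<le> \<theta>" using \<theta>(2) by (simp add: ennreal_le_iff)
  moreover have "(\<integral>s. 1 + - lam * s \<partial>M) \<le> (\<integral>s. exp (- lam * s) \<partial>M)"
    using int_M by (intro integral_mono int_exp exp_ge_add_one_self) auto
  moreover have "(\<integral>s. 1 + - lam * s \<partial>M) = 1 - lam * (\<integral>s. s \<partial>M)"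
    using int_M by (simp add: prob_space[simplified])
  ultimately have "lam * (\<integral>s. s \<partial>M) > 0" using \<theta>(3) by linarith
  then show ?thesis using lam by (simp add: zero_less_mult_iff)
qed

text \<open>All the regularity that \<open>r\<close> has: it may drop at once, but it rises at most
  like exp (\<alpha> u). This is what later links pointwise values with integrals.\<close>

lemma r_growth: "t \<le> u \<Longrightarrow> r u \<le> exp (\<alpha> * (u - t)) * r t"
proof -
  assume "t \<le> u"
  then have "exp (\<alpha> * u) * (exp (- \<alpha> * u) * r u) \<le> exp (\<alpha> * u) * (exp (- \<alpha> * t) * r t)"
    by (intro mult_left_mono decr) auto
  then show ?thesis
    by (simp add: mult.assoc[symmetric] exp_add[symmetric] right_diff_distrib)
qed

text \<open>The equation is iterated in weak form, so that all operators act on the test function.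
  The last term is the remainder that has to disappear as \<open>N\<close> grows.\<close>

lemma renewal_iterate:
  assumes [measurable]: "h \<in> borel_measurable borel"
  shows "(\<integral>\<^sup>+t. ennreal (r t) * h t \<partial>lborel) =
    (\<integral>\<^sup>+t. ennreal (g t) * potential N h t \<partial>lborel) + (\<integral>\<^sup>+t. ennreal (r t) * shift_iter h N t \<partial>lborel)"
proof (induction N)
  case 0
  then show ?case by (simp add: potential_def)
next
  case (Suc N)
  let ?k = "shift_iter h N"
  have "(\<integral>\<^sup>+t. ennreal (r t) * ?k t \<partial>lborel) =
      (\<integral>\<^sup>+t. (\<integral>\<^sup>+s. ennreal (r (t - s)) \<partial>M) * ?k t + ennreal (g t) * ?k t \<partial>lborel)"
    by (simp only: distrib_right[symmetric] renewal[symmetric])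
  also have "\<dots> = (\<integral>\<^sup>+t. (\<integral>\<^sup>+s. ennreal (r (t - s)) \<partial>M) * ?k t \<partial>lborel) + (\<integral>\<^sup>+t. ennreal (g t) * ?k t \<partial>lborel)"
    by (rule nn_integral_add) auto
  also have "(\<integral>\<^sup>+t. (\<integral>\<^sup>+s. ennreal (r (t - s)) \<partial>M) * ?k t \<partial>lborel) =
      (\<integral>\<^sup>+t. ennreal (r t) * shift_iter h (Suc N) t \<partial>lborel)"
    unfolding shift_iter.simps
    by (rule nn_integral_convolution_dual'[of "\<lambda>x. ennreal (r x)"]) auto
  finally show ?case
    unfolding Suc potential_def by (simp add: distrib_left nn_integral_add add_ac)
qed

text \<open>Integrating out one step multiplies the density exp (lam t) by at most \<theta>. As
  \<open>r\<close> is below a multiple of this density, the remainder of the iteration decays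
  geometrically.\<close>

lemma nn_integral_exp_shift_iter_le:
  assumes [measurable]: "h \<in> borel_measurable borel"
  shows "(\<integral>\<^sup>+t. ennreal (exp (lam * t)) * shift_iter h n t \<partial>lborel) \<le>
    ennreal (\<theta> ^ n) * (\<integral>\<^sup>+t. ennreal (exp (lam * t)) * h t \<partial>lborel)"
proof (induction n)
  case 0
  then show ?case by simp
next
  case (Suc n)
  have "(\<integral>\<^sup>+t. ennreal (exp (lam * t)) * shift_iter h (Suc n) t \<partial>lborel) =
      (\<integral>\<^sup>+t. (\<integral>\<^sup>+s. ennreal (exp (lam * (t - s))) \<partial>M) * shift_iter h n t \<partial>lborel)"
    unfolding shift_iter.simps
    by (rule nn_integral_convolution_dual'[of "\<lambda>x. ennreal (exp (lam * x))", symmetric]) auto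
  also have "\<dots> \<le> (\<integral>\<^sup>+t. ennreal \<theta> * (ennreal (exp (lam * t)) * shift_iter h n t) \<partial>lborel)"
  proof (rule nn_integral_mono)
    fix t
    have "(\<integral>\<^sup>+s. ennreal (exp (lam * (t - s))) \<partial>M) = (\<integral>\<^sup>+s. ennreal (exp (lam * t)) * ennreal (exp (- lam * s)) \<partial>M)"
      by (simp add: ennreal_mult'[symmetric] exp_add[symmetric] algebra_simps)
    also have "\<dots> \<le> ennreal (exp (lam * t)) * ennreal \<theta>"
      using \<theta>(1) by (subst nn_integral_cmult) (auto intro!: mult_left_mono)
    finally have "(\<integral>\<^sup>+s. ennreal (exp (lam * (t - s))) \<partial>M) * shift_iter h n t \<le>
        (ennreal (exp (lam * t)) * ennreal \<theta>) * shift_iter h n t"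
      by (rule mult_right_mono) simp
    then show "(\<integral>\<^sup>+s. ennreal (exp (lam * (t - s))) \<partial>M) * shift_iter h n t \<le>
        ennreal \<theta> * (ennreal (exp (lam * t)) * shift_iter h n t)"
      by (simp add: mult_ac)
  qed
  also have "\<dots> = ennreal \<theta> * (\<integral>\<^sup>+t. ennreal (exp (lam * t)) * shift_iter h n t \<partial>lborel)"
    by (rule nn_integral_cmult) measurable
  also have "\<dots> \<le> ennreal \<theta> * (ennreal (\<theta> ^ n) * (\<integral>\<^sup>+t. ennreal (exp (lam * t)) * h t \<partial>lborel))"
    by (intro mult_left_mono Suc) simp
  also have "\<dots> = ennreal (\<theta> ^ Suc n) * (\<integral>\<^sup>+t. ennreal (exp (lam * t)) * h t \<partial>lborel)"
    using \<theta>(2) by (simp add: ennreal_mult mult.assoc)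
  finally show ?case .
qed

text \<open>In the iterated equation the potential is bounded uniformly in \<open>N\<close> and in
  the position of the interval, while the remainder is of order \<open>\<theta> ^ N\<close>.\<close>

lemma integral_unit_interval_le:
  "(\<integral>\<^sup>+t. ennreal (r t) * indicator {T..T+1} t \<partial>lborel) \<le> ennreal (2 * exp lam / (1 - \<theta>) * (\<integral>t. g t \<partial>lborel))"
proof -
  let ?h = "indicator {T..T+1} :: real \<Rightarrow> ennreal" and ?K = "2 * exp lam / (1 - \<theta>)"
  define J where "J = (\<integral>\<^sup>+t. ennreal (exp (lam * t)) * ?h t \<partial>lborel)"
  have "J \<le> (\<integral>\<^sup>+t. ennreal (exp (lam * (T + 1))) * ?h t \<partial>lborel)"
    unfolding J_def using lam by (intro nn_integral_mono) (auto split: split_indicator)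
  also have "\<dots> = ennreal (exp (lam * (T + 1)))"
    by (subst nn_integral_cmult) auto
  finally have "J < \<top>" by (rule order.strict_trans1) simp
  then obtain j where j: "J = ennreal j" "j \<ge> 0" by (cases J) auto
  have gG: "(\<integral>\<^sup>+t. ennreal (g t) \<partial>lborel) = ennreal (\<integral>t. g t \<partial>lborel)"
    using g by (intro nn_integral_eq_integral) auto
  have bound: "(\<integral>\<^sup>+t. ennreal (r t) * ?h t \<partial>lborel) \<le> ennreal (?K * (\<integral>t. g t \<partial>lborel) + C * \<theta> ^ N * j)" for N
  proof -
    have "(\<integral>\<^sup>+t. ennreal (g t) * potential N ?h t \<partial>lborel) \<le> (\<integral>\<^sup>+t. ennreal (g t) * ennreal ?K \<partial>lborel)"
      by (intro nn_integral_mono mult_left_mono potential_interval_le[OF \<theta> lam]) auto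
    also have "\<dots> = ennreal (?K * (\<integral>t. g t \<partial>lborel))"
      using \<theta> by (subst nn_integral_multc) (auto simp: gG ennreal_mult'[symmetric] ennreal_mult''[symmetric] mult.commute)
    finally have 1: "(\<integral>\<^sup>+t. ennreal (g t) * potential N ?h t \<partial>lborel) \<le> ennreal (?K * (\<integral>t. g t \<partial>lborel))" .
    have "(\<integral>\<^sup>+t. ennreal (r t) * shift_iter ?h N t \<partial>lborel) \<le>
        (\<integral>\<^sup>+t. ennreal C * (ennreal (exp (lam * t)) * shift_iter ?h N t) \<partial>lborel)"
    proof (rule nn_integral_mono)
      fix t
      have "ennreal (r t) \<le> ennreal C * ennreal (exp (lam * t))"
        using r(2)[of t] C_nonneg by (subst ennreal_mult[symmetric]) (auto intro: ennreal_leI)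
      then show "ennreal (r t) * shift_iter ?h N t \<le> ennreal C * (ennreal (exp (lam * t)) * shift_iter ?h N t)"
        unfolding mult.assoc[symmetric] by (rule mult_right_mono) simp
    qed
    also have "\<dots> \<le> ennreal C * (ennreal (\<theta> ^ N) * J)"
      unfolding J_def
      by (subst nn_integral_cmult) (auto intro!: mult_left_mono nn_integral_exp_shift_iter_le)
    also have "\<dots> = ennreal (C * \<theta> ^ N * j)"
      using j \<theta> C_nonneg by (simp add: ennreal_mult mult.assoc)
    finally have 2: "(\<integral>\<^sup>+t. ennreal (r t) * shift_iter ?h N t \<partial>lborel) \<le> ennreal (C * \<theta> ^ N * j)" .
    have "(\<integral>\<^sup>+t. ennreal (r t) * ?h t \<partial>lborel) =
        (\<integral>\<^sup>+t. ennreal (g t) * potential N ?h t \<partial>lborel) + (\<integral>\<^sup>+t. ennreal (r t) * shift_iter ?h N t \<partial>lborel)"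
      by (rule renewal_iterate) simp
    also have "\<dots> \<le> ennreal (?K * (\<integral>t. g t \<partial>lborel)) + ennreal (C * \<theta> ^ N * j)"
      by (rule add_mono[OF 1 2])
    also have "\<dots> = ennreal (?K * (\<integral>t. g t \<partial>lborel) + C * \<theta> ^ N * j)"
      using \<theta> j C_nonneg g by (intro ennreal_plus[symmetric] mult_nonneg_nonneg Bochner_Integration.integral_nonneg) auto
    finally show ?thesis .
  qed
  have "(\<lambda>N. ennreal (?K * (\<integral>t. g t \<partial>lborel) + C * \<theta> ^ N * j)) \<longlonglongrightarrow> ennreal (?K * (\<integral>t. g t \<partial>lborel) + C * 0 * j)"
    using \<theta> by (intro tendsto_intros LIMSEQ_power_zero tendsto_ennrealI) auto
  then show ?thesis using bound
    by (intro LIMSEQ_le_const[where X = "\<lambda>N. ennreal (?K * (\<integral>t. g t \<partial>lborel) + C * \<theta> ^ N * j)"]) auto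
qed

text \<open>Throughout [t - 1, t] the function is at least \<open>exp (- \<alpha>) * r t\<close>, so
  a bound on integrals over unit intervals is a pointwise bound.\<close>

lemma r_bounded: obtains B where "B \<ge> 0" "\<And>t. r t \<le> B"
proof
  define K where "K = 2 * exp lam / (1 - \<theta>) * (\<integral>t. g t \<partial>lborel)"
  have K: "K \<ge> 0" unfolding K_def using \<theta> g by (intro mult_nonneg_nonneg Bochner_Integration.integral_nonneg) auto
  show "exp \<alpha> * K \<ge> 0" using K by simp
  fix t
  have "ennreal (exp (- \<alpha>) * r t) = (\<integral>\<^sup>+x. ennreal (exp (- \<alpha>) * r t) * indicator {t-1..t-1+1} x \<partial>lborel)"
    by (subst nn_integral_cmult) auto
  also have "\<dots> \<le> (\<integral>\<^sup>+x. ennreal (r x) * indicator {t-1..t-1+1} x \<partial>lborel)"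
  proof (intro nn_integral_mono)
    fix x
    have "exp (- \<alpha>) * r t \<le> r x" if "x \<in> {t-1..t}"
    proof -
      have "r t \<le> exp (\<alpha> * (t - x)) * r x" using that by (intro r_growth) auto
      also have "\<dots> \<le> exp \<alpha> * r x" using that \<alpha> r by (intro mult_right_mono) (auto simp: mult_le_cancel_left1)
      finally have "exp (- \<alpha>) * r t \<le> exp (- \<alpha>) * (exp \<alpha> * r x)" by (intro mult_left_mono) auto
      then show ?thesis by (simp add: mult.assoc[symmetric] exp_add[symmetric])
    qed
    then show "ennreal (exp (- \<alpha>) * r t) * indicator {t-1..t-1+1} x \<le> ennreal (r x) * indicator {t-1..t-1+1} x"
      by (auto split: split_indicator intro: ennreal_leI)
  qed
  also have "\<dots> \<le> ennreal K" unfolding K_def by (rule integral_unit_interval_le)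
  finally have "exp (- \<alpha>) * r t \<le> K" using K by (simp add: ennreal_le_iff)
  then have "exp \<alpha> * (exp (- \<alpha>) * r t) \<le> exp \<alpha> * K" by (intro mult_left_mono) auto
  then show "r t \<le> exp \<alpha> * K" by (simp add: mult.assoc[symmetric] exp_add[symmetric])
qed

section \<open>Averages over short windows\<close>

text \<open>Not divided by \<open>d\<close>. The averaging makes \<open>r\<close> Lipschitz, hence
  uniformly continuous, and turns the merely integrable \<open>g\<close> into a function vanishing
  at infinity; \<open>smooth_renewal\<close> asks for both.\<close>

definition window :: "real \<Rightarrow> (real \<Rightarrow> real) \<Rightarrow> real \<Rightarrow> real" where
  "window d w t = (\<integral>x. w x * indicator {t..t+d} x \<partial>lborel)"

lemma window_nn:
  assumes [measurable]: "w \<in> borel_measurable borel" and w: "\<And>x. 0 \<le> w x"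
    and int: "integrable lborel (\<lambda>x. w x * indicator {t..t+d} x)"
  shows "ennreal (window d w t) = (\<integral>\<^sup>+x. ennreal (w x) * indicator {t..t+d} x \<partial>lborel)"
proof -
  have "ennreal (w x * indicator {t..t+d} x) = ennreal (w x) * indicator {t..t+d} x" for x
    by (auto split: split_indicator)
  then show ?thesis
    unfolding window_def using int w by (subst nn_integral_eq_integral[symmetric]) auto
qed

lemma integrable_indicator_Icc [simp]: "integrable lborel (indicat_real {a..b})" for a b :: real
  by (rule integrable_real_indicator) (auto simp: emeasure_lborel_Icc_eq)

lemma integrable_r_window: "integrable lborel (\<lambda>x. r x * indicator {t..t+d} x)"
proof -
  obtain B where B: "B \<ge> 0" "\<And>t. r t \<le> B" using r_bounded by blast
  show ?thesis
    by (rule Bochner_Integration.integrable_bound[of _ "\<lambda>x. B * indicator {t..t+d} x"])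
       (use r(1) B in \<open>auto split: split_indicator\<close>)
qed

lemma integrable_g_window: "integrable lborel (\<lambda>x. g x * indicator {t..t+d} x)"
  using integrable_mult_indicator[OF _ g(2), of "{t..t+d}"] by (simp add: mult.commute)

lemma window_nonneg: "(\<And>x. 0 \<le> w x) \<Longrightarrow> window d w t \<ge> 0"
  unfolding window_def by (intro Bochner_Integration.integral_nonneg) auto

lemma window_g_tendsto: "(window d g \<longlongrightarrow> 0) at_top"
proof -
  have "((\<lambda>t. \<integral>x. g x * indicator {t..t+d} x \<partial>lborel) \<longlongrightarrow> (\<integral>x. 0 \<partial>(lborel :: real measure))) at_top"
  proof (rule integral_dominated_convergence_at_top[where w = "\<lambda>x. norm (g x)"])
    have "((\<lambda>t. g x * indicator {t..t+d} x) \<longlongrightarrow> 0) at_top" for x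
      by (rule tendsto_eventually, use eventually_gt_at_top[of x] in eventually_elim) auto
    then show "AE x in lborel. ((\<lambda>t. g x * indicator {t..t+d} x) \<longlongrightarrow> 0) at_top" by simp
    show "\<forall>\<^sub>F t in at_top. AE x in lborel. norm (g x * indicator {t..t+d} x) \<le> norm (g x)"
      by (intro always_eventually allI AE_I2) (auto split: split_indicator)
  qed (use g in auto)
  then show ?thesis by (simp add: window_def[abs_def])
qed

text \<open>Fubini: each \<open>x\<close> belongs to the windows whose left ends fill an interval of
  length \<open>d\<close>.\<close>

lemma window_g_nn_integral:
  assumes "d > 0"
  shows "(\<integral>\<^sup>+t. ennreal (window d g t) \<partial>lborel) = ennreal (d * (\<integral>x. g x \<partial>lborel))"
proof -
  have "(\<integral>\<^sup>+t. ennreal (window d g t) \<partial>lborel) = (\<integral>\<^sup>+t. (\<integral>\<^sup>+x. ennreal (g x) * indicator {x-d..x} t \<partial>lborel) \<partial>lborel)"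
  proof (rule nn_integral_cong)
    fix t
    show "ennreal (window d g t) = (\<integral>\<^sup>+x. ennreal (g x) * indicator {x-d..x} t \<partial>lborel)"
      unfolding window_nn[OF g_meas g(1) integrable_g_window]
      by (intro nn_integral_cong) (auto split: split_indicator)
  qed
  also have "\<dots> = (\<integral>\<^sup>+x. (\<integral>\<^sup>+t. ennreal (g x) * indicator {x-d..x} t \<partial>lborel) \<partial>lborel)"
  proof (rule lborel_pair.Fubini')
    \<comment> \<open>The moving interval is expressed by one closed subset of the plane, whose
      indicator is jointly measurable.\<close>
    have "(\<lambda>(x, t). ennreal (g x) * indicator {p. fst p - d \<le> snd p \<and> snd p \<le> fst p} (x, t)) \<in> borel_measurable (lborel \<Otimes>\<^sub>M (lborel :: real measure))"
      by measurable
    then show "(\<lambda>(x, t). ennreal (g x) * indicator {x-d..x} t) \<in> borel_measurable (lborel \<Otimes>\<^sub>M (lborel :: real measure))"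
      by (rule measurable_cong[THEN iffD1, rotated]) (auto split: split_indicator)
  qed
  also have "\<dots> = (\<integral>\<^sup>+x. ennreal (g x) * ennreal d \<partial>lborel)"
    using assms by (intro nn_integral_cong) (subst nn_integral_cmult, auto)
  also have "\<dots> = ennreal (d * (\<integral>x. g x \<partial>lborel))"
    using g assms by (subst nn_integral_multc) (auto simp: nn_integral_eq_integral ennreal_mult'' mult.commute)
  finally show ?thesis .
qed

lemma window_r_Lipschitz:
  assumes B: "\<And>t. r t \<le> B" and "t \<le> u"
  shows "\<bar>window d r u - window d r t\<bar> \<le> 2 * B * (u - t)"
proof -
  let ?k = "\<lambda>x. B * indicator {t..u} x + B * indicator {t+d..u+d} x"
  have bound: "\<bar>r x * indicator {u..u+d} x - r x * indicator {t..t+d} x\<bar> \<le> ?k x" for x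
    using B[of x] r(1)[of x] \<open>t \<le> u\<close> by (auto split: split_indicator)
  have "\<bar>window d r u - window d r t\<bar> = \<bar>\<integral>x. r x * indicator {u..u+d} x - r x * indicator {t..t+d} x \<partial>lborel\<bar>"
    unfolding window_def using integrable_r_window by (subst Bochner_Integration.integral_diff) auto
  also have "\<dots> \<le> (\<integral>x. ?k x \<partial>lborel)"
    by (rule integral_abs_bound_integral) (use bound integrable_r_window in \<open>auto intro!: Bochner_Integration.integrable_add\<close>)
  also have "\<dots> = 2 * B * (u - t)"
    using \<open>t \<le> u\<close> by (subst Bochner_Integration.integral_add) auto
  finally show ?thesis .
qed

lemma window_r_uniformly_continuous: "uniformly_continuous_on UNIV (window d r)"
proof -
  obtain B where B: "B \<ge> 0" "\<And>t. r t \<le> B" using r_bounded by blast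
  show ?thesis
    unfolding uniformly_continuous_on_def
  proof (intro allI impI)
    fix e :: real assume "e > 0"
    have *: "2 * B * y < e" if "0 \<le> y" "y < e / (2 * B + 1)" for y
    proof -
      have "2 * B * y \<le> (2 * B + 1) * y" using that B by (intro mult_right_mono) auto
      also have "\<dots> < e" using that(2) B(1) by (simp add: pos_less_divide_eq mult.commute)
      finally show ?thesis .
    qed
    have "dist (window d r x) (window d r y) < e" if "dist x y < e / (2 * B + 1)" for x y
    proof (cases "x \<le> y")
      case True
      then show ?thesis using window_r_Lipschitz[OF B(2) True, of d] *[of "y - x"] that
        by (simp add: dist_real_def)
    next
      case False
      then show ?thesis using window_r_Lipschitz[OF B(2), of y x d] *[of "x - y"] that
        by (simp add: dist_real_def)
    qed
    then show "\<exists>d'>0. \<forall>x\<in>UNIV. \<forall>x'\<in>UNIV. dist x' x < d' \<longrightarrow> dist (window d r x') (window d r x) < e"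
      using \<open>e > 0\<close> B(1) by (intro exI[of _ "e / (2 * B + 1)"]) auto
  qed
qed

text \<open>Averaging commutes with convolution, since a translate of a window is again a
  window.\<close>

lemma window_renewal:
  "ennreal (window d r t) = (\<integral>\<^sup>+s. ennreal (window d r (t - s)) \<partial>M) + ennreal (window d g t)"
proof -
  have "ennreal (window d r t) = (\<integral>\<^sup>+x. ((\<integral>\<^sup>+s. ennreal (r (x - s)) \<partial>M) + ennreal (g x)) * indicator {t..t+d} x \<partial>lborel)"
    by (simp only: renewal[symmetric] window_nn[OF _ r(1) integrable_r_window] \<open>r \<in> borel_measurable borel\<close>)
  also have "\<dots> = (\<integral>\<^sup>+x. (\<integral>\<^sup>+s. ennreal (r (x - s)) \<partial>M) * indicator {t..t+d} x \<partial>lborel) +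
      (\<integral>\<^sup>+x. ennreal (g x) * indicator {t..t+d} x \<partial>lborel)"
    by (simp add: distrib_right nn_integral_add)
  also have "(\<integral>\<^sup>+x. (\<integral>\<^sup>+s. ennreal (r (x - s)) \<partial>M) * indicator {t..t+d} x \<partial>lborel) =
      (\<integral>\<^sup>+s. (\<integral>\<^sup>+x. ennreal (r x) * indicator {t..t+d} (x + s) \<partial>lborel) \<partial>M)"
    by (rule nn_integral_convolution_dual[of "\<lambda>x. ennreal (r x)"]) auto
  also have "\<dots> = (\<integral>\<^sup>+s. ennreal (window d r (t - s)) \<partial>M)"
    unfolding window_nn[OF \<open>r \<in> borel_measurable borel\<close> r(1) integrable_r_window]
    by (intro nn_integral_cong) (auto split: split_indicator)
  also have "(\<integral>\<^sup>+x. ennreal (g x) * indicator {t..t+d} x \<partial>lborel) = ennreal (window d g t)"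
    by (rule window_nn[OF g_meas g(1) integrable_g_window, symmetric])
  finally show ?thesis .
qed

lemma window_r_le:
  assumes "d > 0"
  shows "window d r t \<le> d * (exp (\<alpha> * d) * r t)"
proof -
  have "r x \<le> exp (\<alpha> * d) * r t" if "x \<in> {t..t+d}" for x
  proof -
    have "r x \<le> exp (\<alpha> * (x - t)) * r t" using that by (intro r_growth) auto
    also have "\<dots> \<le> exp (\<alpha> * d) * r t" using that \<alpha> r by (intro mult_right_mono) auto
    finally show ?thesis .
  qed
  then have "window d r t \<le> (\<integral>x. exp (\<alpha> * d) * r t * indicator {t..t+d} x \<partial>lborel)"
    unfolding window_def using integrable_r_window by (intro integral_mono) (auto split: split_indicator)
  then show ?thesis using assms by (simp add: mult_ac)
qed

lemma window_r_ge:
  assumes "d > 0"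
  shows "d * r (t + d) \<le> exp (\<alpha> * d) * window d r t"
proof -
  have "r (t + d) \<le> exp (\<alpha> * d) * r x" if "x \<in> {t..t+d}" for x
  proof -
    have "r (t + d) \<le> exp (\<alpha> * (t + d - x)) * r x" using that by (intro r_growth) auto
    also have "\<dots> \<le> exp (\<alpha> * d) * r x" using that \<alpha> r by (intro mult_right_mono) auto
    finally show ?thesis .
  qed
  then have "(\<integral>x. r (t + d) * indicator {t..t+d} x \<partial>lborel) \<le> (\<integral>x. exp (\<alpha> * d) * (r x * indicator {t..t+d} x) \<partial>lborel)"
    using integrable_r_window by (intro integral_mono) (auto split: split_indicator)
  then show ?thesis using assms by (simp add: window_def mult.commute)
qed

text \<open>Convergence at minus infinity comes from the a priori bound by exp (lam t).\<close>

lemma window_r_finite: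
  assumes "d > 0"
  shows "(\<integral>\<^sup>+t. ennreal (window d r t) * indicator {..T} t \<partial>lborel) < \<infinity>"
proof -
  have "(\<integral>\<^sup>+t. ennreal (window d r t) * indicator {..T} t \<partial>lborel) \<le>
      (\<integral>\<^sup>+t. ennreal (d * exp (\<alpha> * d) * C) * (ennreal (exp (lam * t)) * indicator {..T} t) \<partial>lborel)"
  proof (rule nn_integral_mono)
    fix t
    have "window d r t \<le> d * (exp (\<alpha> * d) * r t)" by (rule window_r_le) fact
    also have "\<dots> \<le> d * (exp (\<alpha> * d) * (C * exp (lam * t)))"
      using assms r by (intro mult_left_mono) auto
    finally have "ennreal (window d r t) \<le> ennreal (d * exp (\<alpha> * d) * C * exp (lam * t))"
      by (simp add: mult.assoc ennreal_leI)
    then show "ennreal (window d r t) * indicator {..T} t \<le>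
        ennreal (d * exp (\<alpha> * d) * C) * (ennreal (exp (lam * t)) * indicator {..T} t)"
      using assms C_nonneg by (auto simp: ennreal_mult[symmetric] split: split_indicator)
  qed
  also have "\<dots> = ennreal (d * exp (\<alpha> * d) * C) * (\<integral>\<^sup>+t. ennreal (exp (lam * t)) * indicator {..T} t \<partial>lborel)"
    by (rule nn_integral_cmult) auto
  also have "\<dots> < \<infinity>"
    by (simp add: nn_integral_exp_atMost[OF lam] ennreal_mult_less_top)
  finally show ?thesis .
qed

lemma window_r_tendsto:
  assumes "d > 0"
  shows "(window d r \<longlongrightarrow> d * (\<integral>x. g x \<partial>lborel) / (\<integral>s. s \<partial>M)) at_top"
proof -
  obtain B where B: "B \<ge> 0" "\<And>t. r t \<le> B" using r_bounded by blast
  have nn: "(\<integral>\<^sup>+t. ennreal (window d g t) \<partial>lborel) = ennreal (d * (\<integral>x. g x \<partial>lborel))"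
    by (rule window_g_nn_integral) fact
  have [measurable]: "window d g \<in> borel_measurable borel"
  proof -
    have "(\<lambda>(t, x). g x * indicator {p. fst p \<le> snd p \<and> snd p \<le> fst p + d} (t, x)) \<in> borel_measurable (borel \<Otimes>\<^sub>M (lborel :: real measure))"
      by measurable
    then have "(\<lambda>(t, x). g x * indicator {t..t+d} x) \<in> borel_measurable (borel \<Otimes>\<^sub>M (lborel :: real measure))"
      by (rule measurable_cong[THEN iffD1, rotated]) (auto split: split_indicator)
    then show ?thesis
      unfolding window_def[abs_def] by (rule lborel.borel_measurable_lebesgue_integral)
  qed
  have int: "integrable lborel (window d g)"
    using nn by (intro integrableI_nonneg) (auto simp: window_nonneg g)
  have "(\<integral>t. window d g t \<partial>lborel) = d * (\<integral>x. g x \<partial>lborel)"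
    using nn assms g by (subst integral_eq_nn_integral)
      (auto simp: window_nonneg intro!: enn2real_ennreal mult_nonneg_nonneg Bochner_Integration.integral_nonneg)
  moreover have "((\<lambda>T. (\<integral>s. s \<partial>M) * window d r T) \<longlongrightarrow> (\<integral>t. window d g t \<partial>lborel)) at_top"
  proof (rule smooth_renewal[OF nonarith int_M window_r_uniformly_continuous])
    fix t
    have "window d r t \<le> d * (exp (\<alpha> * d) * r t)" by (rule window_r_le) fact
    also have "\<dots> \<le> d * (exp (\<alpha> * d) * B)"
      using assms B by (intro mult_left_mono) auto
    finally show "window d r t \<le> d * (exp (\<alpha> * d) * B)" .
  qed (rule window_nonneg[OF r(1)] window_nonneg[OF g(1)] int window_g_tendsto window_renewal window_r_finite[OF assms])+
  ultimately have "((\<lambda>T. (\<integral>s. s \<partial>M) * window d r T / (\<integral>s. s \<partial>M)) \<longlongrightarrow> d * (\<integral>x. g x \<partial>lborel) / (\<integral>s. s \<partial>M)) at_top"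
    using drift_pos by (intro tendsto_divide) auto
  then show ?thesis using drift_pos by simp
qed

text \<open>The integral over a window is compared with \<open>r\<close> at the left end from above
  and at the right end from below, each time up to a factor exp (\<alpha> d). Since this factor
  tends to 1 as \<open>d\<close> shrinks, the limits for fixed \<open>d\<close> enclose
  \<open>r\<close>.\<close>

theorem renewal_tendsto: "(r \<longlongrightarrow> (\<integral>x. g x \<partial>lborel) / (\<integral>s. s \<partial>M)) at_top"
proof (rule order_tendstoI)
  define c where "c = (\<integral>x. g x \<partial>lborel) / (\<integral>s. s \<partial>M)"
  have small: "((\<lambda>d. exp (\<alpha> * d) * c) \<longlongrightarrow> exp (\<alpha> * 0) * c) (at_right 0)"
    "((\<lambda>d. exp (- \<alpha> * d) * c) \<longlongrightarrow> exp (- \<alpha> * 0) * c) (at_right 0)"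
    by (intro tendsto_intros)+
  have lim: "((\<lambda>t. window d r t / d) \<longlongrightarrow> c) at_top" if "d > 0" for d
    using tendsto_divide[OF window_r_tendsto[OF that] tendsto_const[of d]] that by (simp add: c_def)
  {
    fix y assume "y < (\<integral>x. g x \<partial>lborel) / (\<integral>s. s \<partial>M)"
    then have "eventually (\<lambda>d. y < exp (- \<alpha> * d) * c) (at_right 0)"
      by (intro order_tendstoD(1)[OF small(2)]) (simp add: c_def)
    then have "eventually (\<lambda>d. y < exp (- \<alpha> * d) * c \<and> d > 0) (at_right 0)"
      using eventually_at_right_less[of "0::real"] by (rule eventually_conj)
    then obtain d where d: "y < exp (- \<alpha> * d) * c" "d > 0"
      using eventually_happens'[of "at_right (0::real)"] trivial_limit_at_right_real by blast
    have "((\<lambda>t. exp (- \<alpha> * d) * (window d r t / d)) \<longlongrightarrow> exp (- \<alpha> * d) * c) at_top"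
      by (intro tendsto_intros lim d)
    then have "eventually (\<lambda>t. y < exp (- \<alpha> * d) * (window d r t / d)) at_top"
      by (rule order_tendstoD) (rule d)
    then show "eventually (\<lambda>t. y < r t) at_top"
    proof eventually_elim
      case (elim t)
      have "window d r t / d \<le> exp (\<alpha> * d) * r t"
        using window_r_le[OF d(2), of t] d(2) by (simp add: divide_le_eq mult.commute)
      then have "exp (- \<alpha> * d) * (window d r t / d) \<le> exp (- \<alpha> * d) * (exp (\<alpha> * d) * r t)"
        by (intro mult_left_mono) auto
      with elim show ?case by (simp add: mult.assoc[symmetric] exp_add[symmetric])
    qed
  }
  {
    fix y assume "y > (\<integral>x. g x \<partial>lborel) / (\<integral>s. s \<partial>M)"
    then have "eventually (\<lambda>d. y > exp (\<alpha> * d) * c) (at_right 0)"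
      by (intro order_tendstoD(2)[OF small(1)]) (simp add: c_def)
    then have "eventually (\<lambda>d. y > exp (\<alpha> * d) * c \<and> d > 0) (at_right 0)"
      using eventually_at_right_less[of "0::real"] by (rule eventually_conj)
    then obtain d where d: "y > exp (\<alpha> * d) * c" "d > 0"
      using eventually_happens'[of "at_right (0::real)"] trivial_limit_at_right_real by blast
    \<comment> \<open>The window is shifted by \<open>d\<close> so that \<open>t\<close> becomes its
      right end.\<close>
    have "((\<lambda>t. exp (\<alpha> * d) * (window d r (t - d) / d)) \<longlongrightarrow> exp (\<alpha> * d) * c) at_top"
      by (intro tendsto_mult tendsto_const filterlim_compose[OF lim[OF d(2)]]
        filterlim_tendsto_add_at_top[of "\<lambda>_. -d" "-d", OF _ filterlim_ident, simplified])
    then have "eventually (\<lambda>t. y > exp (\<alpha> * d) * (window d r (t - d) / d)) at_top"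
      by (rule order_tendstoD) (rule d)
    then show "eventually (\<lambda>t. y > r t) at_top"
    proof eventually_elim
      case (elim t)
      have "r t \<le> exp (\<alpha> * d) * (window d r (t - d) / d)"
        using window_r_ge[OF d(2), of "t - d"] d(2) by (simp add: le_divide_eq mult.commute)
      with elim show ?case by simp
    qed
  }
qed

end

end

section \<open>Implicit renewal theory\<close>

text \<open>The power lies strictly below the chord over [0, \<alpha>]. The inequality 1 + x < exp x
  is used at the multiples \<alpha> - \<beta> and - \<beta> of \<open>ln a\<close>, whose mean with
  weights \<beta> / \<alpha> and 1 - \<beta> / \<alpha> is zero.\<close>

lemma powr_less_convex_combination:
  fixes a :: real
  assumes "a > 0" "a \<noteq> 1" "0 < \<beta>" "\<beta> < \<alpha>"
  shows "a powr \<beta> < \<beta> / \<alpha> * a powr \<alpha> + (1 - \<beta> / \<alpha>)"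
proof -
  define z where "z = ln a"
  have "z \<noteq> 0" using assms by (simp add: z_def)
  have strict: "1 + x < exp x" if "x \<noteq> 0" for x :: real
  proof -
    have "1 + x \<noteq> exp x" using ln_eq_minus_one[of "exp x"] that by auto
    then show ?thesis using exp_ge_add_one_self[of x] by linarith
  qed
  have p: "0 < \<beta> / \<alpha>" "\<beta> / \<alpha> < 1" using assms by auto
  have "1 + (\<alpha> - \<beta>) * z < exp ((\<alpha> - \<beta>) * z)" by (rule strict) (use assms \<open>z \<noteq> 0\<close> in auto)
  moreover have "1 + - \<beta> * z < exp (- \<beta> * z)" by (rule strict) (use assms \<open>z \<noteq> 0\<close> in auto)
  ultimately have "\<beta> / \<alpha> * (1 + (\<alpha> - \<beta>) * z) + (1 - \<beta> / \<alpha>) * (1 + - \<beta> * z) <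
      \<beta> / \<alpha> * exp ((\<alpha> - \<beta>) * z) + (1 - \<beta> / \<alpha>) * exp (- \<beta> * z)"
    using p by (intro add_strict_mono mult_strict_left_mono) auto
  also have "\<beta> / \<alpha> * (1 + (\<alpha> - \<beta>) * z) + (1 - \<beta> / \<alpha>) * (1 + - \<beta> * z) = 1"
    using assms by (simp add: field_simps)
  finally have "exp (\<beta> * z) * 1 < exp (\<beta> * z) * (\<beta> / \<alpha> * exp ((\<alpha> - \<beta>) * z) + (1 - \<beta> / \<alpha>) * exp (- \<beta> * z))"
    by (intro mult_strict_left_mono) auto
  also have "\<dots> = \<beta> / \<alpha> * (exp (\<beta> * z) * exp ((\<alpha> - \<beta>) * z)) + (1 - \<beta> / \<alpha>) * (exp (\<beta> * z) * exp (- \<beta> * z))"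
    by (simp add: distrib_left mult_ac)
  also have "\<dots> = \<beta> / \<alpha> * exp (\<alpha> * z) + (1 - \<beta> / \<alpha>)"
    by (simp add: exp_add[symmetric] algebra_simps)
  finally show ?thesis using assms by (simp add: powr_def z_def)
qed

lemma powr_le_convex_combination:
  fixes a :: real
  assumes "a > 0" "0 < \<beta>" "\<beta> < \<alpha>"
  shows "a powr \<beta> \<le> \<beta> / \<alpha> * a powr \<alpha> + (1 - \<beta> / \<alpha>)"
  using powr_less_convex_combination[OF assms(1) _ assms(2,3)] by (cases "a = 1") auto

lemma nn_integral_exp_powr:
  assumes "\<alpha> > 0" "q \<ge> 0"
  shows "(\<integral>\<^sup>+t. ennreal (exp (\<alpha> * t)) * indicator {t. exp t < q} t \<partial>lborel) = ennreal (q powr \<alpha> / \<alpha>)"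
proof (cases "q = 0")
  case True
  have "{t. exp t < (0::real)} = {}" by (auto simp: not_less less_imp_le)
  then show ?thesis using True by simp
next
  case False
  then have q: "q > 0" using assms by simp
  have "(\<integral>\<^sup>+t. ennreal (exp (\<alpha> * t)) * indicator {t. exp t < q} t \<partial>lborel) =
      (\<integral>\<^sup>+t. ennreal (exp (\<alpha> * t)) * indicator {..ln q} t \<partial>lborel)"
  proof (rule nn_integral_cong_AE)
    show "AE t in lborel. ennreal (exp (\<alpha> * t)) * indicator {t. exp t < q} t = ennreal (exp (\<alpha> * t)) * indicator {..ln q} t"
      using AE_lborel_singleton[of "ln q"]
    proof eventually_elim
      case (elim t)
      have "exp t < q \<longleftrightarrow> t \<le> ln q" using q elim by (metis exp_less_cancel_iff exp_ln less_eq_real_def)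
      then show ?case by (auto split: split_indicator)
    qed
  qed
  then show ?thesis using q by (simp add: nn_integral_exp_atMost[OF assms(1)] powr_def)
qed

context prob_space
begin

text \<open>Here the lattice is the degenerate one with \<open>h = 0\<close>.\<close>

lemma non_arithmetic_not_one:
  fixes Y :: "'a \<Rightarrow> real"
  assumes "non_arithmetic M (\<lambda>\<omega>. ln (Y \<omega>))"
  shows "\<not> (AE \<omega> in M. Y \<omega> = 1)"
proof
  assume "AE \<omega> in M. Y \<omega> = 1"
  then have "AE \<omega> in M. \<exists>k::int. ln (Y \<omega>) = 0 * of_int k" by eventually_elim simp
  then show False using assms unfolding non_arithmetic_def by blast
qed

text \<open>The chord has mean 1. Equality of the means would make a pointwise strict inequality an
  equality almost surely, which is possible only for A = 1. These moments are the contraction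
  factors of the whole development.\<close>

lemma moment_less_one:
  fixes A :: "'a \<Rightarrow> real"
  assumes [measurable]: "A \<in> borel_measurable M" and pos: "AE \<omega> in M. A \<omega> > 0" and nt: "\<not> (AE \<omega> in M. A \<omega> = 1)"
    and int: "integrable M (\<lambda>\<omega>. A \<omega> powr \<alpha>)" and one: "(\<integral>\<omega>. A \<omega> powr \<alpha> \<partial>M) = 1"
    and \<beta>: "0 < \<beta>" "\<beta> < \<alpha>"
  shows "integrable M (\<lambda>\<omega>. A \<omega> powr \<beta>)" "(\<integral>\<omega>. A \<omega> powr \<beta> \<partial>M) < 1"
proof -
  let ?b = "\<lambda>\<omega>. \<beta> / \<alpha> * A \<omega> powr \<alpha> + (1 - \<beta> / \<alpha>)"
  have p: "0 < \<beta> / \<alpha>" "\<beta> / \<alpha> < 1" using \<beta> by auto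
  have le: "AE \<omega> in M. A \<omega> powr \<beta> \<le> ?b \<omega>"
    using pos by eventually_elim (rule powr_le_convex_combination[OF _ \<beta>])
  have int_b: "integrable M ?b" using int by auto
  show int_\<beta>: "integrable M (\<lambda>\<omega>. A \<omega> powr \<beta>)"
  proof (rule Bochner_Integration.integrable_bound[OF int_b])
    show "AE \<omega> in M. norm (A \<omega> powr \<beta>) \<le> norm (?b \<omega>)" using le by eventually_elim simp
  qed simp
  show "(\<integral>\<omega>. A \<omega> powr \<beta> \<partial>M) < 1"
  proof (rule ccontr)
    assume "\<not> ?thesis"
    moreover have "(\<integral>\<omega>. ?b \<omega> \<partial>M) = 1"
      using int one by (simp add: prob_space)
    ultimately have "(\<integral>\<omega>. ?b \<omega> - A \<omega> powr \<beta> \<partial>M) \<le> 0"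
      using int_b int_\<beta> by simp
    moreover have nn: "AE \<omega> in M. 0 \<le> ?b \<omega> - A \<omega> powr \<beta>" using le by eventually_elim simp
    then have "(\<integral>\<omega>. ?b \<omega> - A \<omega> powr \<beta> \<partial>M) \<ge> 0" by (rule integral_nonneg_AE)
    ultimately have "(\<integral>\<omega>. ?b \<omega> - A \<omega> powr \<beta> \<partial>M) = 0" by simp
    then have "AE \<omega> in M. ?b \<omega> - A \<omega> powr \<beta> = 0"
      using integral_nonneg_eq_0_iff_AE[OF _ nn] int_b int_\<beta> by auto
    then have "AE \<omega> in M. A \<omega> = 1"
      using pos by eventually_elim (use powr_less_convex_combination[OF _ _ \<beta>] in fastforce)
    then show False using nt by blast
  qed
qed

text \<open>\<^const>\<open>prob_space.indep_var\<close> requires both variables to have the same type.\<close>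

definition indep_rv :: "'b measure \<Rightarrow> ('a \<Rightarrow> 'b) \<Rightarrow> 'c measure \<Rightarrow> ('a \<Rightarrow> 'c) \<Rightarrow> bool" where
  "indep_rv S X T Y \<longleftrightarrow> random_variable S X \<and> random_variable T Y \<and>
    distr M S X \<Otimes>\<^sub>M distr M T Y = distr M (S \<Otimes>\<^sub>M T) (\<lambda>\<omega>. (X \<omega>, Y \<omega>))"

lemma indep_rv_nn_integral:
  assumes "indep_rv S X T Y" and [measurable]: "f \<in> borel_measurable (S \<Otimes>\<^sub>M T)"
  shows "(\<integral>\<^sup>+\<omega>. f (X \<omega>, Y \<omega>) \<partial>M) = (\<integral>\<^sup>+\<omega>. (\<integral>\<^sup>+\<omega>'. f (X \<omega>, Y \<omega>') \<partial>M) \<partial>M)"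
proof -
  have [measurable]: "X \<in> M \<rightarrow>\<^sub>M S" "Y \<in> M \<rightarrow>\<^sub>M T"
    and eq: "distr M S X \<Otimes>\<^sub>M distr M T Y = distr M (S \<Otimes>\<^sub>M T) (\<lambda>x. (X x, Y x))"
    using assms(1) unfolding indep_rv_def by auto
  interpret Y: prob_space "distr M T Y" by (rule prob_space_distr) simp
  have "(\<integral>\<^sup>+\<omega>. f (X \<omega>, Y \<omega>) \<partial>M) = (\<integral>\<^sup>+p. f p \<partial>distr M (S \<Otimes>\<^sub>M T) (\<lambda>x. (X x, Y x)))"
    by (subst nn_integral_distr) auto
  also have "\<dots> = (\<integral>\<^sup>+x. (\<integral>\<^sup>+y. f (x, y) \<partial>distr M T Y) \<partial>distr M S X)"
    unfolding eq[symmetric] by (rule Y.nn_integral_fst[symmetric]) simp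
  also have "\<dots> = (\<integral>\<^sup>+\<omega>. (\<integral>\<^sup>+y. f (X \<omega>, y) \<partial>distr M T Y) \<partial>M)"
    by (subst nn_integral_distr) auto
  also have "\<dots> = (\<integral>\<^sup>+\<omega>. (\<integral>\<^sup>+\<omega>'. f (X \<omega>, Y \<omega>') \<partial>M) \<partial>M)"
    by (intro nn_integral_cong, subst nn_integral_distr)
       (auto intro!: measurable_compose[OF measurable_Pair1'] dest: measurable_space[OF \<open>X \<in> M \<rightarrow>\<^sub>M S\<close>])
  finally show ?thesis .
qed

lemma nn_integral_distr_eq:
  assumes [measurable]: "X \<in> M \<rightarrow>\<^sub>M N" "Y \<in> M \<rightarrow>\<^sub>M N" "f \<in> borel_measurable N"
    and eq: "distr M N X = distr M N Y"
  shows "(\<integral>\<^sup>+\<omega>. f (X \<omega>) \<partial>M) = (\<integral>\<^sup>+\<omega>. f (Y \<omega>) \<partial>M)"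
proof -
  have "(\<integral>\<^sup>+\<omega>. f (X \<omega>) \<partial>M) = (\<integral>\<^sup>+x. f x \<partial>distr M N X)" by (simp add: nn_integral_distr)
  also have "\<dots> = (\<integral>\<^sup>+\<omega>. f (Y \<omega>) \<partial>M)" unfolding eq by (simp add: nn_integral_distr)
  finally show ?thesis .
qed

lemma tail_Markov:
  fixes X :: "'a \<Rightarrow> real"
  assumes [measurable]: "X \<in> borel_measurable M" and nonneg: "AE \<omega> in M. X \<omega> \<ge> 0"
    and int: "integrable M (\<lambda>\<omega>. X \<omega> powr \<beta>)" and "\<beta> > 0" "y > 0"
  shows "prob {\<omega>\<in>space M. X \<omega> > y} \<le> (\<integral>\<omega>. X \<omega> powr \<beta> \<partial>M) * y powr - \<beta>"
proof -
  have "prob {\<omega>\<in>space M. X \<omega> > y} \<le> prob {\<omega>\<in>space M. y powr \<beta> \<le> X \<omega> powr \<beta>}"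
    using assms by (intro finite_measure_mono) (auto intro!: powr_mono2)
  also have "\<dots> \<le> (\<integral>\<omega>. X \<omega> powr \<beta> \<partial>M) / y powr \<beta>"
    using assms by (intro integral_Markov_inequality_measure[where A = "{}"]) auto
  finally show ?thesis by (simp add: powr_minus divide_inverse)
qed

section \<open>Tails of solutions of X = A X + D in law\<close>

context
  fixes A X D :: "'a \<Rightarrow> real" and \<alpha> \<beta> :: real
  assumes A_meas [measurable]: "A \<in> borel_measurable M" and X_meas [measurable]: "X \<in> borel_measurable M"
    and D_meas [measurable]: "D \<in> borel_measurable M"
    and A_pos: "AE \<omega> in M. A \<omega> > 0" and D_pos: "AE \<omega> in M. D \<omega> > 0" and X_nonneg: "AE \<omega> in M. X \<omega> \<ge> 0"
    and indep: "indep_rv borel A borel X"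
    and fixed_point: "distr M borel (\<lambda>\<omega>. A \<omega> * X \<omega> + D \<omega>) = distr M borel X"
    and nonarith: "non_arithmetic M (\<lambda>\<omega>. ln (A \<omega>))"
    and int_A: "integrable M (\<lambda>\<omega>. A \<omega> powr \<alpha>)" and one: "(\<integral>\<omega>. A \<omega> powr \<alpha> \<partial>M) = 1"
    and int_ln: "integrable M (\<lambda>\<omega>. A \<omega> powr \<alpha> * max (ln (A \<omega>)) 0)"
    and \<beta>: "0 < \<beta>" "\<beta> < \<alpha>" and int_X: "integrable M (\<lambda>\<omega>. X \<omega> powr \<beta>)"
    and int_D: "integrable M (\<lambda>\<omega>. (A \<omega> * X \<omega> + D \<omega>) powr \<alpha> - (A \<omega> * X \<omega>) powr \<alpha>)"
begin

text \<open>A probability measure because the moment of order \<alpha> is 1. The density compensates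
  for the change of the weight exp (\<alpha> t) when \<open>t\<close> is shifted by
  \<open>ln A\<close>.\<close>

definition tilted_law :: "real measure" where
  "tilted_law = distr (density M (\<lambda>\<omega>. ennreal (A \<omega> powr \<alpha>))) borel (\<lambda>\<omega>. ln (A \<omega>))"

definition scaled_tail :: "real \<Rightarrow> real" where
  "scaled_tail t = exp (\<alpha> * t) * prob {\<omega>\<in>space M. X \<omega> > exp t}"

text \<open>The event that the level separates \<open>A X\<close> from \<open>A X + D\<close>. It is
  the only place where \<open>D\<close> enters the equation, so \<open>D\<close> may depend on
  \<open>X\<close>; the half-open form fits the strict inequality in
  \<open>scaled_tail\<close>.\<close>

definition tail_gap :: "real \<Rightarrow> real" where
  "tail_gap t = exp (\<alpha> * t) * prob {\<omega>\<in>space M. A \<omega> * X \<omega> \<le> exp t \<and> exp t < A \<omega> * X \<omega> + D \<omega>}"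

lemma nn_integral_tilted_law:
  assumes [measurable]: "f \<in> borel_measurable borel"
  shows "(\<integral>\<^sup>+s. f s \<partial>tilted_law) = (\<integral>\<^sup>+\<omega>. ennreal (A \<omega> powr \<alpha>) * f (ln (A \<omega>)) \<partial>M)"
  unfolding tilted_law_def by (simp add: nn_integral_distr nn_integral_density)

lemma nn_integral_A_powr: "(\<integral>\<^sup>+\<omega>. ennreal (A \<omega> powr \<alpha>) \<partial>M) = 1"
  using int_A one by (subst nn_integral_eq_integral) auto

lemma real_distribution_tilted_law: "real_distribution tilted_law"
proof -
  have "prob_space tilted_law"
  proof (rule prob_spaceI)
    have "emeasure tilted_law (space tilted_law) = (\<integral>\<^sup>+s. 1 \<partial>tilted_law)" by simp
    also have "\<dots> = 1" by (subst nn_integral_tilted_law) (auto simp: nn_integral_A_powr)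
    finally show "emeasure tilted_law (space tilted_law) = 1" .
  qed
  then show ?thesis by (simp add: real_distribution_def real_distribution_axioms_def tilted_law_def)
qed

lemma tilted_law_nonarithmetic: "\<not> (\<exists>h\<ge>0. AE s in tilted_law. \<exists>k::int. s = h * of_int k)"
proof
  assume "\<exists>h\<ge>0. AE s in tilted_law. \<exists>k::int. s = h * of_int k"
  then obtain h where h: "h \<ge> 0" "AE s in tilted_law. \<exists>k::int. s = h * of_int k" by blast
  have "{s. \<exists>k::int. s = h * of_int k} = range (\<lambda>k::int. h * of_int k)" by auto
  moreover have "range (\<lambda>k::int. h * of_int k) \<in> sets borel"
    by (rule sets.countable) auto
  ultimately have [measurable]: "{s. \<exists>k::int. s = h * of_int k} \<in> sets borel"
    by simp
  have "AE \<omega> in density M (\<lambda>\<omega>. ennreal (A \<omega> powr \<alpha>)). \<exists>k::int. ln (A \<omega>) = h * of_int k"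
    using h(2) unfolding tilted_law_def by (subst (asm) AE_distr_iff) auto
  then have "AE \<omega> in M. 0 < ennreal (A \<omega> powr \<alpha>) \<longrightarrow> (\<exists>k::int. ln (A \<omega>) = h * of_int k)"
    by (subst (asm) AE_density) auto
  then have "AE \<omega> in M. \<exists>k::int. ln (A \<omega>) = h * of_int k"
    using A_pos by eventually_elim auto
  then show False using nonarith h(1) unfolding non_arithmetic_def by blast
qed

lemma not_AE_one: "\<not> (AE \<omega> in M. A \<omega> = 1)"
  using nonarith by (rule non_arithmetic_not_one)

text \<open>For \<open>A\<close> above 1 this is the logarithmic moment in the hypotheses. Below 1
  the weight tames the logarithm: a^\<alpha> (- ln a) is at most 1 / \<alpha>, by ln y \<le> y - 1
  at y = a^(-\<alpha>).\<close>

lemma integrable_tilted_law: "integrable tilted_law (\<lambda>s. s)"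
proof -
  have bound: "\<bar>a powr \<alpha> * ln a\<bar> \<le> a powr \<alpha> * max (ln a) 0 + 1 / \<alpha>" if "a > 0" for a :: real
  proof (cases "a \<ge> 1")
    case True
    then show ?thesis using \<beta> by (simp add: abs_mult)
  next
    case False
    have "ln (a powr - \<alpha>) \<le> a powr - \<alpha> - 1" using that by (intro ln_le_minus_one) simp
    then have "a powr \<alpha> * (\<alpha> * - ln a) \<le> a powr \<alpha> * (a powr - \<alpha>)"
      using that by (intro mult_left_mono) (auto simp: ln_powr)
    also have "\<dots> = 1" using that by (simp add: powr_add[symmetric])
    finally have "\<alpha> * (a powr \<alpha> * - ln a) \<le> 1" by (simp add: mult_ac)
    then have "a powr \<alpha> * - ln a \<le> 1 / \<alpha>" using \<beta> by (simp add: pos_le_divide_eq mult.commute)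
    then show ?thesis using False that by (simp add: abs_mult)
  qed
  have "integrable M (\<lambda>\<omega>. A \<omega> powr \<alpha> * ln (A \<omega>))"
  proof (rule Bochner_Integration.integrable_bound)
    show "integrable M (\<lambda>\<omega>. A \<omega> powr \<alpha> * max (ln (A \<omega>)) 0 + 1 / \<alpha>)" using int_ln by auto
    show "AE \<omega> in M. norm (A \<omega> powr \<alpha> * ln (A \<omega>)) \<le> norm (A \<omega> powr \<alpha> * max (ln (A \<omega>)) 0 + 1 / \<alpha>)"
      using A_pos by eventually_elim (unfold real_norm_def, rule order.trans[OF bound abs_ge_self])
  qed simp
  then show ?thesis
    unfolding tilted_law_def by (simp add: integrable_distr_eq integrable_density)
qed

text \<open>The tilt shifts exponents by \<alpha>, so the Laplace transform at \<alpha> - \<beta> is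
  a moment of order \<beta>, which \<open>moment_less_one\<close> places below 1.\<close>

lemma nn_integral_tilted_exp:
  "(\<integral>\<^sup>+s. ennreal (exp (- (\<alpha> - \<beta>) * s)) \<partial>tilted_law) = ennreal (\<integral>\<omega>. A \<omega> powr \<beta> \<partial>M)"
proof -
  have "(\<integral>\<^sup>+s. ennreal (exp (- (\<alpha> - \<beta>) * s)) \<partial>tilted_law) =
      (\<integral>\<^sup>+\<omega>. ennreal (A \<omega> powr \<alpha>) * ennreal (exp (- (\<alpha> - \<beta>) * ln (A \<omega>))) \<partial>M)"
    by (rule nn_integral_tilted_law) simp
  also have "\<dots> = (\<integral>\<^sup>+\<omega>. ennreal (A \<omega> powr \<beta>) \<partial>M)"
  proof (rule nn_integral_cong_AE)
    show "AE \<omega> in M. ennreal (A \<omega> powr \<alpha>) * ennreal (exp (- (\<alpha> - \<beta>) * ln (A \<omega>))) = ennreal (A \<omega> powr \<beta>)"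
      using A_pos by eventually_elim
        (simp add: ennreal_mult'[symmetric] powr_def exp_add[symmetric] algebra_simps)
  qed
  also have "\<dots> = ennreal (\<integral>\<omega>. A \<omega> powr \<beta> \<partial>M)"
    using moment_less_one(1)[OF A_meas A_pos not_AE_one int_A one \<beta>] by (intro nn_integral_eq_integral) auto
  finally show ?thesis .
qed

lemma scaled_tail_nn:
  "ennreal (scaled_tail t) = ennreal (exp (\<alpha> * t)) * (\<integral>\<^sup>+\<omega>. indicator {exp t<..} (X \<omega>) \<partial>M)"
proof -
  have "(\<integral>\<^sup>+\<omega>. indicator {exp t<..} (X \<omega>) \<partial>M) = (\<integral>\<^sup>+\<omega>. indicator {\<omega>\<in>space M. X \<omega> > exp t} \<omega> \<partial>M)"
    by (intro nn_integral_cong) (auto split: split_indicator)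
  also have "\<dots> = emeasure M {\<omega>\<in>space M. X \<omega> > exp t}" by (rule nn_integral_indicator) measurable
  finally show ?thesis by (simp add: scaled_tail_def emeasure_eq_measure ennreal_mult)
qed

lemma tail_gap_nn:
  "ennreal (tail_gap t) = ennreal (exp (\<alpha> * t)) *
    (\<integral>\<^sup>+\<omega>. indicator {A \<omega> * X \<omega>..<A \<omega> * X \<omega> + D \<omega>} (exp t) \<partial>M)"
proof -
  have "(\<integral>\<^sup>+\<omega>. indicator {A \<omega> * X \<omega>..<A \<omega> * X \<omega> + D \<omega>} (exp t) \<partial>M) =
      (\<integral>\<^sup>+\<omega>. indicator {\<omega>\<in>space M. A \<omega> * X \<omega> \<le> exp t \<and> exp t < A \<omega> * X \<omega> + D \<omega>} \<omega> \<partial>M)"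
    by (intro nn_integral_cong) (auto split: split_indicator)
  also have "\<dots> = emeasure M {\<omega>\<in>space M. A \<omega> * X \<omega> \<le> exp t \<and> exp t < A \<omega> * X \<omega> + D \<omega>}"
    by (rule nn_integral_indicator) measurable
  finally show ?thesis by (simp add: tail_gap_def emeasure_eq_measure ennreal_mult)
qed

lemma scaled_tail_meas [measurable]: "scaled_tail \<in> borel_measurable borel"
proof -
  have "mono (\<lambda>t. - prob {\<omega>\<in>space M. X \<omega> > exp t})"
    by (intro monoI) (auto intro!: finite_measure_mono elim: order.strict_trans1[rotated])
  then have "(\<lambda>t. - prob {\<omega>\<in>space M. X \<omega> > exp t}) \<in> borel_measurable borel" by (rule borel_measurable_mono)
  then have "(\<lambda>t. - (- prob {\<omega>\<in>space M. X \<omega> > exp t})) \<in> borel_measurable borel" by (rule borel_measurable_uminus)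
  then have [measurable]: "(\<lambda>t. prob {\<omega>\<in>space M. X \<omega> > exp t}) \<in> borel_measurable borel" by simp
  show ?thesis unfolding scaled_tail_def[abs_def] by measurable
qed

text \<open>Unlike \<open>scaled_tail\<close>, the gap is not a monotone probability times a weight;
  measurability comes from writing it as a parametrised integral over a fixed measurable set of
  pairs.\<close>

lemma tail_gap_meas [measurable]: "tail_gap \<in> borel_measurable borel"
proof -
  have "(\<lambda>t. enn2real (ennreal (exp (\<alpha> * t)) *
      (\<integral>\<^sup>+\<omega>. indicator {p. A (snd p) * X (snd p) \<le> exp (fst p) \<and> exp (fst p) < A (snd p) * X (snd p) + D (snd p)} (t, \<omega>) \<partial>M))) \<in> borel_measurable borel"
    by measurable
  moreover have "enn2real (ennreal (exp (\<alpha> * t)) *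
      (\<integral>\<^sup>+\<omega>. indicator {p. A (snd p) * X (snd p) \<le> exp (fst p) \<and> exp (fst p) < A (snd p) * X (snd p) + D (snd p)} (t, \<omega>) \<partial>M)) = tail_gap t" for t
  proof -
    have "(\<integral>\<^sup>+\<omega>. indicator {p. A (snd p) * X (snd p) \<le> exp (fst p) \<and> exp (fst p) < A (snd p) * X (snd p) + D (snd p)} (t, \<omega>) \<partial>M) =
        (\<integral>\<^sup>+\<omega>. indicator {A \<omega> * X \<omega>..<A \<omega> * X \<omega> + D \<omega>} (exp t) \<partial>M)"
      by (intro nn_integral_cong) (auto split: split_indicator)
    moreover have "0 \<le> tail_gap t" by (simp add: tail_gap_def)
    ultimately show ?thesis by (simp only: tail_gap_nn[symmetric] enn2real_ennreal)
  qed
  ultimately show ?thesis by simp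
qed

text \<open>Fubini: for a fixed outcome, exp (\<alpha> t) integrated over p \<le> exp t < q gives
  (q^\<alpha> - p^\<alpha>) / \<alpha>. Only the difference of the powers has to be
  integrable.\<close>

lemma nn_integral_tail_gap:
  "(\<integral>\<^sup>+t. ennreal (tail_gap t) \<partial>lborel) =
    ennreal ((\<integral>\<omega>. (A \<omega> * X \<omega> + D \<omega>) powr \<alpha> - (A \<omega> * X \<omega>) powr \<alpha> \<partial>M) / \<alpha>)"
proof -
  interpret pair_sigma_finite M "lborel :: real measure" ..
  have \<alpha>: "\<alpha> > 0" using \<beta> by simp
  have "(\<integral>\<^sup>+t. ennreal (tail_gap t) \<partial>lborel) = (\<integral>\<^sup>+t. (\<integral>\<^sup>+\<omega>. ennreal (exp (\<alpha> * t)) *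
      indicator {p. A (fst p) * X (fst p) \<le> exp (snd p) \<and> exp (snd p) < A (fst p) * X (fst p) + D (fst p)} (\<omega>, t) \<partial>M) \<partial>lborel)"
  proof (intro nn_integral_cong)
    fix t
    have "ennreal (tail_gap t) = (\<integral>\<^sup>+\<omega>. ennreal (exp (\<alpha> * t)) * indicator {A \<omega> * X \<omega>..<A \<omega> * X \<omega> + D \<omega>} (exp t) \<partial>M)"
      unfolding tail_gap_nn
    proof (rule nn_integral_cmult[symmetric])
      have "(\<lambda>\<omega>. indicator {\<omega>\<in>space M. A \<omega> * X \<omega> \<le> exp t \<and> exp t < A \<omega> * X \<omega> + D \<omega>} \<omega> :: ennreal) \<in> borel_measurable M"
        by measurable
      then show "(\<lambda>\<omega>. indicator {A \<omega> * X \<omega>..<A \<omega> * X \<omega> + D \<omega>} (exp t) :: ennreal) \<in> borel_measurable M"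
        by (rule measurable_cong[THEN iffD1, rotated]) (auto split: split_indicator)
    qed
    also have "\<dots> = (\<integral>\<^sup>+\<omega>. ennreal (exp (\<alpha> * t)) *
      indicator {p. A (fst p) * X (fst p) \<le> exp (snd p) \<and> exp (snd p) < A (fst p) * X (fst p) + D (fst p)} (\<omega>, t) \<partial>M)"
      by (intro nn_integral_cong) (auto split: split_indicator)
    finally show "ennreal (tail_gap t) = \<dots>" .
  qed
  also have "\<dots> = (\<integral>\<^sup>+\<omega>. (\<integral>\<^sup>+t. ennreal (exp (\<alpha> * t)) *
      indicator {p. A (fst p) * X (fst p) \<le> exp (snd p) \<and> exp (snd p) < A (fst p) * X (fst p) + D (fst p)} (\<omega>, t) \<partial>lborel) \<partial>M)"
    by (rule Fubini') measurable
  also have "\<dots> = (\<integral>\<^sup>+\<omega>. ennreal (((A \<omega> * X \<omega> + D \<omega>) powr \<alpha> - (A \<omega> * X \<omega>) powr \<alpha>) / \<alpha>) \<partial>M)"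
  proof (rule nn_integral_cong_AE)
    show "AE \<omega> in M. (\<integral>\<^sup>+t. ennreal (exp (\<alpha> * t)) *
      indicator {p. A (fst p) * X (fst p) \<le> exp (snd p) \<and> exp (snd p) < A (fst p) * X (fst p) + D (fst p)} (\<omega>, t) \<partial>lborel) =
      ennreal (((A \<omega> * X \<omega> + D \<omega>) powr \<alpha> - (A \<omega> * X \<omega>) powr \<alpha>) / \<alpha>)"
      using A_pos D_pos X_nonneg
    proof eventually_elim
      case (elim \<omega>)
      define p where "p = A \<omega> * X \<omega>"
      define q where "q = A \<omega> * X \<omega> + D \<omega>"
      have pq: "0 \<le> p" "p < q" using elim by (auto simp: p_def q_def)
      define I where "I = (\<integral>\<^sup>+t. ennreal (exp (\<alpha> * t)) * indicator {t. p \<le> exp t \<and> exp t < q} t \<partial>lborel)"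
      have "(\<integral>\<^sup>+t. ennreal (exp (\<alpha> * t)) * indicator {t. exp t < q} t \<partial>lborel) =
          (\<integral>\<^sup>+t. ennreal (exp (\<alpha> * t)) * indicator {t. p \<le> exp t \<and> exp t < q} t + ennreal (exp (\<alpha> * t)) * indicator {t. exp t < p} t \<partial>lborel)"
        by (intro nn_integral_cong) (use pq in \<open>auto split: split_indicator\<close>)
      also have "\<dots> = I + (\<integral>\<^sup>+t. ennreal (exp (\<alpha> * t)) * indicator {t. exp t < p} t \<partial>lborel)"
        unfolding I_def by (rule nn_integral_add) measurable
      finally have eq: "ennreal (q powr \<alpha> / \<alpha>) = I + ennreal (p powr \<alpha> / \<alpha>)"
        using pq by (simp add: nn_integral_exp_powr[OF \<alpha>])
      \<comment> \<open>Subtraction is harmless because the term removed is finite.\<close>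
      have "I = ennreal (q powr \<alpha> / \<alpha>) - ennreal (p powr \<alpha> / \<alpha>)"
        unfolding eq by simp
      also have "\<dots> = ennreal ((q powr \<alpha> - p powr \<alpha>) / \<alpha>)"
        using \<alpha> pq by (subst ennreal_minus) (auto simp: diff_divide_distrib)
      finally have I: "I = ennreal ((q powr \<alpha> - p powr \<alpha>) / \<alpha>)" .
      have "(\<integral>\<^sup>+t. ennreal (exp (\<alpha> * t)) *
        indicator {p. A (fst p) * X (fst p) \<le> exp (snd p) \<and> exp (snd p) < A (fst p) * X (fst p) + D (fst p)} (\<omega>, t) \<partial>lborel) = I"
        unfolding I_def p_def q_def by (intro nn_integral_cong) (auto split: split_indicator)
      then show ?case unfolding I p_def q_def .
    qed
  qed
  also have "\<dots> = ennreal (\<integral>\<omega>. ((A \<omega> * X \<omega> + D \<omega>) powr \<alpha> - (A \<omega> * X \<omega>) powr \<alpha>) / \<alpha> \<partial>M)"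
  proof (rule nn_integral_eq_integral)
    show "AE \<omega> in M. 0 \<le> ((A \<omega> * X \<omega> + D \<omega>) powr \<alpha> - (A \<omega> * X \<omega>) powr \<alpha>) / \<alpha>"
      using A_pos D_pos X_nonneg by eventually_elim (use \<alpha> in \<open>auto intro!: divide_nonneg_pos powr_mono2\<close>)
  qed (use int_D in auto)
  finally show ?thesis by simp
qed

lemma gap_moment_pos: "(\<integral>\<omega>. (A \<omega> * X \<omega> + D \<omega>) powr \<alpha> - (A \<omega> * X \<omega>) powr \<alpha> \<partial>M) > 0"
proof -
  have pos: "AE \<omega> in M. 0 < (A \<omega> * X \<omega> + D \<omega>) powr \<alpha> - (A \<omega> * X \<omega>) powr \<alpha>"
    using A_pos D_pos X_nonneg by eventually_elim (use \<beta> in \<open>auto intro!: powr_less_mono2\<close>)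
  then have nn: "AE \<omega> in M. 0 \<le> (A \<omega> * X \<omega> + D \<omega>) powr \<alpha> - (A \<omega> * X \<omega>) powr \<alpha>"
    by eventually_elim simp
  have "(\<integral>\<omega>. (A \<omega> * X \<omega> + D \<omega>) powr \<alpha> - (A \<omega> * X \<omega>) powr \<alpha> \<partial>M) \<noteq> 0"
  proof
    assume "(\<integral>\<omega>. (A \<omega> * X \<omega> + D \<omega>) powr \<alpha> - (A \<omega> * X \<omega>) powr \<alpha> \<partial>M) = 0"
    then have "AE \<omega> in M. (A \<omega> * X \<omega> + D \<omega>) powr \<alpha> - (A \<omega> * X \<omega>) powr \<alpha> = 0"
      using integral_nonneg_eq_0_iff_AE[OF int_D nn] by simp
    with pos have "AE \<omega> in M. False" by eventually_elim simp
    then show False by simp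
  qed
  then show ?thesis using integral_nonneg_AE[OF nn] by simp
qed

text \<open>As \<open>D\<close> is positive, the event \<open>A X + D > exp t\<close> is the
  disjoint union of \<open>A X > exp t\<close> and the gap. Given \<open>A\<close>, the former asks
  \<open>X\<close> to exceed the level with logarithm t - ln A, and exp (\<alpha> t) splits into
  \<open>A powr \<alpha>\<close> and the weight at that level.\<close>

lemma scaled_tail_renewal:
  "ennreal (scaled_tail t) = (\<integral>\<^sup>+s. ennreal (scaled_tail (t - s)) \<partial>tilted_law) + ennreal (tail_gap t)"
proof -
  let ?I = "\<lambda>y. indicator {exp t<..} y :: ennreal"
  have gap_meas [measurable]: "(\<lambda>\<omega>. indicator {A \<omega> * X \<omega>..<A \<omega> * X \<omega> + D \<omega>} (exp t) :: ennreal) \<in> borel_measurable M"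
  proof -
    have "(\<lambda>\<omega>. indicator {\<omega>\<in>space M. A \<omega> * X \<omega> \<le> exp t \<and> exp t < A \<omega> * X \<omega> + D \<omega>} \<omega> :: ennreal) \<in> borel_measurable M"
      by measurable
    then show ?thesis by (rule measurable_cong[THEN iffD1, rotated]) (auto split: split_indicator)
  qed
  have "(\<integral>\<^sup>+\<omega>. ?I (X \<omega>) \<partial>M) = (\<integral>\<^sup>+\<omega>. ?I (A \<omega> * X \<omega> + D \<omega>) \<partial>M)"
    by (rule nn_integral_distr_eq[where N = borel and f = ?I]) (auto simp: fixed_point)
  also have "\<dots> = (\<integral>\<^sup>+\<omega>. ?I (A \<omega> * X \<omega>) + indicator {A \<omega> * X \<omega>..<A \<omega> * X \<omega> + D \<omega>} (exp t) \<partial>M)"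
  proof (rule nn_integral_cong_AE)
    show "AE \<omega> in M. ?I (A \<omega> * X \<omega> + D \<omega>) = ?I (A \<omega> * X \<omega>) + indicator {A \<omega> * X \<omega>..<A \<omega> * X \<omega> + D \<omega>} (exp t)"
      using D_pos by eventually_elim (auto split: split_indicator)
  qed
  also have "\<dots> = (\<integral>\<^sup>+\<omega>. ?I (A \<omega> * X \<omega>) \<partial>M) + (\<integral>\<^sup>+\<omega>. indicator {A \<omega> * X \<omega>..<A \<omega> * X \<omega> + D \<omega>} (exp t) \<partial>M)"
    by (rule nn_integral_add) auto
  also have "(\<integral>\<^sup>+\<omega>. ?I (A \<omega> * X \<omega>) \<partial>M) = (\<integral>\<^sup>+\<omega>. (\<integral>\<^sup>+\<omega>'. ?I (A \<omega> * X \<omega>') \<partial>M) \<partial>M)"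
    using indep_rv_nn_integral[OF indep, of "\<lambda>(a, x). ?I (a * x)"] by simp
  finally have 1: "(\<integral>\<^sup>+\<omega>. ?I (X \<omega>) \<partial>M) = (\<integral>\<^sup>+\<omega>. (\<integral>\<^sup>+\<omega>'. ?I (A \<omega> * X \<omega>') \<partial>M) \<partial>M) +
      (\<integral>\<^sup>+\<omega>. indicator {A \<omega> * X \<omega>..<A \<omega> * X \<omega> + D \<omega>} (exp t) \<partial>M)" .
  have "ennreal (exp (\<alpha> * t)) * (\<integral>\<^sup>+\<omega>. (\<integral>\<^sup>+\<omega>'. ?I (A \<omega> * X \<omega>') \<partial>M) \<partial>M) =
      (\<integral>\<^sup>+\<omega>. ennreal (exp (\<alpha> * t)) * (\<integral>\<^sup>+\<omega>'. ?I (A \<omega> * X \<omega>') \<partial>M) \<partial>M)"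
    by (rule nn_integral_cmult[symmetric]) measurable
  also have "\<dots> = (\<integral>\<^sup>+\<omega>. ennreal (A \<omega> powr \<alpha>) * ennreal (scaled_tail (t - ln (A \<omega>))) \<partial>M)"
  proof (rule nn_integral_cong_AE)
    show "AE \<omega> in M. ennreal (exp (\<alpha> * t)) * (\<integral>\<^sup>+\<omega>'. ?I (A \<omega> * X \<omega>') \<partial>M) =
        ennreal (A \<omega> powr \<alpha>) * ennreal (scaled_tail (t - ln (A \<omega>)))"
      using A_pos
    proof eventually_elim
      case (elim \<omega>)
      have "?I (A \<omega> * x) = indicator {exp (t - ln (A \<omega>))<..} x" for x
        using elim by (auto simp: exp_diff divide_less_eq mult.commute split: split_indicator)
      moreover have "exp (\<alpha> * t) = A \<omega> powr \<alpha> * exp (\<alpha> * (t - ln (A \<omega>)))"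
        using elim by (simp add: powr_def exp_add[symmetric] algebra_simps)
      ultimately show ?case
        by (simp add: scaled_tail_nn ennreal_mult mult.assoc)
    qed
  qed
  also have "\<dots> = (\<integral>\<^sup>+s. ennreal (scaled_tail (t - s)) \<partial>tilted_law)"
    by (rule nn_integral_tilted_law[symmetric]) measurable
  finally have 2: "ennreal (exp (\<alpha> * t)) * (\<integral>\<^sup>+\<omega>. (\<integral>\<^sup>+\<omega>'. ?I (A \<omega> * X \<omega>') \<partial>M) \<partial>M) =
      (\<integral>\<^sup>+s. ennreal (scaled_tail (t - s)) \<partial>tilted_law)" .
  show ?thesis
    unfolding scaled_tail_nn[of t] tail_gap_nn 1 distrib_left 2 ..
qed

theorem implicit_renewal_tail:
  "\<exists>c>0. ((\<lambda>x. x powr \<alpha> * prob {\<omega>\<in>space M. X \<omega> > x}) \<longlongrightarrow> c) at_top"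
proof -
  have \<alpha>: "\<alpha> > 0" using \<beta> by simp
  interpret T: real_distribution tilted_law by (rule real_distribution_tilted_law)
  define \<theta> where "\<theta> = (\<integral>\<omega>. A \<omega> powr \<beta> \<partial>M)"
  define C where "C = (\<integral>\<omega>. X \<omega> powr \<beta> \<partial>M)"
  have \<theta>: "0 \<le> \<theta>" "\<theta> < 1"
    using moment_less_one(2)[OF A_meas A_pos not_AE_one int_A one \<beta>] by (auto simp: \<theta>_def)
  have gap_nonneg: "tail_gap t \<ge> 0" for t by (simp add: tail_gap_def)
  have int_gap: "integrable lborel tail_gap"
    using nn_integral_tail_gap by (intro integrableI_nonneg) (auto simp: gap_nonneg)
  \<comment> \<open>Markov's inequality of order \<beta>. The resulting growth rate \<alpha> -
    \<beta> is the very point where the Laplace transform of the tilted law is below 1.\<close>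
  have tail_le: "scaled_tail t \<le> C * exp ((\<alpha> - \<beta>) * t)" for t
  proof -
    have "scaled_tail t \<le> exp (\<alpha> * t) * (C * exp t powr - \<beta>)"
      unfolding scaled_tail_def C_def
      by (intro mult_left_mono tail_Markov X_nonneg int_X) (use \<beta> in auto)
    also have "\<dots> = C * exp ((\<alpha> - \<beta>) * t)"
      by (simp add: powr_def exp_add[symmetric] algebra_simps)
    finally show ?thesis .
  qed
  have decr: "exp (- \<alpha> * u) * scaled_tail u \<le> exp (- \<alpha> * t) * scaled_tail t" if "t \<le> u" for t u
  proof -
    have "exp (- \<alpha> * t) * scaled_tail t = prob {\<omega>\<in>space M. X \<omega> > exp t}" for t
      by (simp add: scaled_tail_def mult.assoc[symmetric] exp_add[symmetric])
    moreover have "exp t < x" if "exp u < x" for x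
      using \<open>t \<le> u\<close> that by (simp add: le_less_trans[of "exp t" "exp u"])
    ultimately show ?thesis by (auto intro!: finite_measure_mono)
  qed
  have \<theta>_le: "(\<integral>\<^sup>+s. ennreal (exp (- (\<alpha> - \<beta>) * s)) \<partial>tilted_law) \<le> ennreal \<theta>"
    unfolding nn_integral_tilted_exp \<theta>_def by simp
  have lam: "\<alpha> - \<beta> > 0" using \<beta> by simp
  have tail_nonneg: "scaled_tail t \<ge> 0" for t by (simp add: scaled_tail_def)
  note renewal = tilted_law_nonarithmetic integrable_tilted_law \<theta>_le \<theta> lam scaled_tail_meas tail_nonneg
    tail_le decr \<alpha> gap_nonneg int_gap scaled_tail_renewal
  have lim: "(scaled_tail \<longlongrightarrow> (\<integral>x. tail_gap x \<partial>lborel) / (\<integral>s. s \<partial>tilted_law)) at_top"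
    by (rule T.renewal_tendsto[OF renewal])
  have gap_pos: "(\<integral>x. tail_gap x \<partial>lborel) > 0"
  proof -
    let ?J = "(\<integral>\<omega>. (A \<omega> * X \<omega> + D \<omega>) powr \<alpha> - (A \<omega> * X \<omega>) powr \<alpha> \<partial>M) / \<alpha>"
    have J: "?J > 0" by (intro divide_pos_pos gap_moment_pos \<alpha>)
    have "ennreal (\<integral>x. tail_gap x \<partial>lborel) = ennreal ?J"
      using nn_integral_eq_integral[OF int_gap] gap_nonneg unfolding nn_integral_tail_gap by simp
    then show ?thesis using J by (metis ennreal_eq_0_iff linorder_not_less)
  qed
  have "(\<integral>s. s \<partial>tilted_law) > 0"
    by (rule T.drift_pos[OF renewal])
  then have pos: "(\<integral>x. tail_gap x \<partial>lborel) / (\<integral>s. s \<partial>tilted_law) > 0" using gap_pos by simp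
  have "((\<lambda>x. scaled_tail (ln x)) \<longlongrightarrow> (\<integral>x. tail_gap x \<partial>lborel) / (\<integral>s. s \<partial>tilted_law)) at_top"
    by (rule filterlim_compose[OF lim ln_at_top])
  moreover have "eventually (\<lambda>x. scaled_tail (ln x) = x powr \<alpha> * prob {\<omega>\<in>space M. X \<omega> > x}) at_top"
    using eventually_gt_at_top[of 0] by eventually_elim (simp add: scaled_tail_def powr_def)
  ultimately have "((\<lambda>x. x powr \<alpha> * prob {\<omega>\<in>space M. X \<omega> > x}) \<longlongrightarrow> (\<integral>x. tail_gap x \<partial>lborel) / (\<integral>s. s \<partial>tilted_law)) at_top"
    by (rule Lim_transform_eventually)
  then show ?thesis using pos by blast
qed

end

end

section \<open>Spectral measures\<close>

lemma nsphere_eq_top_of_set: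
  assumes "h \<ge> 1"
  shows "nsphere (h - 1) = top_of_set {x. (\<forall>i\<ge>h. x i = 0) \<and> vec_norm h x = 1}"
proof -
  have eq: "{..h - 1} = {..<h}" using assms by auto
  have "Suc (h - 1) = h" using assms by simp
  then show ?thesis
    unfolding nsphere_def Euclidean_space_def subtopology_subtopology euclidean_product_topology
      vec_norm_def L2_set_def eq
    by (simp add: Collect_conj_eq)
qed

lemma topspace_nsphere_eq:
  "h \<ge> 1 \<Longrightarrow> topspace (nsphere (h - 1)) = {x. (\<forall>i\<ge>h. x i = 0) \<and> vec_norm h x = 1}"
  by (simp only: nsphere_eq_top_of_set topspace_euclidean_subtopology)

lemma continuous_vec_norm: "continuous_on UNIV (vec_norm h)"
  unfolding vec_norm_def[abs_def] L2_set_def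
  by (intro continuous_intros continuous_on_product_coordinates)

lemma vec_norm_measurable [measurable]: "vec_norm h \<in> borel_measurable borel"
  by (intro borel_measurable_continuous_onI continuous_vec_norm)

lemma vec_norm_nonneg [simp]: "vec_norm h x \<ge> 0"
  by (simp add: vec_norm_def)

lemma abs_le_vec_norm: "i < h \<Longrightarrow> \<bar>x i\<bar> \<le> vec_norm h x"
  using member_le_L2_set[of "{..<h}" i "\<lambda>i. \<bar>x i\<bar>"] unfolding vec_norm_def L2_set_def by simp

lemma vec_norm_triangle: "vec_norm h (\<lambda>i. x i + y i) \<le> vec_norm h x + vec_norm h y"
  unfolding vec_norm_def by (rule L2_set_triangle_ineq)

lemma vec_norm_scale: "vec_norm h (\<lambda>i. c * x i) = \<bar>c\<bar> * vec_norm h x"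
  unfolding vec_norm_def L2_set_def
  by (simp add: power_mult_distrib sum_distrib_left[symmetric] real_sqrt_mult)

lemma vec_norm_diff: "\<bar>vec_norm h (\<lambda>i. x i + y i) - vec_norm h x\<bar> \<le> vec_norm h y"
proof -
  have "vec_norm h (\<lambda>i. x i + y i + - 1 * y i) \<le> vec_norm h (\<lambda>i. x i + y i) + vec_norm h (\<lambda>i. - 1 * y i)"
    by (rule vec_norm_triangle)
  then have "vec_norm h x \<le> vec_norm h (\<lambda>i. x i + y i) + vec_norm h y"
    using vec_norm_scale[of h "-1" y] by simp
  then show ?thesis using vec_norm_triangle[of h x y] by simp
qed

lemma vec_norm_le_sum: "vec_norm h x \<le> (\<Sum>i<h. \<bar>x i\<bar>)"
  unfolding vec_norm_def by (rule L2_set_le_sum_abs)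

lemma vec_dir_measurable [measurable]: "vec_dir h \<in> borel_measurable borel"
proof (rule measurable_coordinatewise_then_product)
  fix i
  have [measurable]: "(\<lambda>x :: nat \<Rightarrow> real. x i) \<in> borel_measurable borel"
    by (intro borel_measurable_continuous_onI continuous_on_product_coordinates)
  show "(\<lambda>x. vec_dir h x i) \<in> borel_measurable borel"
    unfolding vec_dir_def by measurable
qed

lemma vec_dir_in_sphere:
  assumes "h \<ge> 1" "x \<in> topspace (Euclidean_space h)" "vec_norm h x > 0"
  shows "vec_dir h x \<in> topspace (nsphere (h - 1))"
proof -
  have "vec_norm h (vec_dir h x) = 1"
    using vec_norm_scale[of h "1 / vec_norm h x" x] assms by (simp add: vec_dir_def)
  then show ?thesis
    using assms(2) unfolding topspace_nsphere_eq[OF assms(1)]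
    by (auto simp: topspace_Euclidean_space vec_dir_def)
qed

lemma vec_dir_scale: "c > 0 \<Longrightarrow> vec_dir h (\<lambda>i. c * x i) = vec_dir h x"
  by (auto simp: vec_dir_def vec_norm_scale)

text \<open>With a and b the norms of x and x + y, the difference of the directions is (a - b) / (a
  b) (x + y) + y / a, and each part has norm at most that of y divided by a.\<close>

lemma vec_dir_add_diff:
  assumes "vec_norm h x > 0" "vec_norm h (\<lambda>i. x i + y i) > 0"
  shows "vec_norm h (\<lambda>i. vec_dir h (\<lambda>i. x i + y i) i - vec_dir h x i) \<le> 2 * vec_norm h y / vec_norm h x"
proof -
  define a where "a = vec_norm h x"
  define b where "b = vec_norm h (\<lambda>i. x i + y i)"
  have ab: "a > 0" "b > 0" using assms by (auto simp: a_def b_def)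
  have eq: "vec_dir h (\<lambda>i. x i + y i) i - vec_dir h x i = (a - b) / (a * b) * (x i + y i) + 1 / a * y i" for i
    using ab unfolding vec_dir_def a_def[symmetric] b_def[symmetric] by (simp add: field_simps)
  have "vec_norm h (\<lambda>i. vec_dir h (\<lambda>i. x i + y i) i - vec_dir h x i) \<le>
      vec_norm h (\<lambda>i. (a - b) / (a * b) * (x i + y i)) + vec_norm h (\<lambda>i. 1 / a * y i)"
    unfolding eq by (rule vec_norm_triangle)
  also have "\<dots> = \<bar>a - b\<bar> / a + vec_norm h y / a"
    using ab unfolding vec_norm_scale b_def[symmetric] by (simp add: abs_mult)
  also have "\<dots> \<le> vec_norm h y / a + vec_norm h y / a"
    using ab vec_norm_diff[of h x y] unfolding a_def[symmetric] b_def[symmetric]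
    by (intro add_mono divide_right_mono) (auto simp: abs_minus_commute)
  finally show ?thesis by (simp add: a_def)
qed

lemma sphere_sets [measurable]: "h \<ge> 1 \<Longrightarrow> topspace (nsphere (h - 1)) \<in> sets borel"
proof -
  assume h: "h \<ge> 1"
  have [measurable]: "(\<lambda>x :: nat \<Rightarrow> real. x i) \<in> borel_measurable borel" for i
    by (intro borel_measurable_continuous_onI continuous_on_product_coordinates)
  have "{x \<in> space (borel :: (nat \<Rightarrow> real) measure). (\<forall>i\<in>{h..}. x i = 0) \<and> vec_norm h x = 1} \<in> sets borel"
    by measurable
  then show ?thesis unfolding topspace_nsphere_eq[OF h] by simp
qed

text \<open>A closed subset of the cube of sequences with values in [-1, 1], which is compact by
  Tychonoff's theorem.\<close>

lemma compact_sphere: "h \<ge> 1 \<Longrightarrow> compact (topspace (nsphere (h - 1)))"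
proof -
  assume h: "h \<ge> 1"
  define S where "S = topspace (nsphere (h - 1))"
  have S: "S = {x. (\<forall>i\<ge>h. x i = 0) \<and> vec_norm h x = 1}"
    unfolding S_def by (rule topspace_nsphere_eq[OF h])
  have "compactin (product_topology (\<lambda>i. euclideanreal) UNIV) (PiE UNIV (\<lambda>i::nat. {-1..1}))"
    by (subst compactin_PiE) auto
  then have cube: "compact (PiE UNIV (\<lambda>i::nat. {-1..1::real}))"
    unfolding euclidean_product_topology by simp
  have "S = (\<Inter>i\<in>{h..}. {x. x i = 0}) \<inter> {x. vec_norm h x = 1}"
    by (auto simp: S)
  moreover have "closed (\<Inter>i\<in>{h..}. {x :: nat \<Rightarrow> real. x i = 0})"
    by (intro closed_INT ballI closed_Collect_eq continuous_on_product_coordinates continuous_on_const)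
  moreover have "closed {x. vec_norm h x = 1}"
    by (intro closed_Collect_eq continuous_vec_norm continuous_on_const)
  ultimately have "closed S" by (simp only: closed_Int)
  moreover have "S \<subseteq> PiE UNIV (\<lambda>i::nat. {-1..1::real})"
  proof
    fix x assume x: "x \<in> S"
    have "\<bar>x i\<bar> \<le> 1" for i
      using x abs_le_vec_norm[of i h x] by (cases "i < h") (auto simp: S)
    then show "x \<in> PiE UNIV (\<lambda>i::nat. {-1..1::real})" by (auto simp: abs_le_iff minus_le_iff)
  qed
  ultimately have "compact S"
    using compact_Int_closed[OF cube, of S] by (simp add: Int_absorb1)
  then show "compact (topspace (nsphere (h - 1)))" by (simp add: S_def)
qed

text \<open>Compactness yields uniform continuity for the metric of the sequence space; the work
  lies in passing from that metric to \<open>vec_norm\<close>.\<close>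

lemma sphere_uniformly_continuous:
  fixes f :: "(nat \<Rightarrow> real) \<Rightarrow> real"
  assumes h: "h \<ge> 1" and f: "continuous_map (nsphere (h - 1)) euclideanreal f" and "e > 0"
  obtains d where "d > 0"
    "\<And>v w. v \<in> topspace (nsphere (h - 1)) \<Longrightarrow> w \<in> topspace (nsphere (h - 1)) \<Longrightarrow>
      vec_norm h (\<lambda>i. v i - w i) < d \<Longrightarrow> \<bar>f v - f w\<bar> < e"
proof -
  let ?S = "topspace (nsphere (h - 1))"
  have "continuous_on ?S f"
    using f unfolding nsphere_eq_top_of_set[OF h] by simp
  then have "uniformly_continuous_on ?S f"
    using compact_sphere[OF h] by (rule compact_uniformly_continuous)
  then obtain d where d: "d > 0" "\<And>v w. v \<in> ?S \<Longrightarrow> w \<in> ?S \<Longrightarrow> dist w v < d \<Longrightarrow> dist (f w) (f v) < e"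
    using \<open>e > 0\<close> unfolding uniformly_continuous_on_def by metis
  \<comment> \<open>The metric is at most twice the largest of finitely many coordinate distances
    plus \<open>(1 / 2) ^ N\<close>; coordinate distances below \<open>d / 4\<close> make it less
    than \<open>d\<close>.\<close>
  obtain N :: nat where N: "(1 / 2) ^ N < d / 2"
    using real_arch_pow_inv[of "d / 2" "1 / 2"] d(1) by auto
  show thesis
  proof (rule that[of "d / 4"])
    show "d / 4 > 0" using d(1) by simp
    fix v w assume v: "v \<in> ?S" and w: "w \<in> ?S" and vw: "vec_norm h (\<lambda>i. v i - w i) < d / 4"
    have "dist (v i) (w i) < d / 4" for i
    proof (cases "i < h")
      case True
      then show ?thesis using abs_le_vec_norm[of i h "\<lambda>i. v i - w i"] vw by (simp add: dist_real_def)
    next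
      case False
      then show ?thesis using v w d(1) unfolding topspace_nsphere_eq[OF h] by auto
    qed
    then have "Max {dist (v (from_nat n)) (w (from_nat n))|n. n \<le> N} < d / 4"
      by (subst Max_less_iff) auto
    then have "dist v w < d"
      using dist_fun_le_dist_first_terms[of v w N] N by simp
    then show "\<bar>f v - f w\<bar> < e" using d(2)[OF w v] by (simp add: dist_real_def)
  qed
qed

lemma sphere_bounded:
  fixes f :: "(nat \<Rightarrow> real) \<Rightarrow> real"
  assumes h: "h \<ge> 1" and f: "continuous_map (nsphere (h - 1)) euclideanreal f"
  obtains K where "K \<ge> 0" "\<And>v. v \<in> topspace (nsphere (h - 1)) \<Longrightarrow> \<bar>f v\<bar> \<le> K"
proof -
  let ?S = "topspace (nsphere (h - 1))"
  have "continuous_on ?S f"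
    using f unfolding nsphere_eq_top_of_set[OF h] by simp
  then have "bounded (f ` ?S)"
    using compact_sphere[OF h] by (intro compact_imp_bounded compact_continuous_image)
  then obtain K where K: "\<And>v. v \<in> ?S \<Longrightarrow> \<bar>f v\<bar> \<le> K" unfolding bounded_real by blast
  show thesis by (rule that[of "max K 0"]) (use K in \<open>auto intro: max.coboundedI1\<close>)
qed

lemma sphere_continuous_measurable:
  fixes f :: "(nat \<Rightarrow> real) \<Rightarrow> real"
  assumes h: "h \<ge> 1" and f: "continuous_map (nsphere (h - 1)) euclideanreal f"
  shows "f \<in> borel_measurable (sphere_borel h)"
proof -
  have "continuous_on (topspace (nsphere (h - 1))) f"
    using f unfolding nsphere_eq_top_of_set[OF h] by simp
  then show ?thesis unfolding sphere_borel_def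
    by (rule borel_measurable_continuous_on_restrict)
qed

lemma space_sphere_borel [simp]: "space (sphere_borel h) = topspace (nsphere (h - 1))"
  by (simp add: sphere_borel_def space_restrict_space)

text \<open>Obtained as the law of the direction after a change of measure whose density is
  proportional to \<open>vec_norm h (Y \<omega>) powr \<alpha>\<close>.\<close>

lemma (in prob_space) tilted_direction_law_exists:
  fixes Y :: "'a \<Rightarrow> nat \<Rightarrow> real"
  assumes h: "h \<ge> 1" and Y [measurable]: "Y \<in> borel_measurable M"
    and Eucl: "\<And>\<omega>. \<omega> \<in> space M \<Longrightarrow> Y \<omega> \<in> topspace (Euclidean_space h)" and "\<alpha> > 0"
    and int: "integrable M (\<lambda>\<omega>. vec_norm h (Y \<omega>) powr \<alpha>)"
    and pos: "(\<integral>\<omega>. vec_norm h (Y \<omega>) powr \<alpha> \<partial>M) > 0"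
  obtains S where "is_tilted_direction_law M h Y \<alpha> S"
    "\<And>f. f \<in> borel_measurable (sphere_borel h) \<Longrightarrow>
      integral\<^sup>L S f = (\<integral>\<omega>. (if vec_norm h (Y \<omega>) > 0 then f (vec_dir h (Y \<omega>)) else 0) * vec_norm h (Y \<omega>) powr \<alpha> \<partial>M) /
        (\<integral>\<omega>. vec_norm h (Y \<omega>) powr \<alpha> \<partial>M)"
proof -
  define E where "E = (\<integral>\<omega>. vec_norm h (Y \<omega>) powr \<alpha> \<partial>M)"
  have E: "E > 0" using pos by (simp add: E_def)
  define dens where "dens \<omega> = vec_norm h (Y \<omega>) powr \<alpha> / E" for \<omega>
  have dens: "dens \<omega> \<ge> 0" for \<omega> using E by (simp add: dens_def)
  have [measurable]: "dens \<in> borel_measurable M" unfolding dens_def by measurable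
  have int_dens: "integrable M dens" "(\<integral>\<omega>. dens \<omega> \<partial>M) = 1"
    using int E by (auto simp: dens_def[abs_def] E_def)
  \<comment> \<open>The first unit vector, a default direction for \<open>Y = 0\<close>; the density
    vanishes there.\<close>
  let ?e = "(\<lambda>n. if n = 0 then 1 else 0) :: nat \<Rightarrow> real"
  define dir where "dir \<omega> = (if vec_norm h (Y \<omega>) > 0 then vec_dir h (Y \<omega>) else ?e)" for \<omega>
  have dir_meas [measurable]: "dir \<in> M \<rightarrow>\<^sub>M sphere_borel h"
    unfolding sphere_borel_def
  proof (rule measurable_restrict_space2)
    show "dir \<in> space M \<rightarrow> topspace (nsphere (h - 1))"
      using vec_dir_in_sphere[OF h Eucl] in_topspace_nsphere by (auto simp: dir_def)
    show "dir \<in> borel_measurable M" unfolding dir_def by measurable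
  qed
  define S where "S = distr (density M (\<lambda>\<omega>. ennreal (dens \<omega>))) (sphere_borel h) dir"
  have prob: "prob_space (density M (\<lambda>\<omega>. ennreal (dens \<omega>)))"
  proof (rule prob_spaceI)
    have "(\<integral>\<^sup>+\<omega>. ennreal (dens \<omega>) \<partial>M) = 1"
      using int_dens dens by (subst nn_integral_eq_integral) auto
    then show "emeasure (density M (\<lambda>\<omega>. ennreal (dens \<omega>))) (space (density M (\<lambda>\<omega>. ennreal (dens \<omega>)))) = 1"
      by (simp add: emeasure_density cong: nn_integral_cong)
  qed
  then have prob_S: "prob_space S" unfolding S_def by (rule prob_space.prob_space_distr) simp
  have sets_S: "sets S = sets (sphere_borel h)" by (simp add: S_def)
  have integral_S: "integral\<^sup>L S f = (\<integral>\<omega>. (if vec_norm h (Y \<omega>) > 0 then f (vec_dir h (Y \<omega>)) else 0) * vec_norm h (Y \<omega>) powr \<alpha> \<partial>M) / E"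
    if [measurable]: "f \<in> borel_measurable (sphere_borel h)" for f :: "(nat \<Rightarrow> real) \<Rightarrow> real"
  proof -
    have "integral\<^sup>L S f = (\<integral>\<omega>. dens \<omega> * f (dir \<omega>) \<partial>M)"
      unfolding S_def using dens by (simp add: integral_distr integral_density)
    also have "\<dots> = (\<integral>\<omega>. ((if vec_norm h (Y \<omega>) > 0 then f (vec_dir h (Y \<omega>)) else 0) * vec_norm h (Y \<omega>) powr \<alpha>) / E \<partial>M)"
      using vec_norm_nonneg[of h] by (intro Bochner_Integration.integral_cong) (auto simp: dens_def dir_def order.order_iff_strict[of 0])
    finally show ?thesis by simp
  qed
  have "is_tilted_direction_law M h Y \<alpha> S"
    unfolding is_tilted_direction_law_def
  proof (intro conjI ballI sets_S prob_S int)
    fix B assume B: "B \<in> sets S"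
    interpret S: prob_space S by fact
    have "measure S B = integral\<^sup>L S (indicator B)" using B by simp
    also have "\<dots> = (\<integral>\<omega>. (if vec_norm h (Y \<omega>) > 0 then indicator B (vec_dir h (Y \<omega>)) else 0) * vec_norm h (Y \<omega>) powr \<alpha> \<partial>M) / E"
      using B by (intro integral_S) (simp add: sets_S)
    also have "(\<integral>\<omega>. (if vec_norm h (Y \<omega>) > 0 then indicator B (vec_dir h (Y \<omega>)) else 0) * vec_norm h (Y \<omega>) powr \<alpha> \<partial>M) =
        (\<integral>\<omega>. vec_norm h (Y \<omega>) powr \<alpha> * indicator B (vec_dir h (Y \<omega>)) \<partial>M)"
      using vec_norm_nonneg[of h] by (intro Bochner_Integration.integral_cong) (auto simp: order.order_iff_strict[of 0])
    finally show "measure S B = (\<integral>\<omega>. vec_norm h (Y \<omega>) powr \<alpha> * indicator B (vec_dir h (Y \<omega>)) \<partial>M) /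
        (\<integral>\<omega>. vec_norm h (Y \<omega>) powr \<alpha> \<partial>M)" by (simp add: E_def)
  qed
  then show thesis using integral_S by (intro that) (auto simp: E_def)
qed

section \<open>Breiman's lemma and negligible remainders\<close>

context prob_space
begin

lemma indep_rv_integral:
  fixes f :: "_ \<Rightarrow> real"
  assumes "indep_rv S X T Y" and [measurable]: "f \<in> borel_measurable (S \<Otimes>\<^sub>M T)" and bound: "\<And>p. \<bar>f p\<bar> \<le> K"
  shows "(\<integral>\<omega>. f (X \<omega>, Y \<omega>) \<partial>M) = (\<integral>\<omega>. (\<integral>\<omega>'. f (X \<omega>, Y \<omega>') \<partial>M) \<partial>M)"
proof -
  have XS [measurable]: "X \<in> M \<rightarrow>\<^sub>M S" and YT [measurable]: "Y \<in> M \<rightarrow>\<^sub>M T"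
    and eq: "distr M S X \<Otimes>\<^sub>M distr M T Y = distr M (S \<Otimes>\<^sub>M T) (\<lambda>x. (X x, Y x))"
    using assms(1) unfolding indep_rv_def by auto
  interpret X: prob_space "distr M S X" by (rule prob_space_distr) simp
  interpret Y: prob_space "distr M T Y" by (rule prob_space_distr) simp
  interpret P: pair_prob_space "distr M S X" "distr M T Y" ..
  have int: "integrable (distr M S X \<Otimes>\<^sub>M distr M T Y) f"
    by (rule P.integrable_const_bound[of _ K]) (use bound in auto)
  have "(\<integral>\<omega>. f (X \<omega>, Y \<omega>) \<partial>M) = (\<integral>p. f p \<partial>distr M (S \<Otimes>\<^sub>M T) (\<lambda>x. (X x, Y x)))"
    by (subst integral_distr) auto
  also have "\<dots> = (\<integral>x. (\<integral>y. f (x, y) \<partial>distr M T Y) \<partial>distr M S X)"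
    unfolding eq[symmetric] using P.integral_fst[of "\<lambda>x y. f (x, y)"] int by simp
  also have "\<dots> = (\<integral>\<omega>. (\<integral>y. f (X \<omega>, y) \<partial>distr M T Y) \<partial>M)"
    by (subst integral_distr) auto
  also have "\<dots> = (\<integral>\<omega>. (\<integral>\<omega>'. f (X \<omega>, Y \<omega>') \<partial>M) \<partial>M)"
    by (intro Bochner_Integration.integral_cong refl, subst integral_distr)
       (auto intro!: measurable_compose[OF measurable_Pair1'] dest: measurable_space[OF XS])
  finally show ?thesis .
qed

text \<open>The exact moment of order \<open>\<alpha>\<close> suffices in Breiman's lemma because \<open>x powr \<alpha> * P (X > x)\<close> is
  bounded, which makes dominated convergence applicable.\<close>

lemma Breiman_limit:
  fixes X N \<Phi> :: "'a \<Rightarrow> real"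
  assumes indep: "indep_rv (borel \<Otimes>\<^sub>M borel) (\<lambda>\<omega>. (\<Phi> \<omega>, N \<omega>)) borel X"
    and N: "\<And>\<omega>. N \<omega> \<ge> 0" and \<Phi>: "\<And>\<omega>. \<bar>\<Phi> \<omega>\<bar> \<le> K" and \<alpha>: "\<alpha> > 0" and "u > 0"
    and tail: "((\<lambda>x. x powr \<alpha> * prob {\<omega>\<in>space M. X \<omega> > x}) \<longlongrightarrow> c) at_top"
    and int: "integrable M (\<lambda>\<omega>. N \<omega> powr \<alpha>)"
  shows "((\<lambda>x. x powr \<alpha> * (\<integral>\<omega>. \<Phi> \<omega> * indicator {u * x<..} (X \<omega> * N \<omega>) \<partial>M)) \<longlongrightarrow>
    u powr - \<alpha> * c * (\<integral>\<omega>. \<Phi> \<omega> * N \<omega> powr \<alpha> \<partial>M)) at_top"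
proof -
  have pair [measurable]: "(\<lambda>\<omega>. (\<Phi> \<omega>, N \<omega>)) \<in> M \<rightarrow>\<^sub>M borel \<Otimes>\<^sub>M borel" and X [measurable]: "X \<in> borel_measurable M"
    using indep unfolding indep_rv_def by auto
  have [measurable]: "\<Phi> \<in> borel_measurable M" "N \<in> borel_measurable M"
    using measurable_compose[OF pair measurable_fst] measurable_compose[OF pair measurable_snd] by simp_all
  define \<rho> where "\<rho> y = y powr \<alpha> * prob {\<omega>\<in>space M. X \<omega> > y}" for y
  have K: "K \<ge> 0" using \<Phi>[of undefined] by linarith
  have \<rho>_nonneg: "\<rho> y \<ge> 0" for y by (simp add: \<rho>_def)
  have \<rho>_meas [measurable]: "\<rho> \<in> borel_measurable borel"
  proof -
    have "mono (\<lambda>t. - prob {\<omega>\<in>space M. X \<omega> > t})"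
      by (intro monoI) (auto intro!: finite_measure_mono)
    then have "(\<lambda>t. - prob {\<omega>\<in>space M. X \<omega> > t}) \<in> borel_measurable borel" by (rule borel_measurable_mono)
    then have "(\<lambda>t. - (- prob {\<omega>\<in>space M. X \<omega> > t})) \<in> borel_measurable borel" by (rule borel_measurable_uminus)
    then have [measurable]: "(\<lambda>t. prob {\<omega>\<in>space M. X \<omega> > t}) \<in> borel_measurable borel" by simp
    show ?thesis unfolding \<rho>_def[abs_def] by measurable
  qed
  have \<rho>_lim: "(\<rho> \<longlongrightarrow> c) at_top" using tail by (simp add: \<rho>_def[abs_def])
  \<comment> \<open>Beyond some point \<rho> is close to its limit; before it, the probability is at
    most 1 and the power is bounded.\<close>
  obtain R where R: "R \<ge> 0" "\<And>y. y > 0 \<Longrightarrow> \<rho> y \<le> R"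
  proof -
    have "eventually (\<lambda>y. \<rho> y < c + 1) at_top" using \<rho>_lim by (rule order_tendstoD) simp
    then obtain y0 where y0: "\<And>y. y \<ge> y0 \<Longrightarrow> \<rho> y < c + 1" by (auto simp: eventually_at_top_linorder)
    have "\<rho> y \<le> max (\<bar>c\<bar> + 1) (\<bar>y0\<bar> powr \<alpha>)" if "y > 0" for y
    proof (cases "y \<ge> y0")
      case True
      then show ?thesis using y0[of y] by (intro max.coboundedI1) linarith
    next
      case False
      have "\<rho> y \<le> y powr \<alpha> * 1" unfolding \<rho>_def by (intro mult_left_mono prob_le_1) auto
      also have "\<dots> \<le> \<bar>y0\<bar> powr \<alpha>" using False that \<alpha> by (auto intro!: powr_mono2)
      finally show ?thesis by (rule max.coboundedI2)
    qed
    then show thesis by (intro that[of "max (\<bar>c\<bar> + 1) (\<bar>y0\<bar> powr \<alpha>)"]) auto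
  qed
  \<comment> \<open>The integrand after averaging over \<open>X\<close>: the level
    \<open>u * x\<close> for the product is the level \<open>u * x / N \<omega>\<close> for
    \<open>X\<close>, and \<open>x powr \<alpha>\<close> is distributed over \<rho> and the factor
    in front.\<close>
  define s where "s x \<omega> = \<Phi> \<omega> * ((N \<omega> / u) powr \<alpha> * \<rho> (u * x / N \<omega>))" for x \<omega>
  have eq: "x powr \<alpha> * (\<integral>\<omega>. \<Phi> \<omega> * indicator {u * x<..} (X \<omega> * N \<omega>) \<partial>M) = (\<integral>\<omega>. s x \<omega> \<partial>M)"
    if x: "x > 0" for x
  proof -
    \<comment> \<open>Truncation does not change the values of \<Phi> but makes the integrand
      bounded on the whole product space.\<close>
    define cl where "cl y = max (- K) (min K y)" for y :: real
    have cl: "cl (\<Phi> \<omega>) = \<Phi> \<omega>" for \<omega> using \<Phi>[of \<omega>] unfolding cl_def by linarith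
    have cl_le: "\<bar>cl y\<bar> \<le> K" for y using K unfolding cl_def by linarith
    have [measurable]: "cl \<in> borel_measurable borel" unfolding cl_def by measurable
    let ?g = "\<lambda>p. cl (fst (fst p)) * indicator {p. snd p * snd (fst p) > u * x} p :: real"
    have "(\<integral>\<omega>. \<Phi> \<omega> * indicator {u * x<..} (X \<omega> * N \<omega>) \<partial>M) = (\<integral>\<omega>. ?g ((\<Phi> \<omega>, N \<omega>), X \<omega>) \<partial>M)"
      by (intro Bochner_Integration.integral_cong) (auto simp: cl indicator_def)
    also have "\<dots> = (\<integral>\<omega>. (\<integral>\<omega>'. ?g ((\<Phi> \<omega>, N \<omega>), X \<omega>') \<partial>M) \<partial>M)"
    proof (rule indep_rv_integral[OF indep])
      show "?g \<in> borel_measurable ((borel \<Otimes>\<^sub>M borel) \<Otimes>\<^sub>M borel)" by measurable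
      show "\<bar>?g p\<bar> \<le> K" for p using K cl_le by (auto simp: indicator_def)
    qed
    also have "\<dots> = (\<integral>\<omega>. \<Phi> \<omega> * prob {\<omega>'\<in>space M. X \<omega>' * N \<omega> > u * x} \<partial>M)"
    proof (intro Bochner_Integration.integral_cong refl)
      fix \<omega>
      have "(\<integral>\<omega>'. ?g ((\<Phi> \<omega>, N \<omega>), X \<omega>') \<partial>M) = (\<integral>\<omega>'. \<Phi> \<omega> * indicator {\<omega>'\<in>space M. X \<omega>' * N \<omega> > u * x} \<omega>' \<partial>M)"
        by (intro Bochner_Integration.integral_cong) (auto simp: cl indicator_def)
      then show "(\<integral>\<omega>'. ?g ((\<Phi> \<omega>, N \<omega>), X \<omega>') \<partial>M) = \<Phi> \<omega> * prob {\<omega>'\<in>space M. X \<omega>' * N \<omega> > u * x}"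
        by simp
    qed
    also have "x powr \<alpha> * \<dots> = (\<integral>\<omega>. x powr \<alpha> * (\<Phi> \<omega> * prob {\<omega>'\<in>space M. X \<omega>' * N \<omega> > u * x}) \<partial>M)"
      by simp
    also have "\<dots> = (\<integral>\<omega>. s x \<omega> \<partial>M)"
    proof (intro Bochner_Integration.integral_cong refl)
      fix \<omega>
      show "x powr \<alpha> * (\<Phi> \<omega> * prob {\<omega>'\<in>space M. X \<omega>' * N \<omega> > u * x}) = s x \<omega>"
      proof (cases "N \<omega> = 0")
        case True
        have "\<not> u * x < 0" using x \<open>u > 0\<close> by (simp add: mult_less_0_iff)
        then show ?thesis using True by (simp add: s_def)
      next
        case False
        then have n: "N \<omega> > 0" using N[of \<omega>] by simp
        have "X \<omega>' * N \<omega> > u * x \<longleftrightarrow> X \<omega>' > u * x / N \<omega>" for \<omega>'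
          using n by (simp add: pos_divide_less_eq)
        moreover have "x powr \<alpha> = (N \<omega> / u) powr \<alpha> * (u * x / N \<omega>) powr \<alpha>"
          using n x \<open>u > 0\<close> by (subst powr_mult[symmetric]) (auto simp: field_simps)
        ultimately show ?thesis by (simp add: s_def \<rho>_def)
      qed
    qed
    finally show ?thesis .
  qed
  have "((\<lambda>x. \<integral>\<omega>. s x \<omega> \<partial>M) \<longlongrightarrow> (\<integral>\<omega>. \<Phi> \<omega> * ((N \<omega> / u) powr \<alpha> * c) \<partial>M)) at_top"
  proof (rule integral_dominated_convergence_at_top[where w = "\<lambda>\<omega>. K * R * (N \<omega> / u) powr \<alpha>"])
    show "integrable M (\<lambda>\<omega>. K * R * (N \<omega> / u) powr \<alpha>)"
      using int \<open>u > 0\<close> N by (simp add: powr_divide)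
    have "((\<lambda>x. s x \<omega>) \<longlongrightarrow> \<Phi> \<omega> * ((N \<omega> / u) powr \<alpha> * c)) at_top" for \<omega>
    proof (cases "N \<omega> = 0")
      case True
      then show ?thesis by (simp add: s_def)
    next
      case False
      then have "u / N \<omega> > 0" using N[of \<omega>] \<open>u > 0\<close> by simp
      then have "filterlim (\<lambda>x. u / N \<omega> * x) at_top at_top"
        by (intro filterlim_tendsto_pos_mult_at_top[OF tendsto_const _ filterlim_ident])
      then have "((\<lambda>x. \<rho> (u / N \<omega> * x)) \<longlongrightarrow> c) at_top" by (rule filterlim_compose[OF \<rho>_lim])
      then show ?thesis unfolding s_def by (intro tendsto_intros) simp
    qed
    then show "AE \<omega> in M. ((\<lambda>x. s x \<omega>) \<longlongrightarrow> \<Phi> \<omega> * ((N \<omega> / u) powr \<alpha> * c)) at_top" by simp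
    have "norm (s x \<omega>) \<le> K * R * (N \<omega> / u) powr \<alpha>" if x: "x > 0" for x \<omega>
    proof (cases "N \<omega> = 0")
      case True
      then show ?thesis by (simp add: s_def)
    next
      case False
      then have "u * x / N \<omega> > 0" using N[of \<omega>] \<open>u > 0\<close> x by simp
      then have "\<rho> (u * x / N \<omega>) \<le> R" by (rule R)
      then have "\<bar>\<Phi> \<omega>\<bar> * ((N \<omega> / u) powr \<alpha> * \<rho> (u * x / N \<omega>)) \<le> K * ((N \<omega> / u) powr \<alpha> * R)"
        using \<Phi>[of \<omega>] K \<rho>_nonneg by (intro mult_mono) auto
      then show ?thesis using \<rho>_nonneg by (simp add: s_def abs_mult mult_ac)
    qed
    then show "\<forall>\<^sub>F x in at_top. AE \<omega> in M. norm (s x \<omega>) \<le> K * R * (N \<omega> / u) powr \<alpha>"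
      by (intro eventually_mono[OF eventually_gt_at_top[of "0::real"]] AE_I2)
    show "s x \<in> borel_measurable M" for x unfolding s_def by measurable
  qed simp
  also have "(\<integral>\<omega>. \<Phi> \<omega> * ((N \<omega> / u) powr \<alpha> * c) \<partial>M) = u powr - \<alpha> * c * (\<integral>\<omega>. \<Phi> \<omega> * N \<omega> powr \<alpha> \<partial>M)"
  proof -
    have "(\<integral>\<omega>. \<Phi> \<omega> * ((N \<omega> / u) powr \<alpha> * c) \<partial>M) = (\<integral>\<omega>. u powr - \<alpha> * c * (\<Phi> \<omega> * N \<omega> powr \<alpha>) \<partial>M)"
    proof (intro Bochner_Integration.integral_cong refl)
      fix \<omega>
      have "(N \<omega> / u) powr \<alpha> = u powr - \<alpha> * N \<omega> powr \<alpha>"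
        using \<open>u > 0\<close> N[of \<omega>] by (subst powr_divide) (auto simp: powr_minus divide_inverse)
      then show "\<Phi> \<omega> * ((N \<omega> / u) powr \<alpha> * c) = u powr - \<alpha> * c * (\<Phi> \<omega> * N \<omega> powr \<alpha>)"
        by (simp only: mult_ac)
    qed
    then show ?thesis by simp
  qed
  finally have lim: "((\<lambda>x. \<integral>\<omega>. s x \<omega> \<partial>M) \<longlongrightarrow> u powr - \<alpha> * c * (\<integral>\<omega>. \<Phi> \<omega> * N \<omega> powr \<alpha> \<partial>M)) at_top" .
  have "eventually (\<lambda>x. (\<integral>\<omega>. s x \<omega> \<partial>M) = x powr \<alpha> * (\<integral>\<omega>. \<Phi> \<omega> * indicator {u * x<..} (X \<omega> * N \<omega>) \<partial>M)) at_top"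
    using eventually_gt_at_top[of "0::real"] by eventually_elim (rule eq[symmetric])
  then show ?thesis by (rule Lim_transform_eventually[OF lim])
qed

text \<open>Markov's inequality with the moment restricted to R > e x; the truncated moment tends to
  0 by dominated convergence, which improves a bounded expression to a vanishing one.\<close>

lemma tail_moment_tendsto_zero:
  fixes R :: "'a \<Rightarrow> real"
  assumes [measurable]: "R \<in> borel_measurable M" and int: "integrable M (\<lambda>\<omega>. R \<omega> powr \<alpha>)"
    and nonneg: "\<And>\<omega>. R \<omega> \<ge> 0" and "\<alpha> > 0" "e > 0"
  shows "((\<lambda>x. x powr \<alpha> * prob {\<omega>\<in>space M. R \<omega> > e * x}) \<longlongrightarrow> 0) at_top"
proof -
  have lim: "((\<lambda>x. \<integral>\<omega>. e powr - \<alpha> * (R \<omega> powr \<alpha> * indicator {e * x<..} (R \<omega>)) \<partial>M) \<longlongrightarrow> (\<integral>\<omega>. 0 \<partial>M)) at_top"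
  proof (rule integral_dominated_convergence_at_top[where w = "\<lambda>\<omega>. e powr - \<alpha> * R \<omega> powr \<alpha>"])
    have "((\<lambda>x. e powr - \<alpha> * (R \<omega> powr \<alpha> * indicator {e * x<..} (R \<omega>))) \<longlongrightarrow> 0) at_top" for \<omega>
    proof (rule tendsto_eventually)
      show "\<forall>\<^sub>F x in at_top. e powr - \<alpha> * (R \<omega> powr \<alpha> * indicator {e * x<..} (R \<omega>)) = 0"
        using eventually_ge_at_top[of "R \<omega> / e"]
      proof eventually_elim
        case (elim x)
        then have "R \<omega> \<le> e * x" using \<open>e > 0\<close> by (simp add: pos_divide_le_eq mult.commute)
        then show ?case by simp
      qed
    qed
    then show "AE \<omega> in M. ((\<lambda>x. e powr - \<alpha> * (R \<omega> powr \<alpha> * indicator {e * x<..} (R \<omega>))) \<longlongrightarrow> 0) at_top" by simp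
    show "\<forall>\<^sub>F x in at_top. AE \<omega> in M. norm (e powr - \<alpha> * (R \<omega> powr \<alpha> * indicator {e * x<..} (R \<omega>))) \<le> e powr - \<alpha> * R \<omega> powr \<alpha>"
      by (intro always_eventually allI AE_I2) (auto simp: indicator_def)
  qed (use int in auto)
  have upper: "eventually (\<lambda>x. x powr \<alpha> * prob {\<omega>\<in>space M. R \<omega> > e * x} \<le>
      (\<integral>\<omega>. e powr - \<alpha> * (R \<omega> powr \<alpha> * indicator {e * x<..} (R \<omega>)) \<partial>M)) at_top"
    using eventually_gt_at_top[of "0::real"]
  proof eventually_elim
    case (elim x)
    have "x powr \<alpha> * prob {\<omega>\<in>space M. R \<omega> > e * x} = (\<integral>\<omega>. x powr \<alpha> * indicator {\<omega>\<in>space M. R \<omega> > e * x} \<omega> \<partial>M)"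
      by simp
    also have "\<dots> \<le> (\<integral>\<omega>. e powr - \<alpha> * (R \<omega> powr \<alpha> * indicator {e * x<..} (R \<omega>)) \<partial>M)"
    proof (rule integral_mono)
      have "integrable M (\<lambda>\<omega>. R \<omega> powr \<alpha> * indicator {e * x<..} (R \<omega>))"
        by (rule Bochner_Integration.integrable_bound[OF int]) (auto simp: indicator_def)
      then show "integrable M (\<lambda>\<omega>. e powr - \<alpha> * (R \<omega> powr \<alpha> * indicator {e * x<..} (R \<omega>)))" by simp
      fix \<omega>
      have "x powr \<alpha> \<le> e powr - \<alpha> * R \<omega> powr \<alpha>" if "R \<omega> > e * x"
      proof -
        have "x powr \<alpha> = e powr - \<alpha> * (e * x) powr \<alpha>"
          using elim \<open>e > 0\<close> by (simp add: powr_mult powr_minus)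
        also have "\<dots> \<le> e powr - \<alpha> * R \<omega> powr \<alpha>"
          using that elim \<open>e > 0\<close> \<open>\<alpha> > 0\<close> by (intro mult_left_mono powr_mono2) auto
        finally show ?thesis .
      qed
      then show "x powr \<alpha> * indicator {\<omega>\<in>space M. R \<omega> > e * x} \<omega> \<le> e powr - \<alpha> * (R \<omega> powr \<alpha> * indicator {e * x<..} (R \<omega>))"
        by (auto simp: indicator_def)
      show "integrable M (\<lambda>\<omega>. x powr \<alpha> * indicator {\<omega>\<in>space M. R \<omega> > e * x} \<omega>)"
        by (intro integrable_mult_right integrable_real_indicator) (simp_all add: less_top[symmetric])
    qed
    finally show ?case .
  qed
  show ?thesis
  proof (rule tendsto_sandwich[OF _ upper tendsto_const])
    show "((\<lambda>x. \<integral>\<omega>. e powr - \<alpha> * (R \<omega> powr \<alpha> * indicator {e * x<..} (R \<omega>)) \<partial>M) \<longlongrightarrow> 0) at_top"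
      using lim by simp
    show "eventually (\<lambda>x. 0 \<le> x powr \<alpha> * prob {\<omega>\<in>space M. R \<omega> > e * x}) at_top"
      by (intro always_eventually allI) simp
  qed
qed

end

lemma integral_scale_measure:
  fixes f :: "'b \<Rightarrow> real"
  assumes "r \<ge> 0" and [measurable]: "f \<in> borel_measurable N"
  shows "integral\<^sup>L (scale_measure (ennreal r) N) f = r * integral\<^sup>L N f"
proof -
  have "scale_measure (ennreal r) N = density N (\<lambda>_. ennreal r)"
    by (rule measure_eqI) (auto simp: emeasure_density nn_integral_cmult)
  then show ?thesis using assms by (simp add: integral_density)
qed

context prob_space
begin

lemma integral_exceedance_measure:
  fixes f :: "(nat \<Rightarrow> real) \<Rightarrow> real"
  assumes h: "h \<ge> 1" and V: "random_vector M h V" and "u > 0" "x > 0"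
    and f: "f \<in> borel_measurable (sphere_borel h)"
  shows "integral\<^sup>L (exceedance_measure M h V u x) f =
    (\<integral>\<omega>. f (vec_dir h (V \<omega>)) * indicator {u * x<..} (vec_norm h (V \<omega>)) \<partial>M) /
      prob {\<omega>\<in>space M. vec_norm h (V \<omega>) > x}"
proof -
  have [measurable]: "V \<in> borel_measurable M" and Eucl: "\<And>\<omega>. \<omega> \<in> space M \<Longrightarrow> V \<omega> \<in> topspace (Euclidean_space h)"
    using V by (auto simp: random_vector_def)
  let ?D = "{\<omega>\<in>space M. vec_norm h (V \<omega>) > u * x}"
  have dir [measurable]: "(\<lambda>\<omega>. vec_dir h (V \<omega>)) \<in> restrict_space M ?D \<rightarrow>\<^sub>M sphere_borel h"
    unfolding sphere_borel_def
  proof (rule measurable_restrict_space2)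
    have "u * x > 0" using assms by simp
    then show "(\<lambda>\<omega>. vec_dir h (V \<omega>)) \<in> space (restrict_space M ?D) \<rightarrow> topspace (nsphere (h - 1))"
      by (auto simp: space_restrict_space intro!: vec_dir_in_sphere[OF h Eucl] simp del: One_nat_def)
    show "(\<lambda>\<omega>. vec_dir h (V \<omega>)) \<in> borel_measurable (restrict_space M ?D)"
      by (rule measurable_restrict_space1) measurable
  qed
  have "integral\<^sup>L (exceedance_measure M h V u x) f =
      1 / prob {\<omega>\<in>space M. vec_norm h (V \<omega>) > x} * integral\<^sup>L (distr (restrict_space M ?D) (sphere_borel h) (\<lambda>\<omega>. vec_dir h (V \<omega>))) f"
    unfolding exceedance_measure_def by (rule integral_scale_measure) (use f in auto)
  also have "integral\<^sup>L (distr (restrict_space M ?D) (sphere_borel h) (\<lambda>\<omega>. vec_dir h (V \<omega>))) f =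
      (\<integral>\<omega>. f (vec_dir h (V \<omega>)) \<partial>restrict_space M ?D)"
    by (rule integral_distr) (use f in auto)
  also have "\<dots> = (\<integral>\<omega>. indicator ?D \<omega> *\<^sub>R f (vec_dir h (V \<omega>)) \<partial>M)"
    by (rule integral_restrict_space) measurable
  also have "\<dots> = (\<integral>\<omega>. f (vec_dir h (V \<omega>)) * indicator {u * x<..} (vec_norm h (V \<omega>)) \<partial>M)"
    by (intro Bochner_Integration.integral_cong) (auto simp: indicator_def)
  finally show ?thesis by simp
qed

section \<open>Spectral measure of a random multiple of an independent vector plus a
  remainder\<close>

context
  fixes h :: nat and \<alpha> c :: real and X :: "'a \<Rightarrow> real" and \<Xi> R V :: "'a \<Rightarrow> nat \<Rightarrow> real"
  assumes h: "h \<ge> 1" and \<alpha>: "\<alpha> > 0" and c: "c > 0"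
    and X_nonneg: "AE \<omega> in M. X \<omega> \<ge> 0"
    and indep: "indep_rv borel \<Xi> borel X"
    and R_meas [measurable]: "R \<in> borel_measurable M" and V: "random_vector M h V"
    and \<Xi>_Eucl: "\<And>\<omega>. \<omega> \<in> space M \<Longrightarrow> \<Xi> \<omega> \<in> topspace (Euclidean_space h)"
    and V_eq: "AE \<omega> in M. V \<omega> = (\<lambda>i. X \<omega> * \<Xi> \<omega> i + R \<omega> i)"
    and tail: "((\<lambda>x. x powr \<alpha> * prob {\<omega>\<in>space M. X \<omega> > x}) \<longlongrightarrow> c) at_top"
    and int_\<Xi>: "integrable M (\<lambda>\<omega>. vec_norm h (\<Xi> \<omega>) powr \<alpha>)"
    and pos_\<Xi>: "(\<integral>\<omega>. vec_norm h (\<Xi> \<omega>) powr \<alpha> \<partial>M) > 0"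
    and int_R: "integrable M (\<lambda>\<omega>. vec_norm h (R \<omega>) powr \<alpha>)"
begin

lemma \<Xi>_meas [measurable]: "\<Xi> \<in> borel_measurable M" and X_meas' [measurable]: "X \<in> borel_measurable M"
  using indep by (auto simp: indep_rv_def)

lemma V_meas [measurable]: "V \<in> borel_measurable M"
  using V by (simp add: random_vector_def)

text \<open>Supplies the form of independence that \<open>Breiman_limit\<close> asks for; \<phi>
  will be a test function evaluated at the direction.\<close>

lemma indep_norm:
  assumes [measurable]: "\<phi> \<in> borel_measurable borel"
  shows "indep_rv (borel \<Otimes>\<^sub>M borel) (\<lambda>\<omega>. (\<phi> (\<Xi> \<omega>) :: real, vec_norm h (\<Xi> \<omega>))) borel X"
proof -
  let ?g = "\<lambda>v. (\<phi> v, vec_norm h v)"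
  interpret PX: prob_space "distr M borel X" by (rule prob_space_distr) simp
  have "distr M (borel \<Otimes>\<^sub>M borel) (\<lambda>\<omega>. ?g (\<Xi> \<omega>)) \<Otimes>\<^sub>M distr M borel X =
      distr (distr M borel \<Xi>) (borel \<Otimes>\<^sub>M borel) ?g \<Otimes>\<^sub>M distr (distr M borel X) borel (\<lambda>x. x)"
    by (simp add: distr_distr comp_def)
  also have "\<dots> = distr (distr M borel \<Xi> \<Otimes>\<^sub>M distr M borel X) ((borel \<Otimes>\<^sub>M borel) \<Otimes>\<^sub>M borel) (\<lambda>(v, x). (?g v, x))"
    by (rule pair_measure_distr) (auto intro!: prob_space_imp_sigma_finite PX.prob_space_distr)
  also have "distr M borel \<Xi> \<Otimes>\<^sub>M distr M borel X = distr M (borel \<Otimes>\<^sub>M borel) (\<lambda>\<omega>. (\<Xi> \<omega>, X \<omega>))"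
    using indep by (simp add: indep_rv_def)
  also have "distr \<dots> ((borel \<Otimes>\<^sub>M borel) \<Otimes>\<^sub>M borel) (\<lambda>(v, x). (?g v, x)) =
      distr M ((borel \<Otimes>\<^sub>M borel) \<Otimes>\<^sub>M borel) (\<lambda>\<omega>. (?g (\<Xi> \<omega>), X \<omega>))"
    by (subst distr_distr) (auto simp: comp_def)
  finally show ?thesis by (simp add: indep_rv_def)
qed

lemma product_tail_tendsto:
  assumes [measurable]: "\<phi> \<in> borel_measurable borel" and "\<And>v. \<bar>\<phi> v\<bar> \<le> K" "u > 0"
  shows "((\<lambda>x. x powr \<alpha> * (\<integral>\<omega>. \<phi> (\<Xi> \<omega>) * indicator {u * x<..} (X \<omega> * vec_norm h (\<Xi> \<omega>)) \<partial>M)) \<longlongrightarrow>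
    u powr - \<alpha> * c * (\<integral>\<omega>. \<phi> (\<Xi> \<omega>) * vec_norm h (\<Xi> \<omega>) powr \<alpha> \<partial>M)) at_top"
  by (rule Breiman_limit[OF indep_norm _ _ \<alpha> _ tail int_\<Xi>]) (use assms in auto)

lemma product_prob_tendsto:
  assumes "u > 0"
  shows "((\<lambda>x. x powr \<alpha> * prob {\<omega>\<in>space M. X \<omega> * vec_norm h (\<Xi> \<omega>) > u * x}) \<longlongrightarrow>
    u powr - \<alpha> * c * (\<integral>\<omega>. vec_norm h (\<Xi> \<omega>) powr \<alpha> \<partial>M)) at_top"
proof -
  have "(\<integral>\<omega>. 1 * indicat_real {u * x<..} (X \<omega> * vec_norm h (\<Xi> \<omega>)) \<partial>M) = prob {\<omega>\<in>space M. X \<omega> * vec_norm h (\<Xi> \<omega>) > u * x}" for x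
  proof -
    have "(\<integral>\<omega>. 1 * indicat_real {u * x<..} (X \<omega> * vec_norm h (\<Xi> \<omega>)) \<partial>M) =
        (\<integral>\<omega>. indicator {\<omega>\<in>space M. X \<omega> * vec_norm h (\<Xi> \<omega>) > u * x} \<omega> \<partial>M)"
      by (intro Bochner_Integration.integral_cong) (auto simp: indicator_def)
    then show ?thesis by simp
  qed
  then show ?thesis using product_tail_tendsto[of "\<lambda>_. 1" 1 u] assms by simp
qed

text \<open>One term for each way in which the integrands can differ: the remainder exceeds
  \<open>eps * x\<close>; the norm of the product lies in a band around \<open>u * x\<close>, where
  a small remainder decides; or both norms exceed \<open>u * x\<close> and only the directions
  differ.\<close>

lemma direction_perturbation:
  fixes f :: "(nat \<Rightarrow> real) \<Rightarrow> real"
  assumes K: "\<And>v. \<bar>f v\<bar> \<le> K"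
    and unif: "\<And>v w. v \<in> topspace (nsphere (h - 1)) \<Longrightarrow> w \<in> topspace (nsphere (h - 1)) \<Longrightarrow>
      vec_norm h (\<lambda>i. v i - w i) < d \<Longrightarrow> \<bar>f v - f w\<bar> < \<eta>"
    and eps: "0 < eps" "eps < u" "2 * eps / u < d" and x: "x > 0"
  shows "AE \<omega> in M. \<bar>f (vec_dir h (V \<omega>)) * indicator {u * x<..} (vec_norm h (V \<omega>)) -
      f (vec_dir h (\<Xi> \<omega>)) * indicator {u * x<..} (X \<omega> * vec_norm h (\<Xi> \<omega>))\<bar> \<le>
    2 * K * indicator {eps * x<..} (vec_norm h (R \<omega>)) +
    K * (indicator {(u - eps) * x<..} (X \<omega> * vec_norm h (\<Xi> \<omega>)) - indicator {(u + eps) * x<..} (X \<omega> * vec_norm h (\<Xi> \<omega>))) +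
    \<eta> * indicator {u * x<..} (X \<omega> * vec_norm h (\<Xi> \<omega>))"
  using X_nonneg V_eq AE_space
proof eventually_elim
  case (elim \<omega>)
  define y where "y = X \<omega> * vec_norm h (\<Xi> \<omega>)"
  define v where "v = vec_norm h (V \<omega>)"
  define \<rho> where "\<rho> = vec_norm h (R \<omega>)"
  define F where "F = f (vec_dir h (V \<omega>))"
  define G where "G = f (vec_dir h (\<Xi> \<omega>))"
  have FG: "\<bar>F\<bar> \<le> K" "\<bar>G\<bar> \<le> K" using K by (auto simp: F_def G_def)
  have K0: "K \<ge> 0" using FG by linarith
  \<comment> \<open>Positivity follows by comparing a point of the sphere with itself in
    \<open>unif\<close>.\<close>
  have \<eta>: "\<eta> > 0"
  proof -
    have "2 * eps / u > 0" using eps by simp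
    then have "d > 0" using eps(3) by linarith
    then have "\<bar>f (\<lambda>n. if n = 0 then 1 else 0) - f (\<lambda>n. if n = 0 then 1 else 0)\<bar> < \<eta>"
      by (intro unif in_topspace_nsphere) (simp add: vec_norm_def L2_set_def)
    then show ?thesis by simp
  qed
  have y_norm: "vec_norm h (\<lambda>i. X \<omega> * \<Xi> \<omega> i) = y"
    using elim by (simp add: y_def vec_norm_scale)
  have vy: "\<bar>v - y\<bar> \<le> \<rho>"
    using vec_norm_diff[of h "\<lambda>i. X \<omega> * \<Xi> \<omega> i" "R \<omega>"] elim(2) unfolding y_norm v_def \<rho>_def by simp
  have ord: "(u - eps) * x < u * x" "u * x < (u + eps) * x"
    using eps x by (auto intro!: mult_strict_right_mono)
  have exp: "(u - eps) * x = u * x - eps * x" "(u + eps) * x = u * x + eps * x"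
    by (simp_all add: algebra_simps)
  have both: "\<bar>F - G\<bar> < \<eta>" if "\<rho> \<le> eps * x" "v > u * x" "y > u * x"
  proof -
    have ux: "u * x > 0" using eps x by simp
    have pos: "X \<omega> > 0" "vec_norm h (\<Xi> \<omega>) > 0"
      using that(3) ux elim(1) vec_norm_nonneg[of h "\<Xi> \<omega>"] unfolding y_def
      by (auto simp: order.order_iff_strict[of 0])
    have dirY: "vec_dir h (\<lambda>i. X \<omega> * \<Xi> \<omega> i) = vec_dir h (\<Xi> \<omega>)" by (rule vec_dir_scale) fact
    have "vec_norm h (\<lambda>i. vec_dir h (V \<omega>) i - vec_dir h (\<Xi> \<omega>) i) \<le> 2 * \<rho> / y"
      using vec_dir_add_diff[of h "\<lambda>i. X \<omega> * \<Xi> \<omega> i" "R \<omega>"] that ux elim(2)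
      unfolding y_norm dirY \<rho>_def v_def by simp
    also have "\<dots> \<le> 2 * (eps * x) / (u * x)"
      using that ux eps x by (intro frac_le) auto
    also have "\<dots> < d" using x eps by simp
    finally have "vec_norm h (\<lambda>i. vec_dir h (V \<omega>) i - vec_dir h (\<Xi> \<omega>) i) < d" .
    moreover have "vec_dir h (V \<omega>) \<in> topspace (nsphere (h - 1))"
      using V elim(3) that ux by (intro vec_dir_in_sphere[OF h]) (auto simp: random_vector_def v_def)
    moreover have "vec_dir h (\<Xi> \<omega>) \<in> topspace (nsphere (h - 1))"
      by (intro vec_dir_in_sphere[OF h] \<Xi>_Eucl elim(3) pos)
    ultimately show ?thesis unfolding F_def G_def by (intro unif)
  qed
  have "\<bar>F * indicator {u * x<..} v - G * indicator {u * x<..} y\<bar> \<le>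
    2 * K * indicator {eps * x<..} \<rho> + K * (indicator {(u - eps) * x<..} y - indicator {(u + eps) * x<..} y) +
    \<eta> * indicator {u * x<..} y"
  proof (cases "\<rho> \<le> eps * x")
    case False
    have "\<bar>F * indicator {u * x<..} v - G * indicator {u * x<..} y\<bar> \<le> 2 * K"
      using FG by (auto simp: indicator_def)
    moreover have "K * (indicator {(u - eps) * x<..} y - indicator {(u + eps) * x<..} y) \<ge> 0"
      using ord K0 by (auto simp: indicator_def)
    ultimately show ?thesis using False \<eta> by (auto simp: indicator_def)
  next
    \<comment> \<open>Now the norms \<open>v\<close> and \<open>y\<close> differ by at most
      \<open>eps * x\<close>, so outside the band they lie on the same side of
      \<open>u * x\<close>.\<close>
    case True
    then show ?thesis
      using both[OF True] vy ord FG K0 \<eta> unfolding exp by (auto simp: indicator_def)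
  qed
  then show ?case unfolding F_def G_def v_def y_def \<rho>_def .
qed

text \<open>The limit for the pure product is Breiman's lemma; the remainder is removed by
  \<open>direction_perturbation\<close>. The test function is extended by zero because
  \<open>vec_dir\<close> of a vector of norm 0 is not on the sphere.\<close>

lemma direction_tail_tendsto:
  fixes f :: "(nat \<Rightarrow> real) \<Rightarrow> real"
  assumes cont: "continuous_map (nsphere (h - 1)) euclideanreal f" and u: "u > 0"
  defines "f' \<equiv> (\<lambda>w. f w * indicator (topspace (nsphere (h - 1))) w)"
  shows "((\<lambda>x. x powr \<alpha> * (\<integral>\<omega>. f' (vec_dir h (V \<omega>)) * indicator {u * x<..} (vec_norm h (V \<omega>)) \<partial>M)) \<longlongrightarrow>
    u powr - \<alpha> * c * (\<integral>\<omega>. f' (vec_dir h (\<Xi> \<omega>)) * vec_norm h (\<Xi> \<omega>) powr \<alpha> \<partial>M)) at_top"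
proof -
  obtain K where K0: "K \<ge> 0" and Kf: "\<And>v. v \<in> topspace (nsphere (h - 1)) \<Longrightarrow> \<bar>f v\<bar> \<le> K"
    using sphere_bounded[OF h cont] by blast
  have K: "\<bar>f' v\<bar> \<le> K" for v using K0 Kf[of v] by (auto simp: f'_def indicator_def simp del: One_nat_def)
  have f'_meas [measurable]: "f' \<in> borel_measurable borel"
    using sphere_continuous_measurable[OF h cont] sphere_sets[OF h]
    unfolding sphere_borel_def f'_def by (subst (asm) borel_measurable_restrict_space_iff) (auto simp: mult.commute simp del: One_nat_def)
  define E where "E = (\<integral>\<omega>. vec_norm h (\<Xi> \<omega>) powr \<alpha> \<partial>M)"
  define P where "P w x = x powr \<alpha> * prob {\<omega>\<in>space M. X \<omega> * vec_norm h (\<Xi> \<omega>) > w * x}" for w x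
  have P_lim: "(P w \<longlongrightarrow> w powr - \<alpha> * c * E) at_top" if "w > 0" for w
    using product_prob_tendsto[OF that] by (simp add: P_def[abs_def] E_def)
  define T where "T x = x powr \<alpha> * (\<integral>\<omega>. f' (vec_dir h (V \<omega>)) * indicator {u * x<..} (vec_norm h (V \<omega>)) \<partial>M)" for x
  define T0 where "T0 x = x powr \<alpha> * (\<integral>\<omega>. f' (vec_dir h (\<Xi> \<omega>)) * indicator {u * x<..} (X \<omega> * vec_norm h (\<Xi> \<omega>)) \<partial>M)" for x
  have T0_lim: "(T0 \<longlongrightarrow> u powr - \<alpha> * c * (\<integral>\<omega>. f' (vec_dir h (\<Xi> \<omega>)) * vec_norm h (\<Xi> \<omega>) powr \<alpha> \<partial>M)) at_top"
    unfolding T0_def[abs_def] by (rule product_tail_tendsto[where \<phi> = "\<lambda>v. f' (vec_dir h v)" and K = K]) (use K u in auto)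
  have int_ind [simp]: "integrable M (\<lambda>\<omega>. indicat_real {a<..} (Z \<omega>))"
    and prob_ind: "(\<integral>\<omega>. indicat_real {a<..} (Z \<omega>) \<partial>M) = prob {\<omega>\<in>space M. Z \<omega> > a}"
    if [measurable]: "Z \<in> borel_measurable M" for a :: real and Z
  proof -
    show "integrable M (\<lambda>\<omega>. indicat_real {a<..} (Z \<omega>))"
      by (rule integrable_const_bound[of _ 1]) (auto simp: indicator_def)
    have "(\<integral>\<omega>. indicat_real {a<..} (Z \<omega>) \<partial>M) = (\<integral>\<omega>. indicat_real {\<omega>\<in>space M. Z \<omega> > a} \<omega> \<partial>M)"
      by (intro Bochner_Integration.integral_cong) (auto simp: indicator_def)
    then show "(\<integral>\<omega>. indicat_real {a<..} (Z \<omega>) \<partial>M) = prob {\<omega>\<in>space M. Z \<omega> > a}" by simp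
  qed
  have diff: "((\<lambda>x. T x - T0 x) \<longlongrightarrow> 0) at_top"
  proof (rule tendstoI)
    fix e :: real assume e: "e > 0"
    have E0: "u powr - \<alpha> * c * E \<ge> 0"
      using c pos_\<Xi> by (simp add: E_def)
    \<comment> \<open>Makes the limit of the direction error smaller than \<open>e / 2\<close>; the
      summand 1 keeps the denominator positive.\<close>
    define \<eta> where "\<eta> = e / (2 * (u powr - \<alpha> * c * E + 1))"
    have \<eta>: "\<eta> > 0" using E0 e by (simp add: \<eta>_def)
    have \<eta>_small: "\<eta> * (u powr - \<alpha> * c * E) < e / 2"
    proof -
      have half: "e / (2 * Z) * Z = e / 2" if "Z > 0" for Z :: real using that by simp
      have "\<eta> * (u powr - \<alpha> * c * E + 1) = e / 2"
        unfolding \<eta>_def by (rule half) (use E0 in linarith)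
      moreover have "\<eta> * (u powr - \<alpha> * c * E) < \<eta> * (u powr - \<alpha> * c * E + 1)"
        using \<eta> by (intro mult_strict_left_mono) auto
      ultimately show ?thesis by simp
    qed
    obtain d where d: "d > 0"
      "\<And>v w. v \<in> topspace (nsphere (h - 1)) \<Longrightarrow> w \<in> topspace (nsphere (h - 1)) \<Longrightarrow>
        vec_norm h (\<lambda>i. v i - w i) < d \<Longrightarrow> \<bar>f v - f w\<bar> < \<eta>"
      using sphere_uniformly_continuous[OF h cont \<eta>] by blast
    have unif: "\<bar>f' v - f' w\<bar> < \<eta>" if "v \<in> topspace (nsphere (h - 1))" "w \<in> topspace (nsphere (h - 1))"
        "vec_norm h (\<lambda>i. v i - w i) < d" for v w
      using d(2)[OF that] that by (simp add: f'_def)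
    \<comment> \<open>The limiting weight of the band vanishes with \<open>eps\<close>, because the
      power with exponent - \<alpha> is continuous at \<open>u\<close>.\<close>
    have "((\<lambda>eps. K * ((u - eps) powr - \<alpha> * c * E - (u + eps) powr - \<alpha> * c * E)) \<longlongrightarrow>
        K * ((u - 0) powr - \<alpha> * c * E - (u + 0) powr - \<alpha> * c * E)) (at_right 0)"
      using u by (intro tendsto_intros) auto
    then have "eventually (\<lambda>eps. K * ((u - eps) powr - \<alpha> * c * E - (u + eps) powr - \<alpha> * c * E) < e / 2) (at_right 0)"
      using e by (intro order_tendstoD(2)) auto
    moreover have "((\<lambda>eps. 2 * eps / u) \<longlongrightarrow> 2 * 0 / u) (at_right 0)" using u by (intro tendsto_intros) auto
    then have "eventually (\<lambda>eps. 2 * eps / u < d) (at_right 0)"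
      using d(1) by (intro order_tendstoD(2)) auto
    moreover have "eventually (\<lambda>eps. eps \<in> {0<..<u}) (at_right 0)"
      using eventually_at_right_real[of 0 u] u by simp
    ultimately have "eventually (\<lambda>eps. K * ((u - eps) powr - \<alpha> * c * E - (u + eps) powr - \<alpha> * c * E) < e / 2 \<and>
        2 * eps / u < d \<and> eps \<in> {0<..<u}) (at_right 0)"
      by (intro eventually_conj)
    then obtain eps where eps: "K * ((u - eps) powr - \<alpha> * c * E - (u + eps) powr - \<alpha> * c * E) < e / 2"
      "2 * eps / u < d" "0 < eps" "eps < u"
      using eventually_happens'[of "at_right (0::real)"] trivial_limit_at_right_real by fastforce
    define Q where "Q x = x powr \<alpha> * prob {\<omega>\<in>space M. vec_norm h (R \<omega>) > eps * x}" for x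
    have Q_lim: "(Q \<longlongrightarrow> 0) at_top"
      unfolding Q_def[abs_def] by (rule tail_moment_tendsto_zero) (use int_R \<alpha> eps in auto)
    define Bd where "Bd x = 2 * K * Q x + K * (P (u - eps) x - P (u + eps) x) + \<eta> * P u x" for x
    have "(Bd \<longlongrightarrow> 2 * K * 0 + K * ((u - eps) powr - \<alpha> * c * E - (u + eps) powr - \<alpha> * c * E) + \<eta> * (u powr - \<alpha> * c * E)) at_top"
      unfolding Bd_def[abs_def] by (intro tendsto_intros Q_lim P_lim) (use u eps in auto)
    then have "eventually (\<lambda>x. Bd x < e) at_top"
      by (rule order_tendstoD(2)) (use eps(1) \<eta>_small in linarith)
    then show "eventually (\<lambda>x. dist (T x - T0 x) 0 < e) at_top"
      using eventually_gt_at_top[of 0]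
    proof eventually_elim
      case (elim x)
      let ?F = "\<lambda>\<omega>. f' (vec_dir h (V \<omega>)) * indicator {u * x<..} (vec_norm h (V \<omega>))"
      let ?G = "\<lambda>\<omega>. f' (vec_dir h (\<Xi> \<omega>)) * indicator {u * x<..} (X \<omega> * vec_norm h (\<Xi> \<omega>))"
      let ?H = "\<lambda>\<omega>. 2 * K * indicator {eps * x<..} (vec_norm h (R \<omega>)) +
        K * (indicator {(u - eps) * x<..} (X \<omega> * vec_norm h (\<Xi> \<omega>)) - indicator {(u + eps) * x<..} (X \<omega> * vec_norm h (\<Xi> \<omega>))) +
        \<eta> * indicator {u * x<..} (X \<omega> * vec_norm h (\<Xi> \<omega>))"
      have int_F: "integrable M ?F"
        by (rule integrable_const_bound[of _ K]) (use K K0 in \<open>auto simp: indicator_def\<close>)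
      have int_G: "integrable M ?G"
        by (rule integrable_const_bound[of _ K]) (use K K0 in \<open>auto simp: indicator_def\<close>)
      have int_H: "integrable M ?H"
        by (intro Bochner_Integration.integrable_add Bochner_Integration.integrable_diff integrable_mult_right int_ind) measurable
      have "\<bar>(\<integral>\<omega>. ?F \<omega> \<partial>M) - (\<integral>\<omega>. ?G \<omega> \<partial>M)\<bar> = \<bar>\<integral>\<omega>. ?F \<omega> - ?G \<omega> \<partial>M\<bar>"
        using int_F int_G by simp
      also have "\<dots> \<le> (\<integral>\<omega>. \<bar>?F \<omega> - ?G \<omega>\<bar> \<partial>M)" by (rule integral_abs_bound)
      also have "\<dots> \<le> (\<integral>\<omega>. ?H \<omega> \<partial>M)"
        by (intro integral_mono_AE int_H integrable_abs Bochner_Integration.integrable_diff int_F int_G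
            direction_perturbation[OF K unif eps(3,4,2) elim(2)])
      also have "\<dots> = 2 * K * prob {\<omega>\<in>space M. vec_norm h (R \<omega>) > eps * x} +
          K * (prob {\<omega>\<in>space M. X \<omega> * vec_norm h (\<Xi> \<omega>) > (u - eps) * x} - prob {\<omega>\<in>space M. X \<omega> * vec_norm h (\<Xi> \<omega>) > (u + eps) * x}) +
          \<eta> * prob {\<omega>\<in>space M. X \<omega> * vec_norm h (\<Xi> \<omega>) > u * x}"
        by (simp add: prob_ind)
      finally have "x powr \<alpha> * \<bar>(\<integral>\<omega>. ?F \<omega> \<partial>M) - (\<integral>\<omega>. ?G \<omega> \<partial>M)\<bar> \<le> x powr \<alpha> * \<dots>"
        by (rule mult_left_mono) simp
      also have "\<dots> = Bd x" by (simp add: Bd_def P_def Q_def algebra_simps)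
      finally have "x powr \<alpha> * \<bar>(\<integral>\<omega>. ?F \<omega> \<partial>M) - (\<integral>\<omega>. ?G \<omega> \<partial>M)\<bar> < e" using elim(1) by linarith
      moreover have "dist (T x - T0 x) 0 = x powr \<alpha> * \<bar>(\<integral>\<omega>. ?F \<omega> \<partial>M) - (\<integral>\<omega>. ?G \<omega> \<partial>M)\<bar>"
        by (simp add: T_def T0_def dist_real_def right_diff_distrib[symmetric] abs_mult)
      ultimately show ?case by simp
    qed
  qed
  have "((\<lambda>x. (T x - T0 x) + T0 x) \<longlongrightarrow> 0 + u powr - \<alpha> * c * (\<integral>\<omega>. f' (vec_dir h (\<Xi> \<omega>)) * vec_norm h (\<Xi> \<omega>) powr \<alpha> \<partial>M)) at_top"
    by (intro tendsto_add diff T0_lim)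
  then show ?thesis by (simp add: T_def)
qed

text \<open>After multiplication by \<open>x powr \<alpha>\<close>, numerator and denominator of the
  exceedance measure converge separately and the tail constant \<open>c\<close> cancels. Every
  continuous function on the sphere is tested, as the sphere is compact.\<close>

theorem spectral_measure_product_perturbation:
  "\<exists>S. is_tilted_direction_law M h \<Xi> \<alpha> S \<and> has_spectral_measure M h V \<alpha> S"
proof -
  let ?S = "topspace (nsphere (h - 1))"
  define E where "E = (\<integral>\<omega>. vec_norm h (\<Xi> \<omega>) powr \<alpha> \<partial>M)"
  have E: "E > 0" using pos_\<Xi> by (simp add: E_def)
  obtain S where S: "is_tilted_direction_law M h \<Xi> \<alpha> S"
    and S_int: "\<And>f. f \<in> borel_measurable (sphere_borel h) \<Longrightarrow>
      integral\<^sup>L S f = (\<integral>\<omega>. (if vec_norm h (\<Xi> \<omega>) > 0 then f (vec_dir h (\<Xi> \<omega>)) else 0) * vec_norm h (\<Xi> \<omega>) powr \<alpha> \<partial>M) / E"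
    unfolding E_def using tilted_direction_law_exists[OF h \<Xi>_meas \<Xi>_Eucl \<alpha> int_\<Xi> pos_\<Xi>] by blast
  have prob_S: "prob_space S" and sets_S: "sets S = sets (sphere_borel h)"
    using S by (auto simp: is_tilted_direction_law_def)
  have dir_V: "f (vec_dir h (V \<omega>)) * indicator {u * x<..} (vec_norm h (V \<omega>)) =
      (f (vec_dir h (V \<omega>)) * indicator ?S (vec_dir h (V \<omega>))) * indicator {u * x<..} (vec_norm h (V \<omega>))"
    if "\<omega> \<in> space M" "u > 0" "x > 0" for f :: "(nat \<Rightarrow> real) \<Rightarrow> real" and u x \<omega>
  proof (cases "vec_norm h (V \<omega>) > u * x")
    case True
    have "u * x > 0" using that by simp
    then have "vec_norm h (V \<omega>) > 0" using True by linarith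
    then have "vec_dir h (V \<omega>) \<in> ?S"
      using V that by (intro vec_dir_in_sphere[OF h]) (auto simp: random_vector_def)
    then show ?thesis by simp
  qed simp
  \<comment> \<open>The case of the constant test function 1 at \<open>u = 1\<close>.\<close>
  have norm_lim: "((\<lambda>x. x powr \<alpha> * prob {\<omega>\<in>space M. vec_norm h (V \<omega>) > x}) \<longlongrightarrow> c * E) at_top"
  proof -
    have "((\<lambda>x. x powr \<alpha> * (\<integral>\<omega>. (1 * indicator ?S (vec_dir h (V \<omega>))) * indicator {1 * x<..} (vec_norm h (V \<omega>)) \<partial>M)) \<longlongrightarrow>
      1 powr - \<alpha> * c * (\<integral>\<omega>. (1 * indicator ?S (vec_dir h (\<Xi> \<omega>))) * vec_norm h (\<Xi> \<omega>) powr \<alpha> \<partial>M)) at_top"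
      by (rule direction_tail_tendsto) auto
    moreover have "(\<integral>\<omega>. (1 * indicator ?S (vec_dir h (\<Xi> \<omega>))) * vec_norm h (\<Xi> \<omega>) powr \<alpha> \<partial>M) = E"
      unfolding E_def
    proof (intro Bochner_Integration.integral_cong refl)
      fix \<omega> assume "\<omega> \<in> space M"
      then show "(1 * indicator ?S (vec_dir h (\<Xi> \<omega>))) * vec_norm h (\<Xi> \<omega>) powr \<alpha> = vec_norm h (\<Xi> \<omega>) powr \<alpha>"
        using vec_dir_in_sphere[OF h \<Xi>_Eucl, of \<omega>] vec_norm_nonneg[of h "\<Xi> \<omega>"]
        by (cases "vec_norm h (\<Xi> \<omega>) = 0") (auto simp: order.order_iff_strict[of 0] simp del: One_nat_def)
    qed
    ultimately have lim: "((\<lambda>x. x powr \<alpha> * (\<integral>\<omega>. (1 * indicator ?S (vec_dir h (V \<omega>))) * indicator {1 * x<..} (vec_norm h (V \<omega>)) \<partial>M)) \<longlongrightarrow> c * E) at_top"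
      by simp
    have "(\<integral>\<omega>. (1 * indicator ?S (vec_dir h (V \<omega>))) * indicator {1 * x<..} (vec_norm h (V \<omega>)) \<partial>M) = prob {\<omega>\<in>space M. vec_norm h (V \<omega>) > x}"
      if "x > 0" for x
    proof -
      have "(\<integral>\<omega>. (1 * indicator ?S (vec_dir h (V \<omega>))) * indicator {1 * x<..} (vec_norm h (V \<omega>)) \<partial>M) =
          (\<integral>\<omega>. indicat_real {\<omega>\<in>space M. vec_norm h (V \<omega>) > x} \<omega> \<partial>M)"
      proof (intro Bochner_Integration.integral_cong refl)
        fix \<omega> assume "\<omega> \<in> space M"
        then show "(1 * indicator ?S (vec_dir h (V \<omega>))) * indicator {1 * x<..} (vec_norm h (V \<omega>)) = indicat_real {\<omega>\<in>space M. vec_norm h (V \<omega>) > x} \<omega>"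
          using dir_V[of \<omega> 1 x "\<lambda>_. 1"] that by (auto simp: indicator_def simp del: One_nat_def)
      qed
      then show ?thesis by simp
    qed
    then have "eventually (\<lambda>x. x powr \<alpha> * (\<integral>\<omega>. (1 * indicator ?S (vec_dir h (V \<omega>))) * indicator {1 * x<..} (vec_norm h (V \<omega>)) \<partial>M) =
        x powr \<alpha> * prob {\<omega>\<in>space M. vec_norm h (V \<omega>) > x}) at_top"
      by (intro eventually_mono[OF eventually_gt_at_top[of 0]]) simp
    then show ?thesis by (rule Lim_transform_eventually[OF lim])
  qed
  have "vague_limit (nsphere (h - 1)) (exceedance_measure M h V u) (scale_measure (ennreal (u powr - \<alpha>)) S) at_top"
    if u: "u > 0" for u
    unfolding vague_limit_def
  proof (intro allI impI, elim conjE)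
    fix f :: "(nat \<Rightarrow> real) \<Rightarrow> real"
    assume cont: "continuous_map (nsphere (h - 1)) euclideanreal f"
    have f_meas: "f \<in> borel_measurable (sphere_borel h)" by (rule sphere_continuous_measurable[OF h cont])
    let ?f = "\<lambda>w. f w * indicator ?S w"
    define I where "I = (\<integral>\<omega>. ?f (vec_dir h (\<Xi> \<omega>)) * vec_norm h (\<Xi> \<omega>) powr \<alpha> \<partial>M)"
    have "(\<integral>\<omega>. (if vec_norm h (\<Xi> \<omega>) > 0 then f (vec_dir h (\<Xi> \<omega>)) else 0) * vec_norm h (\<Xi> \<omega>) powr \<alpha> \<partial>M) = I"
      unfolding I_def
    proof (intro Bochner_Integration.integral_cong refl)
      fix \<omega> assume "\<omega> \<in> space M"
      then show "(if vec_norm h (\<Xi> \<omega>) > 0 then f (vec_dir h (\<Xi> \<omega>)) else 0) * vec_norm h (\<Xi> \<omega>) powr \<alpha> =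
          ?f (vec_dir h (\<Xi> \<omega>)) * vec_norm h (\<Xi> \<omega>) powr \<alpha>"
        using vec_dir_in_sphere[OF h \<Xi>_Eucl, of \<omega>] vec_norm_nonneg[of h "\<Xi> \<omega>"]
        by (cases "vec_norm h (\<Xi> \<omega>) = 0") (auto simp: order.order_iff_strict[of 0] simp del: One_nat_def)
    qed
    then have S_f: "integral\<^sup>L S f = I / E" using S_int[OF f_meas] by simp
    have lim: "integral\<^sup>L (scale_measure (ennreal (u powr - \<alpha>)) S) f = (u powr - \<alpha> * c * I) / (c * E)"
      using f_meas c E by (subst integral_scale_measure) (auto simp: S_f measurable_cong_sets[OF sets_S refl])
    have "((\<lambda>x. (x powr \<alpha> * (\<integral>\<omega>. ?f (vec_dir h (V \<omega>)) * indicator {u * x<..} (vec_norm h (V \<omega>)) \<partial>M)) /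
        (x powr \<alpha> * prob {\<omega>\<in>space M. vec_norm h (V \<omega>) > x})) \<longlongrightarrow> (u powr - \<alpha> * c * I) / (c * E)) at_top"
      unfolding I_def using c E by (intro tendsto_divide direction_tail_tendsto[OF cont u] norm_lim) auto
    moreover have "eventually (\<lambda>x. (x powr \<alpha> * (\<integral>\<omega>. ?f (vec_dir h (V \<omega>)) * indicator {u * x<..} (vec_norm h (V \<omega>)) \<partial>M)) /
        (x powr \<alpha> * prob {\<omega>\<in>space M. vec_norm h (V \<omega>) > x}) = integral\<^sup>L (exceedance_measure M h V u x) f) at_top"
      using eventually_gt_at_top[of 0]
    proof eventually_elim
      case (elim x)
      have "(\<integral>\<omega>. f (vec_dir h (V \<omega>)) * indicator {u * x<..} (vec_norm h (V \<omega>)) \<partial>M) =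
          (\<integral>\<omega>. ?f (vec_dir h (V \<omega>)) * indicator {u * x<..} (vec_norm h (V \<omega>)) \<partial>M)"
        by (intro Bochner_Integration.integral_cong refl dir_V u elim)
      then show ?case using elim by (simp add: integral_exceedance_measure[OF h V u elim f_meas])
    qed
    ultimately show "((\<lambda>x. integral\<^sup>L (exceedance_measure M h V u x) f) \<longlongrightarrow>
        integral\<^sup>L (scale_measure (ennreal (u powr - \<alpha>)) S) f) at_top"
      unfolding lim by (rule Lim_transform_eventually)
  qed
  then have "has_spectral_measure M h V \<alpha> S"
    unfolding has_spectral_measure_def using h \<alpha> V prob_S sets_S by blast
  then show ?thesis using S by blast
qed

end

end

section \<open>Stationary scalar recursions\<close>

lemma powr_add_le:
  fixes x y :: real
  assumes "x \<ge> 0" "y \<ge> 0" "p > 0"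
  shows "(x + y) powr p \<le> 2 powr p * (x powr p + y powr p)"
proof -
  have "(x + y) powr p \<le> (2 * max x y) powr p"
    using assms by (intro powr_mono2) auto
  also have "\<dots> = 2 powr p * max x y powr p" using assms by (simp add: powr_mult)
  also have "max x y powr p \<le> x powr p + y powr p" by (simp add: max_def)
  finally show ?thesis by simp
qed

section \<open>Variables determined by a part of the driving sequence\<close>

context prob_space
begin

text \<open>Measurability with respect to the coordinates in \<open>I\<close>, up to null sets.
  Causality is given in terms of such a function, and recursions hold only almost surely, so
  equality almost everywhere is the right notion.\<close>

definition determined_by :: "(int \<Rightarrow> 'a \<Rightarrow> 'z::topological_space) \<Rightarrow> int set \<Rightarrow> ('a \<Rightarrow> 'b::topological_space) \<Rightarrow> bool" where
  "determined_by Z I Y \<longleftrightarrow>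
    (\<exists>g \<in> borel_measurable (\<Pi>\<^sub>M s\<in>I. borel). AE \<omega> in M. Y \<omega> = g (\<lambda>s\<in>I. Z s \<omega>))"

lemma determined_by_mono:
  assumes "determined_by Z I Y" "I \<subseteq> J"
  shows "determined_by Z J Y"
proof -
  obtain g where g: "g \<in> borel_measurable (\<Pi>\<^sub>M s\<in>I. borel)" "AE \<omega> in M. Y \<omega> = g (\<lambda>s\<in>I. Z s \<omega>)"
    using assms(1) by (auto simp: determined_by_def)
  have "(\<lambda>z. g (restrict z I)) \<in> borel_measurable (\<Pi>\<^sub>M s\<in>J. borel)"
    using measurable_compose[OF measurable_restrict_subset[OF assms(2)] g(1)] .
  moreover have "restrict (\<lambda>s\<in>J. Z s \<omega>) I = (\<lambda>s\<in>I. Z s \<omega>)" for \<omega>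
    using assms(2) by (auto simp: restrict_def fun_eq_iff)
  then have "AE \<omega> in M. Y \<omega> = g (restrict (\<lambda>s\<in>J. Z s \<omega>) I)" using g(2) by simp
  ultimately show ?thesis unfolding determined_by_def by (intro bexI[of _ "\<lambda>z. g (restrict z I)"])
qed

lemma determined_by_component:
  assumes "t \<in> I" "f \<in> borel_measurable borel"
  shows "determined_by Z I (\<lambda>\<omega>. f (Z t \<omega>))"
  unfolding determined_by_def
proof (rule bexI)
  show "(\<lambda>z. f (z t)) \<in> borel_measurable (\<Pi>\<^sub>M s\<in>I. borel)"
    using measurable_compose[OF measurable_component_singleton[OF assms(1)] assms(2)] .
qed (use assms in auto)

lemma determined_by_const: "determined_by Z I (\<lambda>_. c)"
  unfolding determined_by_def by (rule bexI[of _ "\<lambda>_. c"]) auto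

lemma determined_by_compose:
  assumes "determined_by Z I Y" "f \<in> borel_measurable borel"
  shows "determined_by Z I (\<lambda>\<omega>. f (Y \<omega>))"
proof -
  obtain g where g: "g \<in> borel_measurable (\<Pi>\<^sub>M s\<in>I. borel)" "AE \<omega> in M. Y \<omega> = g (\<lambda>s\<in>I. Z s \<omega>)"
    using assms(1) by (auto simp: determined_by_def)
  have "(\<lambda>z. f (g z)) \<in> borel_measurable (\<Pi>\<^sub>M s\<in>I. borel)" by (rule measurable_compose[OF g(1) assms(2)])
  moreover have "AE \<omega> in M. f (Y \<omega>) = f (g (\<lambda>s\<in>I. Z s \<omega>))" using g(2) by eventually_elim simp
  ultimately show ?thesis unfolding determined_by_def by (intro bexI[of _ "\<lambda>z. f (g z)"])
qed

lemma determined_by_add_mult: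
  fixes Y Y' :: "'a \<Rightarrow> real"
  assumes "determined_by Z I Y" "determined_by Z I Y'"
  shows "determined_by Z I (\<lambda>\<omega>. Y \<omega> + Y' \<omega>)" "determined_by Z I (\<lambda>\<omega>. Y \<omega> * Y' \<omega>)"
proof -
  obtain g where g [measurable]: "g \<in> borel_measurable (\<Pi>\<^sub>M s\<in>I. borel)" "AE \<omega> in M. Y \<omega> = g (\<lambda>s\<in>I. Z s \<omega>)"
    using assms(1) by (auto simp: determined_by_def)
  obtain g' where g' [measurable]: "g' \<in> borel_measurable (\<Pi>\<^sub>M s\<in>I. borel)" "AE \<omega> in M. Y' \<omega> = g' (\<lambda>s\<in>I. Z s \<omega>)"
    using assms(2) by (auto simp: determined_by_def)
  have "AE \<omega> in M. Y \<omega> + Y' \<omega> = g (\<lambda>s\<in>I. Z s \<omega>) + g' (\<lambda>s\<in>I. Z s \<omega>)"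
    using g(2) g'(2) by eventually_elim simp
  then show "determined_by Z I (\<lambda>\<omega>. Y \<omega> + Y' \<omega>)"
    unfolding determined_by_def by (intro bexI[of _ "\<lambda>z. g z + g' z"]) auto
  have "AE \<omega> in M. Y \<omega> * Y' \<omega> = g (\<lambda>s\<in>I. Z s \<omega>) * g' (\<lambda>s\<in>I. Z s \<omega>)"
    using g(2) g'(2) by eventually_elim simp
  then show "determined_by Z I (\<lambda>\<omega>. Y \<omega> * Y' \<omega>)"
    unfolding determined_by_def by (intro bexI[of _ "\<lambda>z. g z * g' z"]) auto
qed

lemma determined_by_sequence:
  fixes Y :: "'a \<Rightarrow> nat \<Rightarrow> real"
  assumes "\<And>i. determined_by Z I (\<lambda>\<omega>. Y \<omega> i)"
  shows "determined_by Z I Y"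
proof -
  have "\<forall>i. \<exists>g. g \<in> borel_measurable (\<Pi>\<^sub>M s\<in>I. borel) \<and> (AE \<omega> in M. Y \<omega> i = g (\<lambda>s\<in>I. Z s \<omega>))"
    using assms unfolding determined_by_def by blast
  then obtain g where g: "\<And>i. g i \<in> borel_measurable (\<Pi>\<^sub>M s\<in>I. borel)" "\<And>i. AE \<omega> in M. Y \<omega> i = g i (\<lambda>s\<in>I. Z s \<omega>)"
    by metis
  have "(\<lambda>z i. g i z) \<in> borel_measurable (\<Pi>\<^sub>M s\<in>I. borel)"
    by (rule measurable_coordinatewise_then_product) (rule g(1))
  moreover have "AE \<omega> in M. \<forall>i. Y \<omega> i = g i (\<lambda>s\<in>I. Z s \<omega>)" using g(2) by (simp add: AE_all_countable)
  then have "AE \<omega> in M. Y \<omega> = (\<lambda>i. g i (\<lambda>s\<in>I. Z s \<omega>))" by eventually_elim auto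
  ultimately show ?thesis unfolding determined_by_def by (intro bexI[of _ "\<lambda>z i. g i z"])
qed

text \<open>Disjoint blocks of an independent family are independent, and joint laws do not see
  almost sure modifications.\<close>

lemma determined_by_indep:
  assumes Z: "indep_vars (\<lambda>_. borel) Z UNIV" and "I \<inter> J = {}"
    and X: "determined_by Z I X" and Y: "determined_by Z J Y"
    and [measurable]: "X \<in> borel_measurable M" "Y \<in> borel_measurable M"
  shows "indep_rv borel X borel Y"
proof -
  obtain f where f [measurable]: "f \<in> borel_measurable (\<Pi>\<^sub>M s\<in>I. borel)" "AE \<omega> in M. X \<omega> = f (\<lambda>s\<in>I. Z s \<omega>)"
    using X by (auto simp: determined_by_def)
  obtain g where g [measurable]: "g \<in> borel_measurable (\<Pi>\<^sub>M s\<in>J. borel)" "AE \<omega> in M. Y \<omega> = g (\<lambda>s\<in>J. Z s \<omega>)"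
    using Y by (auto simp: determined_by_def)
  let ?U = "\<lambda>\<omega>. \<lambda>s\<in>I. Z s \<omega>" and ?V = "\<lambda>\<omega>. \<lambda>s\<in>J. Z s \<omega>"
  let ?PI = "\<Pi>\<^sub>M s\<in>I. borel :: 'b measure" and ?PJ = "\<Pi>\<^sub>M s\<in>J. borel :: 'b measure"
  have "indep_var ?PI ?U ?PJ ?V" using indep_var_restrict[OF Z assms(2)] by simp
  then have U [measurable]: "?U \<in> M \<rightarrow>\<^sub>M ?PI" and V [measurable]: "?V \<in> M \<rightarrow>\<^sub>M ?PJ"
    and eq: "distr M ?PI ?U \<Otimes>\<^sub>M distr M ?PJ ?V = distr M (?PI \<Otimes>\<^sub>M ?PJ) (\<lambda>\<omega>. (?U \<omega>, ?V \<omega>))"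
    unfolding indep_var_distribution_eq by auto
  have fU [measurable]: "(\<lambda>\<omega>. f (?U \<omega>)) \<in> borel_measurable M" by (rule measurable_compose[OF U f(1)])
  have gV [measurable]: "(\<lambda>\<omega>. g (?V \<omega>)) \<in> borel_measurable M" by (rule measurable_compose[OF V g(1)])
  have "distr M borel X \<Otimes>\<^sub>M distr M borel Y = distr M borel (\<lambda>\<omega>. f (?U \<omega>)) \<Otimes>\<^sub>M distr M borel (\<lambda>\<omega>. g (?V \<omega>))"
    using f(2) g(2) by (intro arg_cong2[where f = pair_measure] distr_cong_AE) auto
  also have "\<dots> = distr (distr M ?PI ?U) borel f \<Otimes>\<^sub>M distr (distr M ?PJ ?V) borel g"
    by (simp add: distr_distr comp_def)
  also have "\<dots> = distr (distr M ?PI ?U \<Otimes>\<^sub>M distr M ?PJ ?V) (borel \<Otimes>\<^sub>M borel) (\<lambda>(u, v). (f u, g v))"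
  proof (rule pair_measure_distr)
    have "distr (distr M ?PJ ?V) borel g = distr M borel (\<lambda>\<omega>. g (?V \<omega>))" by (simp add: distr_distr comp_def)
    then show "sigma_finite_measure (distr (distr M ?PJ ?V) borel g)"
      by (simp add: prob_space_imp_sigma_finite prob_space_distr)
  qed auto
  also have "\<dots> = distr M (borel \<Otimes>\<^sub>M borel) (\<lambda>\<omega>. (f (?U \<omega>), g (?V \<omega>)))"
    unfolding eq by (subst distr_distr) (auto simp: comp_def)
  also have "\<dots> = distr M (borel \<Otimes>\<^sub>M borel) (\<lambda>\<omega>. (X \<omega>, Y \<omega>))"
  proof (rule distr_cong_AE)
    show "AE \<omega> in M. (f (?U \<omega>), g (?V \<omega>)) = (X \<omega>, Y \<omega>)" using f(2) g(2) by eventually_elim simp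
  qed auto
  finally show ?thesis by (simp add: indep_rv_def)
qed

lemma nn_integral_indep_mult:
  fixes f g :: "_ \<Rightarrow> ennreal"
  assumes ind: "indep_rv S X T Y" and [measurable]: "f \<in> borel_measurable S" "g \<in> borel_measurable T"
  shows "(\<integral>\<^sup>+\<omega>. f (X \<omega>) * g (Y \<omega>) \<partial>M) = (\<integral>\<^sup>+\<omega>. f (X \<omega>) \<partial>M) * (\<integral>\<^sup>+\<omega>. g (Y \<omega>) \<partial>M)"
proof -
  have [measurable]: "X \<in> M \<rightarrow>\<^sub>M S" "Y \<in> M \<rightarrow>\<^sub>M T" using ind by (auto simp: indep_rv_def)
  have "(\<integral>\<^sup>+\<omega>. f (X \<omega>) * g (Y \<omega>) \<partial>M) = (\<integral>\<^sup>+\<omega>. (\<integral>\<^sup>+\<omega>'. f (X \<omega>) * g (Y \<omega>') \<partial>M) \<partial>M)"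
    using indep_rv_nn_integral[OF ind, of "\<lambda>p. f (fst p) * g (snd p)"] by simp
  also have "\<dots> = (\<integral>\<^sup>+\<omega>. f (X \<omega>) * (\<integral>\<^sup>+\<omega>'. g (Y \<omega>') \<partial>M) \<partial>M)"
    by (intro nn_integral_cong nn_integral_cmult) simp
  also have "\<dots> = (\<integral>\<^sup>+\<omega>. f (X \<omega>) \<partial>M) * (\<integral>\<^sup>+\<omega>'. g (Y \<omega>') \<partial>M)"
    by (rule nn_integral_multc) simp
  finally show ?thesis .
qed

lemma indep_rv_integrable_mult:
  fixes f g :: "_ \<Rightarrow> real"
  assumes ind: "indep_rv S X T Y" and [measurable]: "f \<in> borel_measurable S" "g \<in> borel_measurable T"
    and nonneg: "\<And>x. f x \<ge> 0" "\<And>y. g y \<ge> 0"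
    and int: "integrable M (\<lambda>\<omega>. f (X \<omega>))" "integrable M (\<lambda>\<omega>. g (Y \<omega>))"
  shows "integrable M (\<lambda>\<omega>. f (X \<omega>) * g (Y \<omega>))"
proof -
  have [measurable]: "X \<in> M \<rightarrow>\<^sub>M S" "Y \<in> M \<rightarrow>\<^sub>M T" using ind by (auto simp: indep_rv_def)
  have "(\<integral>\<^sup>+\<omega>. ennreal (f (X \<omega>) * g (Y \<omega>)) \<partial>M) = (\<integral>\<^sup>+\<omega>. ennreal (f (X \<omega>)) \<partial>M) * (\<integral>\<^sup>+\<omega>. ennreal (g (Y \<omega>)) \<partial>M)"
    using nn_integral_indep_mult[OF ind, of "\<lambda>x. ennreal (f x)" "\<lambda>y. ennreal (g y)"] nonneg
    by (simp add: ennreal_mult)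
  also have "\<dots> < \<infinity>"
    using int nonneg by (simp add: nn_integral_eq_integral ennreal_mult_less_top)
  finally show ?thesis using nonneg by (intro integrableI_nonneg) auto
qed

lemma integrable_distr_transfer:
  fixes X Y :: "'a \<Rightarrow> 'b::topological_space" and f :: "'b \<Rightarrow> real"
  assumes "distr M borel X = distr M borel Y" and [measurable]: "X \<in> borel_measurable M" "Y \<in> borel_measurable M"
    "f \<in> borel_measurable borel" and int: "integrable M (\<lambda>\<omega>. f (Y \<omega>))"
  shows "integrable M (\<lambda>\<omega>. f (X \<omega>))"
proof -
  have "integrable (distr M borel Y) f" using int by (simp add: integrable_distr_eq)
  then show ?thesis unfolding assms(1)[symmetric] by (simp add: integrable_distr_eq)
qed

end

section \<open>Scalar recursions whose inhomogeneous term may depend on the past\<close>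

locale scalar_recursion = prob_space M for M :: "'a measure" +
  fixes Z :: "int \<Rightarrow> 'a \<Rightarrow> 'z::topological_space" and a Q X :: "int \<Rightarrow> 'a \<Rightarrow> real" and \<alpha> \<beta> :: real
  assumes Z_indep: "indep_vars (\<lambda>_. borel) Z UNIV"
    and a_det: "\<And>t. determined_by Z {t} (a t)" and Q_det: "\<And>t. determined_by Z {..t} (Q t)"
    and X_det: "\<And>t. determined_by Z {..t} (X t)"
    and a_meas [measurable]: "\<And>t. a t \<in> borel_measurable M" and Q_meas [measurable]: "\<And>t. Q t \<in> borel_measurable M"
    and X_meas [measurable]: "\<And>t. X t \<in> borel_measurable M"
    and a_pos: "\<And>t. AE \<omega> in M. a t \<omega> > 0" and Q_pos: "\<And>t. AE \<omega> in M. Q t \<omega> > 0"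
    and X_nonneg: "\<And>t. AE \<omega> in M. X t \<omega> \<ge> 0"
    and X_rec: "\<And>t. AE \<omega> in M. X t \<omega> = a t \<omega> * X (t - 1) \<omega> + Q t \<omega>"
    and X_distr: "\<And>t. distr M borel (X t) = distr M borel (X 0)"
    and a_distr: "\<And>t. distr M borel (a t) = distr M borel (a 0)"
    and a_nonarith: "non_arithmetic M (\<lambda>\<omega>. ln (a 0 \<omega>))"
    and a_int: "integrable M (\<lambda>\<omega>. a 0 \<omega> powr \<alpha>)" and a_one: "(\<integral>\<omega>. a 0 \<omega> powr \<alpha> \<partial>M) = 1"
    and a_ln_int: "integrable M (\<lambda>\<omega>. a 0 \<omega> powr \<alpha> * max (ln (a 0 \<omega>)) 0)"
    and Q_int: "\<And>t. integrable M (\<lambda>\<omega>. Q t \<omega> powr \<alpha>)"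
    and \<beta>: "0 < \<beta>" "\<beta> < \<alpha>" and X_int: "integrable M (\<lambda>\<omega>. X (-1) \<omega> powr \<beta>)"
    and increment_int: "integrable M (\<lambda>\<omega>. (a 0 \<omega> * X (-1) \<omega> + Q 0 \<omega>) powr \<alpha> - (a 0 \<omega> * X (-1) \<omega>) powr \<alpha>)"
begin

lemma \<alpha>_pos: "\<alpha> > 0"
  using \<beta> by simp

text \<open>The step from time -1 to time 0 gives the fixed point equation in law; its factor
  \<open>a 0\<close> is independent of everything up to time -1.\<close>

lemma tail: "\<exists>c>0. ((\<lambda>x. x powr \<alpha> * prob {\<omega>\<in>space M. X 0 \<omega> > x}) \<longlongrightarrow> c) at_top"
proof -
  have "distr M borel (\<lambda>\<omega>. a 0 \<omega> * X (-1) \<omega> + Q 0 \<omega>) = distr M borel (X (-1))"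
  proof -
    have "distr M borel (\<lambda>\<omega>. a 0 \<omega> * X (-1) \<omega> + Q 0 \<omega>) = distr M borel (X 0)"
      using X_rec[of 0] by (intro distr_cong_AE) auto
    then show ?thesis using X_distr[of "-1"] by simp
  qed
  moreover have "indep_rv borel (a 0) borel (X (-1))"
    by (rule determined_by_indep[OF Z_indep _ a_det X_det]) auto
  ultimately have "\<exists>c>0. ((\<lambda>x. x powr \<alpha> * prob {\<omega>\<in>space M. X (-1) \<omega> > x}) \<longlongrightarrow> c) at_top"
    by (intro implicit_renewal_tail[where A = "a 0" and D = "Q 0" and \<beta> = \<beta>] a_pos Q_pos X_nonneg a_nonarith
        a_int a_one a_ln_int \<beta> X_int increment_int) auto
  moreover have "prob {\<omega>\<in>space M. X t \<omega> > x} = measure (distr M borel (X t)) {x<..}" for t x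
    by (subst measure_distr) (auto intro!: arg_cong[where f = prob])
  ultimately show ?thesis using X_distr[of "-1"] by simp
qed

text \<open>The path started from 0 at time 0. It may depend on \<open>X 0\<close>, since
  \<open>Q\<close> sees the whole past; what counts is its moment of order \<alpha>.\<close>

primrec remainder :: "nat \<Rightarrow> 'a \<Rightarrow> real" where
  "remainder 0 \<omega> = 0"
| "remainder (Suc k) \<omega> = a (int (Suc k)) \<omega> * remainder k \<omega> + Q (int (Suc k)) \<omega>"

definition factor :: "nat \<Rightarrow> 'a \<Rightarrow> real" where
  "factor k \<omega> = (\<Prod>j=1..k. a (int j) \<omega>)"

lemma factor_Suc: "factor (Suc k) \<omega> = a (int (Suc k)) \<omega> * factor k \<omega>"
  by (simp add: factor_def mult.commute)

lemma remainder_meas [measurable]: "remainder k \<in> borel_measurable M"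
proof (induction k)
  case (Suc k)
  have "(\<lambda>\<omega>. a (int (Suc k)) \<omega> * remainder k \<omega> + Q (int (Suc k)) \<omega>) \<in> borel_measurable M"
    using Suc by measurable
  then show ?case by (simp only: remainder.simps[abs_def])
qed (simp only: remainder.simps[abs_def], simp)

lemma factor_meas [measurable]: "factor k \<in> borel_measurable M"
  unfolding factor_def[abs_def] by measurable

lemma unroll: "AE \<omega> in M. X (int k) \<omega> = X 0 \<omega> * factor k \<omega> + remainder k \<omega>"
proof (induction k)
  case 0
  then show ?case by (simp add: factor_def)
next
  case (Suc k)
  have "AE \<omega> in M. X (int (Suc k)) \<omega> = a (int (Suc k)) \<omega> * X (int k) \<omega> + Q (int (Suc k)) \<omega>"
    using X_rec[of "int (Suc k)"] by simp
  with Suc show ?case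
    by eventually_elim (simp only: factor_Suc remainder.simps distrib_left mult_ac add_ac)
qed

lemma all_pos: "AE \<omega> in M. \<forall>t. a t \<omega> > 0 \<and> Q t \<omega> > 0"
  using a_pos Q_pos by (simp add: AE_all_countable AE_conj_iff)

lemma remainder_nonneg:
  assumes "\<And>t. a t \<omega> > 0 \<and> Q t \<omega> > 0"
  shows "remainder k \<omega> \<ge> 0"
proof (induction k)
  case (Suc k)
  have "a (int (Suc k)) \<omega> \<ge> 0" "Q (int (Suc k)) \<omega> \<ge> 0" using assms by (simp_all add: less_imp_le)
  then show ?case using Suc by (simp only: remainder.simps add_nonneg_nonneg mult_nonneg_nonneg)
qed simp

lemma factor_pos: "(\<And>t. a t \<omega> > 0) \<Longrightarrow> factor k \<omega> > 0"
  unfolding factor_def by (intro prod_pos) auto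

lemma remainder_det: "determined_by Z {..int k} (remainder k)"
proof (induction k)
  case 0
  then show ?case using determined_by_const[of Z "{..0}" 0] by (simp add: remainder.simps(1)[abs_def])
next
  case (Suc k)
  have "determined_by Z {..int (Suc k)} (\<lambda>\<omega>. a (int (Suc k)) \<omega> * remainder k \<omega> + Q (int (Suc k)) \<omega>)"
    by (intro determined_by_add_mult Q_det determined_by_mono[OF a_det] determined_by_mono[OF Suc]) auto
  then show ?case by (simp only: remainder.simps[abs_def])
qed

text \<open>Only times from 1 on are involved, which makes the products independent of
  \<open>X 0\<close>.\<close>

lemma factor_det: "determined_by Z {1..} (factor k)"
proof (induction k)
  case 0
  then show ?case using determined_by_const[of Z "{1..}" 1] by (simp add: factor_def[abs_def])
next
  case (Suc k)
  have "determined_by Z {1..} (\<lambda>\<omega>. a (int (Suc k)) \<omega> * factor k \<omega>)"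
    by (intro determined_by_add_mult Suc determined_by_mono[OF a_det]) auto
  then show ?case by (simp only: factor_Suc[abs_def])
qed

text \<open>The same products viewed as belonging to the past of time \<open>k + 1\<close>, hence
  independent of the next factor in the induction on moments.\<close>

lemma factor_det_atMost: "determined_by Z {..int k} (factor k)"
proof (induction k)
  case 0
  then show ?case using determined_by_const[of Z "{..0}" 1] by (simp add: factor_def[abs_def])
next
  case (Suc k)
  have "determined_by Z {..int (Suc k)} (\<lambda>\<omega>. a (int (Suc k)) \<omega> * factor k \<omega>)"
    by (intro determined_by_add_mult determined_by_mono[OF a_det] determined_by_mono[OF Suc]) auto
  then show ?case by (simp only: factor_Suc[abs_def])
qed

lemma a_powr_int: "integrable M (\<lambda>\<omega>. a t \<omega> powr \<alpha>)"
  by (rule integrable_distr_transfer[OF a_distr _ _ _ a_int]) auto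

lemma product_powr_int:
  assumes [measurable]: "Y \<in> borel_measurable M" and Y: "determined_by Z {..int k} Y"
    and int: "integrable M (\<lambda>\<omega>. Y \<omega> powr \<alpha>)" and nonneg: "AE \<omega> in M. Y \<omega> \<ge> 0"
  shows "integrable M (\<lambda>\<omega>. (a (int (Suc k)) \<omega> * Y \<omega>) powr \<alpha>)"
proof -
  have "indep_rv borel (a (int (Suc k))) borel Y"
    by (rule determined_by_indep[OF Z_indep _ a_det Y]) auto
  then have "integrable M (\<lambda>\<omega>. a (int (Suc k)) \<omega> powr \<alpha> * Y \<omega> powr \<alpha>)"
    by (rule indep_rv_integrable_mult[where f = "\<lambda>x. x powr \<alpha>" and g = "\<lambda>x. x powr \<alpha>"])
       (use a_powr_int int in auto)
  moreover have "AE \<omega> in M. a (int (Suc k)) \<omega> powr \<alpha> * Y \<omega> powr \<alpha> = (a (int (Suc k)) \<omega> * Y \<omega>) powr \<alpha>"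
    using a_pos[of "int (Suc k)"] nonneg by eventually_elim (simp add: powr_mult)
  ultimately show ?thesis
    by (subst integrable_cong_AE[where g = "\<lambda>\<omega>. a (int (Suc k)) \<omega> powr \<alpha> * Y \<omega> powr \<alpha>"]) auto
qed

lemma remainder_int: "integrable M (\<lambda>\<omega>. remainder k \<omega> powr \<alpha>)"
proof (induction k)
  case (Suc k)
  let ?Y = "\<lambda>\<omega>. a (int (Suc k)) \<omega> * remainder k \<omega>" and ?Q = "Q (int (Suc k))"
  have nonneg: "AE \<omega> in M. remainder k \<omega> \<ge> 0"
    using all_pos by eventually_elim (auto intro: remainder_nonneg)
  have "integrable M (\<lambda>\<omega>. ?Y \<omega> powr \<alpha>)"
    by (rule product_powr_int[OF _ remainder_det Suc nonneg]) simp
  then have "integrable M (\<lambda>\<omega>. 2 powr \<alpha> * (?Y \<omega> powr \<alpha> + ?Q \<omega> powr \<alpha>))"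
    using Q_int by (intro integrable_mult_right Bochner_Integration.integrable_add)
  then have "integrable M (\<lambda>\<omega>. (?Y \<omega> + ?Q \<omega>) powr \<alpha>)"
  proof (rule Bochner_Integration.integrable_bound)
    show "AE \<omega> in M. norm ((?Y \<omega> + ?Q \<omega>) powr \<alpha>) \<le> norm (2 powr \<alpha> * (?Y \<omega> powr \<alpha> + ?Q \<omega> powr \<alpha>))"
      using all_pos
    proof eventually_elim
      case (elim \<omega>)
      have "remainder k \<omega> \<ge> 0" by (rule remainder_nonneg) (use elim in auto)
      then have "?Y \<omega> \<ge> 0" "?Q \<omega> \<ge> 0" using elim by (simp_all add: less_imp_le)
      then show ?case using powr_add_le[of "?Y \<omega>" "?Q \<omega>" \<alpha>] \<alpha>_pos by simp
    qed
  qed measurable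
  then show ?case by (simp only: remainder.simps)
qed simp

lemma factor_int: "integrable M (\<lambda>\<omega>. factor k \<omega> powr \<alpha>)"
proof (induction k)
  case (Suc k)
  have "AE \<omega> in M. factor k \<omega> \<ge> 0"
    using all_pos by eventually_elim (auto intro!: less_imp_le factor_pos)
  then show ?case
    unfolding factor_Suc by (rule product_powr_int[OF _ factor_det_atMost Suc, rotated]) simp
qed (simp add: factor_def)

lemma vec_norm_powr_int:
  fixes Y :: "nat \<Rightarrow> 'a \<Rightarrow> real"
  assumes [measurable]: "\<And>k. Y k \<in> borel_measurable M" and nonneg: "\<And>k. AE \<omega> in M. Y k \<omega> \<ge> 0"
    and int: "\<And>k. integrable M (\<lambda>\<omega>. Y k \<omega> powr \<alpha>)"
  shows "integrable M (\<lambda>\<omega>. vec_norm h (tuple h (\<lambda>k. Y k \<omega>)) powr \<alpha>)"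
proof -
  have sum_int: "integrable M (\<lambda>\<omega>. (\<Sum>i<n. Y (Suc i) \<omega>) powr \<alpha>)" for n
  proof (induction n)
    case (Suc n)
    have "integrable M (\<lambda>\<omega>. 2 powr \<alpha> * ((\<Sum>i<n. Y (Suc i) \<omega>) powr \<alpha> + Y (Suc n) \<omega> powr \<alpha>))"
      using Suc int by (intro integrable_mult_right Bochner_Integration.integrable_add)
    then show ?case
    proof (rule Bochner_Integration.integrable_bound)
      have "AE \<omega> in M. \<forall>k. Y k \<omega> \<ge> 0" using nonneg by (simp add: AE_all_countable)
      then show "AE \<omega> in M. norm ((\<Sum>i<Suc n. Y (Suc i) \<omega>) powr \<alpha>) \<le>
          norm (2 powr \<alpha> * ((\<Sum>i<n. Y (Suc i) \<omega>) powr \<alpha> + Y (Suc n) \<omega> powr \<alpha>))"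
      proof eventually_elim
        case (elim \<omega>)
        then have "(\<Sum>i<n. Y (Suc i) \<omega>) \<ge> 0" by (intro sum_nonneg) auto
        then show ?case using powr_add_le[of "\<Sum>i<n. Y (Suc i) \<omega>" "Y (Suc n) \<omega>" \<alpha>] elim \<alpha>_pos by simp
      qed
    qed measurable
  qed simp
  have meas: "(\<lambda>\<omega>. tuple h (\<lambda>k. Y k \<omega>)) \<in> borel_measurable M"
    by (rule measurable_coordinatewise_then_product) (simp add: tuple_def)
  show ?thesis
  proof (rule Bochner_Integration.integrable_bound[OF sum_int[of h]])
    show "(\<lambda>\<omega>. vec_norm h (tuple h (\<lambda>k. Y k \<omega>)) powr \<alpha>) \<in> borel_measurable M"
      using meas by measurable
    have "AE \<omega> in M. \<forall>k. Y k \<omega> \<ge> 0" using nonneg by (simp add: AE_all_countable)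
    then show "AE \<omega> in M. norm (vec_norm h (tuple h (\<lambda>k. Y k \<omega>)) powr \<alpha>) \<le> norm ((\<Sum>i<h. Y (Suc i) \<omega>) powr \<alpha>)"
    proof eventually_elim
      case (elim \<omega>)
      have "vec_norm h (tuple h (\<lambda>k. Y k \<omega>)) \<le> (\<Sum>i<h. \<bar>tuple h (\<lambda>k. Y k \<omega>) i\<bar>)" by (rule vec_norm_le_sum)
      also have "\<dots> = (\<Sum>i<h. Y (Suc i) \<omega>)" using elim by (intro sum.cong) (auto simp: tuple_def)
      finally show ?case using \<alpha>_pos by (auto intro!: powr_mono2)
    qed
  qed
qed

theorem spectral_measure:
  assumes h: "h \<ge> 1"
  shows "\<exists>S. is_tilted_direction_law M h (forward_products a h) \<alpha> S \<and>
    has_spectral_measure M h (\<lambda>\<omega>. tuple h (\<lambda>k. X (int k) \<omega>)) \<alpha> S"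
proof -
  obtain c where c: "c > 0" "((\<lambda>x. x powr \<alpha> * prob {\<omega>\<in>space M. X 0 \<omega> > x}) \<longlongrightarrow> c) at_top"
    using tail by blast
  have fp: "forward_products a h = (\<lambda>\<omega>. tuple h (\<lambda>k. factor k \<omega>))"
    by (simp add: forward_products_def fun_eq_iff factor_def)
  have tuple_meas: "(\<lambda>\<omega>. tuple h (\<lambda>k. Y k \<omega>)) \<in> borel_measurable M"
    if "\<And>k. Y k \<in> borel_measurable M" for Y :: "nat \<Rightarrow> 'a \<Rightarrow> real"
    using that by (intro measurable_coordinatewise_then_product) (simp add: tuple_def)
  have Eucl: "tuple h f \<in> topspace (Euclidean_space h)" for f
    by (simp add: tuple_def topspace_Euclidean_space)
  have fp_meas: "forward_products a h \<in> borel_measurable M" unfolding fp by (rule tuple_meas) simp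
  have fp_det: "determined_by Z {1..} (forward_products a h)"
  proof (rule determined_by_sequence)
    fix i
    show "determined_by Z {1..} (\<lambda>\<omega>. forward_products a h \<omega> i)"
      unfolding fp tuple_def by (cases "i < h") (auto intro: factor_det determined_by_const)
  qed
  have fp_int: "integrable M (\<lambda>\<omega>. vec_norm h (forward_products a h \<omega>) powr \<alpha>)"
    unfolding fp
  proof (rule vec_norm_powr_int)
    show "AE \<omega> in M. factor k \<omega> \<ge> 0" for k
      using all_pos by eventually_elim (auto intro!: less_imp_le factor_pos)
  qed (auto intro: factor_int)
  have fp_pos: "(\<integral>\<omega>. vec_norm h (forward_products a h \<omega>) powr \<alpha> \<partial>M) > 0"
  proof -
    have pos: "AE \<omega> in M. vec_norm h (forward_products a h \<omega>) > 0"
      using all_pos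
    proof eventually_elim
      case (elim \<omega>)
      have "0 < factor 1 \<omega>" using elim by (intro factor_pos) auto
      also have "\<dots> \<le> \<bar>forward_products a h \<omega> 0\<bar>" using h unfolding fp by (simp add: tuple_def)
      also have "\<dots> \<le> vec_norm h (forward_products a h \<omega>)" using h by (intro abs_le_vec_norm) auto
      finally show ?case .
    qed
    have "(\<integral>\<omega>. vec_norm h (forward_products a h \<omega>) powr \<alpha> \<partial>M) \<noteq> 0"
    proof
      assume "(\<integral>\<omega>. vec_norm h (forward_products a h \<omega>) powr \<alpha> \<partial>M) = 0"
      then have "AE \<omega> in M. vec_norm h (forward_products a h \<omega>) powr \<alpha> = 0"
        using integral_nonneg_eq_0_iff_AE[OF fp_int] by simp
      with pos have "AE \<omega> in M. False" by eventually_elim simp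
      then show False by simp
    qed
    moreover have "(\<integral>\<omega>. vec_norm h (forward_products a h \<omega>) powr \<alpha> \<partial>M) \<ge> 0"
      by (rule Bochner_Integration.integral_nonneg) simp
    ultimately show ?thesis by linarith
  qed
  have V_eq: "AE \<omega> in M. tuple h (\<lambda>k. X (int k) \<omega>) = (\<lambda>i. X 0 \<omega> * forward_products a h \<omega> i + tuple h (\<lambda>k. remainder k \<omega>) i)"
  proof -
    have "AE \<omega> in M. \<forall>k. X (int k) \<omega> = X 0 \<omega> * factor k \<omega> + remainder k \<omega>"
      using unroll by (simp add: AE_all_countable)
    then show ?thesis by eventually_elim (auto simp: fp tuple_def fun_eq_iff simp del: of_nat_Suc)
  qed
  show ?thesis
  proof (rule spectral_measure_product_perturbation[where X = "X 0" and R = "\<lambda>\<omega>. tuple h (\<lambda>k. remainder k \<omega>)" and c = c])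
    show "indep_rv borel (forward_products a h) borel (X 0)"
      by (rule determined_by_indep[OF Z_indep _ fp_det X_det]) (auto simp: fp_meas)
    show "(\<lambda>\<omega>. tuple h (\<lambda>k. remainder k \<omega>)) \<in> borel_measurable M" by (rule tuple_meas) simp
    show "random_vector M h (\<lambda>\<omega>. tuple h (\<lambda>k. X (int k) \<omega>))"
      unfolding random_vector_def using tuple_meas[of "\<lambda>k. X (int k)"] Eucl by simp
    show "forward_products a h \<omega> \<in> topspace (Euclidean_space h)" for \<omega> unfolding fp by (rule Eucl)
    show "integrable M (\<lambda>\<omega>. vec_norm h (tuple h (\<lambda>k. remainder k \<omega>)) powr \<alpha>)"
    proof (rule vec_norm_powr_int)
      show "AE \<omega> in M. remainder k \<omega> \<ge> 0" for k
        using all_pos by eventually_elim (auto intro: remainder_nonneg)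
    qed (auto intro: remainder_int)
  qed (use h \<alpha>_pos c X_nonneg V_eq fp_int fp_pos in auto)
qed

end

section \<open>Elementary inequalities for powers\<close>

text \<open>The weight of the first power is as close to 1 as desired, so a contraction factor below
  1 survives; the factor \<open>2 powr p\<close> of \<open>powr_add_le\<close> could destroy it.
  Either y \<le> \<eta> x, or x is below a fixed multiple of y.\<close>

lemma powr_add_le_weighted:
  fixes p \<delta> :: real
  assumes "p > 0" "\<delta> > 0"
  obtains K where "K \<ge> 0" "\<And>x y. x \<ge> 0 \<Longrightarrow> y \<ge> 0 \<Longrightarrow> (x + y) powr p \<le> (1 + \<delta>) * x powr p + K * y powr p"
proof -
  define \<eta> where "\<eta> = (1 + \<delta>) powr (1 / p) - 1"
  have \<eta>: "\<eta> > 0" using assms by (simp add: \<eta>_def gr_one_powr)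
  have \<eta>_eq: "(1 + \<eta>) powr p = 1 + \<delta>" using assms by (simp add: \<eta>_def powr_powr)
  define K where "K = (1 + 1 / \<eta>) powr p"
  show thesis
  proof (rule that[of K])
    show "K \<ge> 0" by (simp add: K_def)
    fix x y :: real assume xy: "x \<ge> 0" "y \<ge> 0"
    show "(x + y) powr p \<le> (1 + \<delta>) * x powr p + K * y powr p"
    proof (cases "y \<le> \<eta> * x")
      case True
      then have "(x + y) powr p \<le> ((1 + \<eta>) * x) powr p"
        using xy assms by (intro powr_mono2) (auto simp: distrib_right)
      also have "\<dots> = (1 + \<delta>) * x powr p" using xy \<eta> by (simp add: powr_mult \<eta>_eq)
      finally show ?thesis using \<open>K \<ge> 0\<close> by (simp add: add_increasing2)
    next
      case False
      then have "x \<le> 1 / \<eta> * y" using \<eta> by (simp add: field_simps)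
      then have "(x + y) powr p \<le> ((1 + 1 / \<eta>) * y) powr p"
        using xy assms by (intro powr_mono2) (auto simp: distrib_right)
      also have "\<dots> = K * y powr p" using xy \<eta> by (simp add: powr_mult K_def)
      finally show ?thesis using assms xy by (simp add: add_increasing)
    qed
  qed
qed

text \<open>The fractions x / (x + y) and y / (x + y) are at most 1, hence at most their own powers
  of order p \<le> 1.\<close>

lemma powr_add_subadditive:
  fixes x y p :: real
  assumes "x \<ge> 0" "y \<ge> 0" "0 < p" "p \<le> 1"
  shows "(x + y) powr p \<le> x powr p + y powr p"
proof (cases "x + y = 0")
  case False
  then have s: "x + y > 0" using assms by simp
  have le: "z / (x + y) \<le> (z / (x + y)) powr p" if "0 \<le> z" "z \<le> x + y" for z
  proof -
    have "(z / (x + y)) powr 1 \<le> (z / (x + y)) powr p"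
      using that s assms by (intro powr_mono') auto
    then show ?thesis using that s by simp
  qed
  have "1 = x / (x + y) + y / (x + y)" using s by (simp add: add_divide_distrib[symmetric])
  also have "\<dots> \<le> (x / (x + y)) powr p + (y / (x + y)) powr p"
    using assms by (intro add_mono le) auto
  finally have "(x + y) powr p * 1 \<le> (x + y) powr p * ((x / (x + y)) powr p + (y / (x + y)) powr p)"
    by (rule mult_left_mono) simp
  also have "\<dots> = x powr p + y powr p"
    using assms s by (simp add: powr_divide distrib_left)
  finally show ?thesis by simp
qed (use assms in simp)

text \<open>The mean value theorem. The point is that \<open>x\<close> appears on the right only to
  the power p - 1, so its moment of order p is not involved.\<close>

lemma powr_increment_le:
  fixes x y p :: real
  assumes "x \<ge> 0" "y \<ge> 0" "p > 1"
  shows "(x + y) powr p - x powr p \<le> p * 2 powr (p - 1) * (y * x powr (p - 1) + y powr p)"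
proof -
  have "(x + y) powr p - x powr p \<le> p * (y * (x + y) powr (p - 1))"
  proof (cases "x = 0 \<or> y = 0")
    case True
    moreover have "y powr p = y * y powr (p - 1)" using assms powr_mult_base[of y "p - 1"] by simp
    moreover have "1 * (y * y powr (p - 1)) \<le> p * (y * y powr (p - 1))"
      using assms by (intro mult_right_mono) auto
    ultimately show ?thesis using assms by auto
  next
    case False
    then have pos: "x > 0" "y > 0" using assms by auto
    have "\<exists>z. x < z \<and> z < x + y \<and> (x + y) powr p - x powr p = (x + y - x) * (p * z powr (p - 1))"
      using pos by (intro MVT2) (auto intro!: has_real_derivative_powr)
    then obtain z where z: "x < z" "z < x + y" "(x + y) powr p - x powr p = y * (p * z powr (p - 1))" by auto
    have "z powr (p - 1) \<le> (x + y) powr (p - 1)" using z pos assms by (intro powr_mono2) auto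
    then have "y * (p * z powr (p - 1)) \<le> y * (p * (x + y) powr (p - 1))"
      using pos assms by (intro mult_left_mono) auto
    then show ?thesis using z(3) by (simp add: mult_ac)
  qed
  also have "\<dots> \<le> p * (y * (2 powr (p - 1) * (x powr (p - 1) + y powr (p - 1))))"
    using assms by (intro mult_left_mono powr_add_le) auto
  also have "\<dots> = p * 2 powr (p - 1) * (y * x powr (p - 1) + y * y powr (p - 1))"
    by (simp add: algebra_simps)
  also have "y * y powr (p - 1) = y powr p"
    using assms powr_mult_base[of y "p - 1"] by simp
  finally show ?thesis .
qed

text \<open>Young's inequality with crude constants: according to whether z \<le> x^(p - 1), one of
  the two powers alone dominates the product.\<close>

lemma Young_powr:
  fixes x z p :: real
  assumes "x \<ge> 0" "z \<ge> 0" "p > 1"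
  shows "x * z \<le> x powr p + z powr (p / (p - 1))"
proof (cases "z \<le> x powr (p - 1)")
  case True
  then have "x * z \<le> x * x powr (p - 1)" using assms by (intro mult_left_mono) auto
  also have "\<dots> = x powr p" using assms powr_mult_base[of x "p - 1"] by simp
  finally show ?thesis by (simp add: add_increasing2)
next
  case False
  have "x = (x powr (p - 1)) powr (1 / (p - 1))" using assms by (simp add: powr_powr)
  also have "\<dots> \<le> z powr (1 / (p - 1))" using False assms by (intro powr_mono2) auto
  finally have "x * z \<le> z powr (1 / (p - 1)) * z" using assms by (intro mult_right_mono) auto
  also have "\<dots> = z powr (1 / (p - 1) + 1)" using assms powr_mult_base[of z "1 / (p - 1)"] by (simp add: mult.commute add.commute)
  also have "1 / (p - 1) + 1 = p / (p - 1)" using assms by (simp add: field_simps)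
  finally show ?thesis by (simp add: add_increasing)
qed

section \<open>Moments, tightness and uniqueness for recursions\<close>

context prob_space
begin

lemma integrable_powr_le:
  fixes Y :: "'a \<Rightarrow> real"
  assumes [measurable]: "Y \<in> borel_measurable M" and "integrable M (\<lambda>\<omega>. Y \<omega> powr q)" "AE \<omega> in M. Y \<omega> \<ge> 0" "0 < p" "p \<le> q"
  shows "integrable M (\<lambda>\<omega>. Y \<omega> powr p)"
proof (rule Bochner_Integration.integrable_bound)
  show "integrable M (\<lambda>\<omega>. 1 + Y \<omega> powr q)" using assms by auto
  show "AE \<omega> in M. norm (Y \<omega> powr p) \<le> norm (1 + Y \<omega> powr q)"
    using assms(3)
  proof eventually_elim
    case (elim \<omega>)
    show ?case
    proof (cases "Y \<omega> \<le> 1")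
      case True
      have "Y \<omega> powr p \<le> 1 powr p" using True elim assms by (intro powr_mono2) auto
      then show ?thesis by (simp add: add_increasing2)
    next
      case False
      have "Y \<omega> powr p \<le> Y \<omega> powr q" using False assms by (intro powr_mono) auto
      then show ?thesis by simp
    qed
  qed
qed measurable

text \<open>Independence factors the moment of the product, so the moments m of order p satisfy m'
  \<le> (1 + \<delta>) \<theta> m + K C, starting from 0. The term \<open>q\<close> may vary with
  \<open>N\<close> because in the first component it contains a partial sum of the second.\<close>

lemma recursion_moment_bound:
  fixes a :: "int \<Rightarrow> 'a \<Rightarrow> real" and q Y :: "nat \<Rightarrow> int \<Rightarrow> 'a \<Rightarrow> real"
  assumes indep: "\<And>N t. indep_rv borel (a t) borel (Y N (t - 1))"
    and q_meas [measurable]: "\<And>N t. q N t \<in> borel_measurable M"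
    and a_nonneg: "\<And>t. AE \<omega> in M. a t \<omega> \<ge> 0" and q_nonneg: "\<And>N t. AE \<omega> in M. q N t \<omega> \<ge> 0"
    and Y_nonneg: "\<And>N t. AE \<omega> in M. Y N t \<omega> \<ge> 0"
    and Y_0: "\<And>t \<omega>. Y 0 t \<omega> = 0" and Y_Suc: "\<And>N t \<omega>. Y (Suc N) t \<omega> = a t \<omega> * Y N (t - 1) \<omega> + q N t \<omega>"
    and p: "p > 0" and a_moment: "\<And>t. (\<integral>\<^sup>+\<omega>. ennreal (a t \<omega> powr p) \<partial>M) \<le> ennreal \<theta>" and \<theta>: "0 \<le> \<theta>" "\<theta> < 1"
    and q_moment: "\<And>N t. (\<integral>\<^sup>+\<omega>. ennreal (q N t \<omega> powr p) \<partial>M) \<le> ennreal C" and C: "C \<ge> 0"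
  obtains D where "D \<ge> 0" "\<And>N t. (\<integral>\<^sup>+\<omega>. ennreal (Y N t \<omega> powr p) \<partial>M) \<le> ennreal D"
proof -
  \<comment> \<open>Gives 1 - (1 + \<delta>) \<theta> = (1 - \<theta>) (1 - \<theta> / 2), which is
    positive.\<close>
  define \<delta> where "\<delta> = (1 - \<theta>) / 2"
  have \<delta>: "\<delta> > 0" using \<theta> by (simp add: \<delta>_def)
  define \<theta>' where "\<theta>' = (1 + \<delta>) * \<theta>"
  have \<theta>': "0 \<le> \<theta>'" "\<theta>' < 1"
  proof -
    show "0 \<le> \<theta>'" using \<theta> \<delta> by (simp add: \<theta>'_def)
    have "0 < (1 - \<theta>) * (1 - \<theta> / 2)" using \<theta> by (intro mult_pos_pos) auto
    then show "\<theta>' < 1" by (simp add: \<theta>'_def \<delta>_def field_simps)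
  qed
  obtain K where K: "K \<ge> 0" "\<And>x y. x \<ge> 0 \<Longrightarrow> y \<ge> 0 \<Longrightarrow> (x + y) powr p \<le> (1 + \<delta>) * x powr p + K * y powr p"
    using powr_add_le_weighted[OF p \<delta>] by blast
  \<comment> \<open>The fixed point of the affine bound: D = \<theta>' D + K C.\<close>
  define D where "D = K * C / (1 - \<theta>')"
  have D: "D \<ge> 0" using K C \<theta>' by (simp add: D_def)
  have [measurable]: "a t \<in> borel_measurable M" "Y N t \<in> borel_measurable M" for N t
    using indep[of t N] indep[of "t + 1" N] by (auto simp: indep_rv_def)
  have "(\<integral>\<^sup>+\<omega>. ennreal (Y N t \<omega> powr p) \<partial>M) \<le> ennreal D" for N t
  proof (induction N arbitrary: t)
    case 0
    then show ?case by (simp add: Y_0)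
  next
    case (Suc N)
    have "(\<integral>\<^sup>+\<omega>. ennreal (Y (Suc N) t \<omega> powr p) \<partial>M) \<le>
        (\<integral>\<^sup>+\<omega>. ennreal (1 + \<delta>) * (ennreal (a t \<omega> powr p) * ennreal (Y N (t - 1) \<omega> powr p)) + ennreal K * ennreal (q N t \<omega> powr p) \<partial>M)"
    proof (rule nn_integral_mono_AE)
      show "AE \<omega> in M. ennreal (Y (Suc N) t \<omega> powr p) \<le>
          ennreal (1 + \<delta>) * (ennreal (a t \<omega> powr p) * ennreal (Y N (t - 1) \<omega> powr p)) + ennreal K * ennreal (q N t \<omega> powr p)"
        using a_nonneg[of t] q_nonneg[of N t] Y_nonneg[of N "t - 1"]
      proof eventually_elim
        case (elim \<omega>)
        have "Y (Suc N) t \<omega> powr p \<le> (1 + \<delta>) * (a t \<omega> * Y N (t - 1) \<omega>) powr p + K * q N t \<omega> powr p"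
          unfolding Y_Suc using elim by (intro K(2)) auto
        also have "(a t \<omega> * Y N (t - 1) \<omega>) powr p = a t \<omega> powr p * Y N (t - 1) \<omega> powr p"
          using elim by (simp add: powr_mult)
        finally have "ennreal (Y (Suc N) t \<omega> powr p) \<le>
            ennreal ((1 + \<delta>) * (a t \<omega> powr p * Y N (t - 1) \<omega> powr p) + K * q N t \<omega> powr p)"
          by (rule ennreal_leI)
        then show ?case using \<delta> K(1) by (simp add: ennreal_mult ennreal_plus)
      qed
    qed
    also have "\<dots> = ennreal (1 + \<delta>) * (\<integral>\<^sup>+\<omega>. ennreal (a t \<omega> powr p) * ennreal (Y N (t - 1) \<omega> powr p) \<partial>M) +
        ennreal K * (\<integral>\<^sup>+\<omega>. ennreal (q N t \<omega> powr p) \<partial>M)"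
      by (simp add: nn_integral_add nn_integral_cmult)
    also have "(\<integral>\<^sup>+\<omega>. ennreal (a t \<omega> powr p) * ennreal (Y N (t - 1) \<omega> powr p) \<partial>M) =
        (\<integral>\<^sup>+\<omega>. ennreal (a t \<omega> powr p) \<partial>M) * (\<integral>\<^sup>+\<omega>. ennreal (Y N (t - 1) \<omega> powr p) \<partial>M)"
      by (rule nn_integral_indep_mult[OF indep, of "\<lambda>x. ennreal (x powr p)" "\<lambda>x. ennreal (x powr p)"]) auto
    also have "ennreal (1 + \<delta>) * ((\<integral>\<^sup>+\<omega>. ennreal (a t \<omega> powr p) \<partial>M) * (\<integral>\<^sup>+\<omega>. ennreal (Y N (t - 1) \<omega> powr p) \<partial>M)) +
        ennreal K * (\<integral>\<^sup>+\<omega>. ennreal (q N t \<omega> powr p) \<partial>M) \<le> ennreal (1 + \<delta>) * (ennreal \<theta> * ennreal D) + ennreal K * ennreal C"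
      by (intro add_mono mult_mono a_moment Suc q_moment) auto
    also have "\<dots> = ennreal ((1 + \<delta>) * (\<theta> * D) + K * C)"
      using \<delta> \<theta> D K C by (simp add: ennreal_mult ennreal_plus)
    also have "(1 + \<delta>) * (\<theta> * D) + K * C = D"
    proof -
      have "D * (1 - \<theta>') = K * C" using \<theta>' by (simp add: D_def)
      then show ?thesis by (simp add: \<theta>'_def algebra_simps)
    qed
    finally show ?case .
  qed
  then show thesis using D that by blast
qed

text \<open>The supremum of the powers has a finite integral by monotone convergence, hence is
  finite almost surely, and bounded increasing sequences converge. Convergence and the moment bound
  come together.\<close>

lemma monotone_moment_limit:
  fixes Y :: "nat \<Rightarrow> 'a \<Rightarrow> real"
  assumes [measurable]: "\<And>N. Y N \<in> borel_measurable M" and mono: "AE \<omega> in M. \<forall>N. 0 \<le> Y N \<omega> \<and> Y N \<omega> \<le> Y (Suc N) \<omega>"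
    and p: "p > 0" and bound: "\<And>N. (\<integral>\<^sup>+\<omega>. ennreal (Y N \<omega> powr p) \<partial>M) \<le> ennreal D"
  shows "AE \<omega> in M. convergent (\<lambda>N. Y N \<omega>)" "(\<integral>\<^sup>+\<omega>. ennreal (lim (\<lambda>N. Y N \<omega>) powr p) \<partial>M) \<le> ennreal D"
proof -
  define S where "S \<omega> = (SUP N. ennreal (Y N \<omega> powr p))" for \<omega>
  have [measurable]: "S \<in> borel_measurable M" unfolding S_def by measurable
  have "(\<integral>\<^sup>+\<omega>. S \<omega> \<partial>M) = (SUP N. \<integral>\<^sup>+\<omega>. ennreal (Y N \<omega> powr p) \<partial>M)"
    unfolding S_def
  proof (rule nn_integral_monotone_convergence_SUP_AE)
    show "AE \<omega> in M. ennreal (Y N \<omega> powr p) \<le> ennreal (Y (Suc N) \<omega> powr p)" for N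
      using mono by eventually_elim (use p in \<open>auto intro!: ennreal_leI powr_mono2\<close>)
  qed measurable
  also have "\<dots> \<le> ennreal D" by (intro SUP_least bound)
  finally have S_int: "(\<integral>\<^sup>+\<omega>. S \<omega> \<partial>M) \<le> ennreal D" .
  then have "(\<integral>\<^sup>+\<omega>. S \<omega> \<partial>M) \<noteq> \<infinity>" by (auto simp: top_unique)
  then have "AE \<omega> in M. S \<omega> \<noteq> \<infinity>" by (intro nn_integral_PInf_AE) auto
  with mono have *: "AE \<omega> in M. convergent (\<lambda>N. Y N \<omega>) \<and> ennreal (lim (\<lambda>N. Y N \<omega>) powr p) \<le> S \<omega>"
  proof eventually_elim
    case (elim \<omega>)
    then obtain s where s: "S \<omega> = ennreal s" "s \<ge> 0" by (cases "S \<omega>") auto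
    have Y_le: "Y N \<omega> powr p \<le> s" for N
    proof -
      have "ennreal (Y N \<omega> powr p) \<le> S \<omega>" unfolding S_def by (rule SUP_upper) simp
      then show ?thesis using s by (simp add: ennreal_le_iff)
    qed
    have "Y N \<omega> \<le> s powr (1 / p)" for N
    proof -
      have "Y N \<omega> = (Y N \<omega> powr p) powr (1 / p)" using elim(1) p by (simp add: powr_powr)
      also have "\<dots> \<le> s powr (1 / p)" using Y_le p by (intro powr_mono2) auto
      finally show ?thesis .
    qed
    moreover have "incseq (\<lambda>N. Y N \<omega>)" using elim(1) by (intro incseq_SucI) auto
    ultimately have conv: "convergent (\<lambda>N. Y N \<omega>)"
      by (intro Bseq_mono_convergent) (auto simp: incseq_def intro!: BseqI'[of _ "s powr (1 / p)"] simp: elim)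
    then have "(\<lambda>N. Y N \<omega>) \<longlonglongrightarrow> lim (\<lambda>N. Y N \<omega>)" by (simp add: convergent_LIMSEQ_iff)
    then have "(\<lambda>N. Y N \<omega> powr p) \<longlonglongrightarrow> lim (\<lambda>N. Y N \<omega>) powr p"
      using p elim by (intro tendsto_powr') auto
    then have "lim (\<lambda>N. Y N \<omega>) powr p \<le> s" by (rule LIMSEQ_le_const2) (use Y_le in auto)
    then show ?case using conv s by (simp add: ennreal_leI)
  qed
  then show "AE \<omega> in M. convergent (\<lambda>N. Y N \<omega>)" by eventually_elim simp
  have "(\<integral>\<^sup>+\<omega>. ennreal (lim (\<lambda>N. Y N \<omega>) powr p) \<partial>M) \<le> (\<integral>\<^sup>+\<omega>. S \<omega> \<partial>M)"
    using * by (intro nn_integral_mono_AE) (auto elim: eventually_mono)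
  then show "(\<integral>\<^sup>+\<omega>. ennreal (lim (\<lambda>N. Y N \<omega>) powr p) \<partial>M) \<le> ennreal D" using S_int by simp
qed

text \<open>Uniform in the index. For a stationary series this much is available before any moment
  is known.\<close>

definition tight_family :: "('i \<Rightarrow> 'a \<Rightarrow> real) \<Rightarrow> bool" where
  "tight_family Y \<longleftrightarrow> (\<forall>e>0. \<exists>K>0. \<forall>t. prob {\<omega>\<in>space M. \<bar>Y t \<omega>\<bar> > K} \<le> e)"

lemma tight_family_diff:
  assumes Y: "tight_family Y" and Y': "tight_family Y'"
    and [measurable]: "\<And>t. Y t \<in> borel_measurable M" "\<And>t. Y' t \<in> borel_measurable M"
  shows "tight_family (\<lambda>t \<omega>. Y t \<omega> - Y' t \<omega>)"
  unfolding tight_family_def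
proof (intro allI impI)
  fix e :: real assume "e > 0"
  then obtain K K' where K: "K > 0" "\<And>t. prob {\<omega>\<in>space M. \<bar>Y t \<omega>\<bar> > K} \<le> e / 2"
    and K': "K' > 0" "\<And>t. prob {\<omega>\<in>space M. \<bar>Y' t \<omega>\<bar> > K'} \<le> e / 2"
    using Y Y' unfolding tight_family_def by (meson half_gt_zero)
  have "prob {\<omega>\<in>space M. \<bar>Y t \<omega> - Y' t \<omega>\<bar> > K + K'} \<le> e" for t
  proof -
    have "prob {\<omega>\<in>space M. \<bar>Y t \<omega> - Y' t \<omega>\<bar> > K + K'} \<le>
        prob ({\<omega>\<in>space M. \<bar>Y t \<omega>\<bar> > K} \<union> {\<omega>\<in>space M. \<bar>Y' t \<omega>\<bar> > K'})"
      by (intro finite_measure_mono) auto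
    also have "\<dots> \<le> prob {\<omega>\<in>space M. \<bar>Y t \<omega>\<bar> > K} + prob {\<omega>\<in>space M. \<bar>Y' t \<omega>\<bar> > K'}"
      by (rule measure_Un_le) auto
    also have "\<dots> \<le> e" using K(2)[of t] K'(2)[of t] by simp
    finally show ?thesis .
  qed
  then show "\<exists>K>0. \<forall>t. prob {\<omega>\<in>space M. \<bar>Y t \<omega> - Y' t \<omega>\<bar> > K} \<le> e"
    using K(1) K'(1) by (intro exI[of _ "K + K'"]) auto
qed

lemma tight_family_identically_distributed:
  assumes [measurable]: "\<And>t. Y t \<in> borel_measurable M" and distr: "\<And>t. distr M borel (Y t) = distr M borel (Y s)"
  shows "tight_family Y"
  unfolding tight_family_def
proof (intro allI impI)
  fix e :: real assume e: "e > 0"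
  interpret D: real_distribution "distr M borel (\<lambda>\<omega>. \<bar>Y s \<omega>\<bar>)" by (rule real_distribution_distr) simp
  have "eventually (\<lambda>K. measure (distr M borel (\<lambda>\<omega>. \<bar>Y s \<omega>\<bar>)) {K<..} < e) at_top"
    by (rule order_tendstoD(2)[OF D.tendsto_measure_greaterThan e])
  then have "eventually (\<lambda>K. measure (distr M borel (\<lambda>\<omega>. \<bar>Y s \<omega>\<bar>)) {K<..} < e \<and> K > 0) at_top"
    using eventually_gt_at_top[of 0] by (rule eventually_conj)
  then obtain K where K: "measure (distr M borel (\<lambda>\<omega>. \<bar>Y s \<omega>\<bar>)) {K<..} < e" "K > 0"
    by (auto simp: eventually_at_top_linorder)
  have "prob {\<omega>\<in>space M. \<bar>Y t \<omega>\<bar> > K} = measure (distr M borel (Y t)) {y. \<bar>y\<bar> > K}" for t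
    by (subst measure_distr) (auto intro!: arg_cong[where f = prob])
  then have "prob {\<omega>\<in>space M. \<bar>Y t \<omega>\<bar> > K} = prob {\<omega>\<in>space M. \<bar>Y s \<omega>\<bar> > K}" for t
    using distr[of t] by simp
  moreover have "prob {\<omega>\<in>space M. \<bar>Y s \<omega>\<bar> > K} = measure (distr M borel (\<lambda>\<omega>. \<bar>Y s \<omega>\<bar>)) {K<..}"
    by (subst measure_distr) (auto intro!: arg_cong[where f = prob])
  ultimately show "\<exists>K>0. \<forall>t. prob {\<omega>\<in>space M. \<bar>Y t \<omega>\<bar> > K} \<le> e"
    using K by (intro exI[of _ K]) auto
qed

lemma prob_moment_le:
  fixes Y :: "'a \<Rightarrow> real"
  assumes [measurable]: "Y \<in> borel_measurable M" and p: "p > 0" and moment: "(\<integral>\<^sup>+\<omega>. ennreal (\<bar>Y \<omega>\<bar> powr p) \<partial>M) \<le> ennreal D"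
    and "D \<ge> 0" "K > 0"
  shows "prob {\<omega>\<in>space M. \<bar>Y \<omega>\<bar> > K} \<le> D / K powr p"
proof -
  have int: "integrable M (\<lambda>\<omega>. \<bar>Y \<omega>\<bar> powr p)"
    using moment by (intro integrableI_nonneg) (auto intro: order.strict_trans1)
  have "ennreal (\<integral>\<omega>. \<bar>Y \<omega>\<bar> powr p \<partial>M) \<le> ennreal D"
    using moment by (subst nn_integral_eq_integral[OF int, symmetric]) auto
  then have le: "(\<integral>\<omega>. \<bar>Y \<omega>\<bar> powr p \<partial>M) \<le> D" using \<open>D \<ge> 0\<close> by (simp add: ennreal_le_iff)
  have "prob {\<omega>\<in>space M. \<bar>Y \<omega>\<bar> > K} \<le> (\<integral>\<omega>. \<bar>Y \<omega>\<bar> powr p \<partial>M) * K powr - p"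
    using assms int by (intro tail_Markov) auto
  also have "\<dots> \<le> D * K powr - p" using le by (intro mult_right_mono) auto
  finally show ?thesis by (simp add: powr_minus divide_inverse)
qed

lemma tight_family_moment:
  fixes Y :: "'i \<Rightarrow> 'a \<Rightarrow> real"
  assumes [measurable]: "\<And>t. Y t \<in> borel_measurable M" and p: "p > 0"
    and moment: "\<And>t. (\<integral>\<^sup>+\<omega>. ennreal (\<bar>Y t \<omega>\<bar> powr p) \<partial>M) \<le> ennreal D" and "D \<ge> 0"
  shows "tight_family Y"
  unfolding tight_family_def
proof (intro allI impI)
  fix e :: real assume e: "e > 0"
  \<comment> \<open>Solves K^p = (D + 1) / e; the summand 1 keeps \<open>K\<close> positive when
    \<open>D = 0\<close>.\<close>
  define K where "K = ((D + 1) / e) powr (1 / p)"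
  have K: "K > 0" using \<open>D \<ge> 0\<close> e by (simp add: K_def)
  have Kp: "K powr p = (D + 1) / e" using p \<open>D \<ge> 0\<close> e by (simp add: K_def powr_powr)
  have "D / K powr p \<le> e" unfolding Kp using \<open>D \<ge> 0\<close> e by (simp add: divide_le_eq mult_left_mono mult.commute)
  then have "prob {\<omega>\<in>space M. \<bar>Y t \<omega>\<bar> > K} \<le> e" for t
    using prob_moment_le[OF _ p moment \<open>D \<ge> 0\<close> K, of t] by simp
  then show "\<exists>K>0. \<forall>t. prob {\<omega>\<in>space M. \<bar>Y t \<omega>\<bar> > K} \<le> e" using K by blast
qed

text \<open>Going back \<open>N\<close> steps, \<open>V t\<close> is a product of \<open>N\<close>
  factors times \<open>V (t - N)\<close>. The product tends to 0 in probability, as its moment of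
  order p is at most \<open>\<theta> ^ N\<close>, while the other term stays tight. This is
  uniqueness among solutions that are tight in time.\<close>

lemma homogeneous_recursion_zero:
  fixes a V :: "int \<Rightarrow> 'a \<Rightarrow> real"
  assumes Z: "indep_vars (\<lambda>_. borel) Z UNIV" and a_det: "\<And>t. determined_by Z {t} (a t)"
    and a_meas [measurable]: "\<And>t. a t \<in> borel_measurable M" and V_meas [measurable]: "\<And>t. V t \<in> borel_measurable M"
    and a_nonneg: "\<And>t. AE \<omega> in M. a t \<omega> \<ge> 0"
    and rec: "\<And>t. AE \<omega> in M. V t \<omega> = a t \<omega> * V (t - 1) \<omega>" and tight: "tight_family V"
    and p: "p > 0" and a_moment: "\<And>t. (\<integral>\<^sup>+\<omega>. ennreal (a t \<omega> powr p) \<partial>M) \<le> ennreal \<theta>" and \<theta>: "0 \<le> \<theta>" "\<theta> < 1"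
  shows "AE \<omega> in M. V t \<omega> = 0"
proof -
  define P where "P N \<omega> = (\<Prod>j<N. a (t - int j) \<omega>)" for N \<omega>
  have [measurable]: "P N \<in> borel_measurable M" for N unfolding P_def by measurable
  have P_Suc: "P (Suc N) = (\<lambda>\<omega>. a (t - int N) \<omega> * P N \<omega>)" for N
    by (simp add: P_def fun_eq_iff mult.commute)
  have P_det: "determined_by Z {t - int N<..} (P N)" for N
  proof (induction N)
    case 0
    then show ?case using determined_by_const[of Z "{t<..}" 1] by (simp add: P_def[abs_def])
  next
    case (Suc N)
    show ?case unfolding P_Suc
      by (intro determined_by_add_mult determined_by_mono[OF a_det] determined_by_mono[OF Suc]) auto
  qed
  have P_nonneg: "AE \<omega> in M. \<forall>N. P N \<omega> \<ge> 0"
  proof -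
    have "AE \<omega> in M. \<forall>t. a t \<omega> \<ge> 0" using a_nonneg by (simp add: AE_all_countable)
    then show ?thesis by eventually_elim (auto simp: P_def intro!: prod_nonneg)
  qed
  have P_moment: "(\<integral>\<^sup>+\<omega>. ennreal (\<bar>P N \<omega>\<bar> powr p) \<partial>M) \<le> ennreal (\<theta> ^ N)" for N
  proof (induction N)
    case 0
    then show ?case by (simp add: P_def emeasure_space_1)
  next
    case (Suc N)
    have ind: "indep_rv borel (a (t - int N)) borel (P N)"
      by (rule determined_by_indep[OF Z _ a_det P_det]) auto
    have "(\<integral>\<^sup>+\<omega>. ennreal (\<bar>P (Suc N) \<omega>\<bar> powr p) \<partial>M) =
        (\<integral>\<^sup>+\<omega>. ennreal (a (t - int N) \<omega> powr p) * ennreal (\<bar>P N \<omega>\<bar> powr p) \<partial>M)"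
    proof (rule nn_integral_cong_AE)
      show "AE \<omega> in M. ennreal (\<bar>P (Suc N) \<omega>\<bar> powr p) = ennreal (a (t - int N) \<omega> powr p) * ennreal (\<bar>P N \<omega>\<bar> powr p)"
        using a_nonneg[of "t - int N"] by eventually_elim (simp add: P_Suc abs_mult powr_mult ennreal_mult)
    qed
    also have "\<dots> = (\<integral>\<^sup>+\<omega>. ennreal (a (t - int N) \<omega> powr p) \<partial>M) * (\<integral>\<^sup>+\<omega>. ennreal (\<bar>P N \<omega>\<bar> powr p) \<partial>M)"
      by (rule nn_integral_indep_mult[OF ind, of "\<lambda>x. ennreal (x powr p)" "\<lambda>x. ennreal (\<bar>x\<bar> powr p)"]) auto
    also have "\<dots> \<le> ennreal \<theta> * ennreal (\<theta> ^ N)" by (intro mult_mono a_moment Suc) auto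
    finally show ?case using \<theta> by (simp add: ennreal_mult)
  qed
  have unroll: "AE \<omega> in M. V t \<omega> = P N \<omega> * V (t - int N) \<omega>" for N
  proof (induction N)
    case 0
    then show ?case by (simp add: P_def)
  next
    case (Suc N)
    have "t - int N - 1 = t - int (Suc N)" by simp
    with rec[of "t - int N"] have "AE \<omega> in M. V (t - int N) \<omega> = a (t - int N) \<omega> * V (t - int (Suc N)) \<omega>"
      by (simp only:)
    with Suc show ?case by eventually_elim (simp only: P_Suc mult_ac)
  qed
  have zero: "prob {\<omega>\<in>space M. \<bar>V t \<omega>\<bar> > e} = 0" if e: "e > 0" for e
  proof -
    have "prob {\<omega>\<in>space M. \<bar>V t \<omega>\<bar> > e} \<le> d" if d: "d > 0" for d
    proof -
      obtain K where K: "K > 0" "\<And>s. prob {\<omega>\<in>space M. \<bar>V s \<omega>\<bar> > K} \<le> d"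
        using tight d unfolding tight_family_def by blast
      \<comment> \<open>If the product of the two terms exceeds \<open>e\<close>, either the first
        exceeds \<open>e / K\<close> or the second exceeds \<open>K\<close>; the latter has
        probability at most \<open>d\<close> for every \<open>N\<close>.\<close>
      have bound: "prob {\<omega>\<in>space M. \<bar>V t \<omega>\<bar> > e} \<le> \<theta> ^ N / (e / K) powr p + d" for N
      proof -
        have "prob {\<omega>\<in>space M. \<bar>V t \<omega>\<bar> > e} \<le>
            prob ({\<omega>\<in>space M. \<bar>P N \<omega>\<bar> > e / K} \<union> {\<omega>\<in>space M. \<bar>V (t - int N) \<omega>\<bar> > K})"
        proof (rule finite_measure_mono_AE)
          show "AE \<omega> in M. \<omega> \<in> {\<omega>\<in>space M. \<bar>V t \<omega>\<bar> > e} \<longrightarrow>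
              \<omega> \<in> {\<omega>\<in>space M. \<bar>P N \<omega>\<bar> > e / K} \<union> {\<omega>\<in>space M. \<bar>V (t - int N) \<omega>\<bar> > K}"
            using unroll[of N]
          proof eventually_elim
            case (elim \<omega>)
            have False if "\<bar>V t \<omega>\<bar> > e" "\<bar>P N \<omega>\<bar> \<le> e / K" "\<bar>V (t - int N) \<omega>\<bar> \<le> K"
            proof -
              have "\<bar>V t \<omega>\<bar> \<le> e / K * K"
                unfolding elim abs_mult using that e K by (intro mult_mono) auto
              then show False using that(1) K by simp
            qed
            then show ?case by force
          qed
        qed measurable
        also have "\<dots> \<le> prob {\<omega>\<in>space M. \<bar>P N \<omega>\<bar> > e / K} + prob {\<omega>\<in>space M. \<bar>V (t - int N) \<omega>\<bar> > K}"
          by (rule measure_Un_le) auto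
        also have "\<dots> \<le> \<theta> ^ N / (e / K) powr p + d"
          using \<theta> e K by (intro add_mono prob_moment_le p P_moment) auto
        finally show ?thesis .
      qed
      have "(\<lambda>N. \<theta> ^ N / (e / K) powr p + d) \<longlonglongrightarrow> 0 / (e / K) powr p + d"
        using \<theta> e K by (intro tendsto_intros LIMSEQ_power_zero) auto
      then show ?thesis by (intro LIMSEQ_le_const[of _ d]) (use bound in auto)
    qed
    then have "prob {\<omega>\<in>space M. \<bar>V t \<omega>\<bar> > e} \<le> 0" by (rule field_le_epsilon) simp
    then show ?thesis by (simp add: measure_le_0_iff)
  qed
  have "AE \<omega> in M. \<forall>n. \<bar>V t \<omega>\<bar> \<le> 1 / real (Suc n)"
    unfolding AE_all_countable
  proof
    fix n
    have "{\<omega>\<in>space M. \<bar>V t \<omega>\<bar> > 1 / real (Suc n)} \<in> null_sets M"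
      using zero[of "1 / real (Suc n)"] by (auto simp: null_sets_def emeasure_eq_measure)
    then show "AE \<omega> in M. \<bar>V t \<omega>\<bar> \<le> 1 / real (Suc n)"
      by (rule AE_I') auto
  qed
  then show ?thesis
  proof eventually_elim
    case (elim \<omega>)
    show ?case
    proof (rule ccontr)
      assume "V t \<omega> \<noteq> 0"
      then obtain n where "1 / real (Suc n) < \<bar>V t \<omega>\<bar>" using reals_Archimedean[of "\<bar>V t \<omega>\<bar>"] by (auto simp: inverse_eq_divide)
      then show False using elim by (meson not_le)
    qed
  qed
qed

end

section \<open>The triangular recursion\<close>

lemma vector2_eq: "(v :: real^2) = vector [v $ 1, v $ 2]"
  by (simp add: vec_eq_iff forall_2)

lemma triangular_mult_vector:
  fixes a b d x y :: real
  shows "(vector [vector [a, b], vector [0, d]] :: real^2^2) *v vector [x, y] = vector [a * x + b * y, d * y]"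
  by (simp add: vec_eq_iff forall_2 matrix_vector_mult_def sum_2)

text \<open>The definition appends the oldest factor on the right. Splitting off the newest factor
  on the left turns partial sums of the series into a recursion in time.\<close>

lemma back_prod_Suc: "back_prod A t (Suc n) = A t ** back_prod A (t - 1) n"
proof (induction n)
  case (Suc n)
  have "back_prod A t (Suc (Suc n)) = A t ** back_prod A (t - 1) n ** A (t - int (Suc n))"
    using Suc by simp
  also have "\<dots> = A t ** (back_prod A (t - 1) n ** A (t - 1 - int n))"
    by (simp add: matrix_mul_assoc algebra_simps)
  finally show ?case by simp
qed simp

text \<open>The marginal law is the image of the finite-dimensional law over the index set {0} under
  the coordinate map.\<close>

lemma (in prob_space) strictly_stationary_distr:
  assumes "strictly_stationary M X"
  shows "distr M borel (X t) = distr M borel (X s)"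
proof -
  have meas [measurable]: "X t \<in> borel_measurable M" for t using assms by (simp add: strictly_stationary_def)
  have "distr M borel (X k) = distr M borel (X 0)" for k
  proof -
    have eq: "distr M (\<Pi>\<^sub>M t\<in>{0::int}. borel) (\<lambda>\<omega>. \<lambda>t\<in>{0}. X (t + k) \<omega>) =
        distr M (\<Pi>\<^sub>M t\<in>{0}. borel) (\<lambda>\<omega>. \<lambda>t\<in>{0}. X t \<omega>)"
      using assms unfolding strictly_stationary_def by blast
    have "distr M borel (\<lambda>\<omega>. Y 0 \<omega>) = distr (distr M (\<Pi>\<^sub>M t\<in>{0::int}. borel) (\<lambda>\<omega>. \<lambda>t\<in>{0}. Y t \<omega>)) borel (\<lambda>v. v 0)"
      if [measurable]: "\<And>t. Y t \<in> borel_measurable M" for Y :: "int \<Rightarrow> 'a \<Rightarrow> 'b"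
    proof -
      have "(\<lambda>v. v (0::int)) \<in> (\<Pi>\<^sub>M t\<in>{0::int}. borel :: 'b measure) \<rightarrow>\<^sub>M borel"
        by (rule measurable_component_singleton) simp
      moreover have "(\<lambda>\<omega>. \<lambda>t\<in>{0::int}. Y t \<omega>) \<in> M \<rightarrow>\<^sub>M (\<Pi>\<^sub>M t\<in>{0::int}. borel)"
        by (rule measurable_restrict) simp
      ultimately show ?thesis by (simp add: distr_distr comp_def)
    qed
    from this[of "\<lambda>t. X (t + k)"] this[of X] show ?thesis using eq by simp
  qed
  from this[of t] this[of s] show ?thesis by simp
qed

lemma (in prob_space) strictly_stationary_compose:
  assumes "strictly_stationary M X" and f [measurable]: "f \<in> borel_measurable borel"
  shows "strictly_stationary M (\<lambda>t \<omega>. f (X t \<omega>))"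
proof -
  have meas [measurable]: "X t \<in> borel_measurable M" for t using assms by (simp add: strictly_stationary_def)
  have "distr M (\<Pi>\<^sub>M t\<in>J. borel) (\<lambda>\<omega>. \<lambda>t\<in>J. f (X (t + k) \<omega>)) = distr M (\<Pi>\<^sub>M t\<in>J. borel) (\<lambda>\<omega>. \<lambda>t\<in>J. f (X t \<omega>))"
    if "finite J" for J :: "int set" and k
  proof -
    let ?F = "\<lambda>v. \<lambda>t\<in>J. f (v t)"
    have F: "?F \<in> (\<Pi>\<^sub>M t\<in>J. borel) \<rightarrow>\<^sub>M (\<Pi>\<^sub>M t\<in>J. borel)"
    proof (rule measurable_restrict)
      fix t assume "t \<in> J"
      then have "(\<lambda>v. v t) \<in> (\<Pi>\<^sub>M t\<in>J. borel :: 'b measure) \<rightarrow>\<^sub>M borel" by (rule measurable_component_singleton)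
      then show "(\<lambda>v. f (v t)) \<in> (\<Pi>\<^sub>M t\<in>J. borel) \<rightarrow>\<^sub>M borel" by (rule measurable_compose[OF _ f])
    qed
    have *: "distr M (\<Pi>\<^sub>M t\<in>J. borel) (\<lambda>\<omega>. \<lambda>t\<in>J. f (Y t \<omega>)) =
        distr (distr M (\<Pi>\<^sub>M t\<in>J. borel) (\<lambda>\<omega>. \<lambda>t\<in>J. Y t \<omega>)) (\<Pi>\<^sub>M t\<in>J. borel) ?F"
      if [measurable]: "\<And>t. Y t \<in> borel_measurable M" for Y
    proof -
      have "(\<lambda>\<omega>. \<lambda>t\<in>J. Y t \<omega>) \<in> M \<rightarrow>\<^sub>M (\<Pi>\<^sub>M t\<in>J. borel)"
        by (rule measurable_restrict) simp
      moreover have "?F (\<lambda>t\<in>J. Y t \<omega>) = (\<lambda>t\<in>J. f (Y t \<omega>))" for \<omega> by (auto simp: fun_eq_iff)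
      ultimately show ?thesis by (simp add: distr_distr[OF F] comp_def)
    qed
    have "distr M (\<Pi>\<^sub>M t\<in>J. borel) (\<lambda>\<omega>. \<lambda>t\<in>J. X (t + k) \<omega>) = distr M (\<Pi>\<^sub>M t\<in>J. borel) (\<lambda>\<omega>. \<lambda>t\<in>J. X t \<omega>)"
      using assms(1) that unfolding strictly_stationary_def by blast
    then show ?thesis using *[of "\<lambda>t. X (t + k)"] *[of X] by simp
  qed
  then show ?thesis unfolding strictly_stationary_def by auto
qed

section \<open>The triangular model and the partial sums of its series\<close>

locale triangular_recursion = prob_space M for M :: "'a measure" +
  fixes A1 A2 A4 B1 B2 :: "int \<Rightarrow> 'a \<Rightarrow> real"
    and A :: "int \<Rightarrow> 'a \<Rightarrow> real^2^2" and B W :: "int \<Rightarrow> 'a \<Rightarrow> real^2" and \<alpha>1 \<alpha>2 :: real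
  assumes A_eq: "\<And>t \<omega>. A t \<omega> = vector [vector [A1 t \<omega>, A2 t \<omega>], vector [0, A4 t \<omega>]]"
    and B_eq: "\<And>t \<omega>. B t \<omega> = vector [B1 t \<omega>, B2 t \<omega>]"
    and iid: "iid_sequence M (\<lambda>t \<omega>. (A t \<omega>, B t \<omega>))"
    and pos: "\<And>t. AE \<omega> in M. A1 t \<omega> > 0 \<and> A2 t \<omega> > 0 \<and> A4 t \<omega> > 0 \<and> B1 t \<omega> > 0 \<and> B2 t \<omega> > 0"
    and A1_nonarith: "non_arithmetic M (\<lambda>\<omega>. ln (A1 0 \<omega>))"
    and A4_nonarith: "non_arithmetic M (\<lambda>\<omega>. ln (A4 0 \<omega>))"
    and \<alpha>: "0 < \<alpha>1" "\<alpha>1 < \<alpha>2"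
    and A1_int: "integrable M (\<lambda>\<omega>. A1 0 \<omega> powr \<alpha>1)" and A1_one: "(\<integral>\<omega>. A1 0 \<omega> powr \<alpha>1 \<partial>M) = 1"
    and A1_ln: "integrable M (\<lambda>\<omega>. A1 0 \<omega> powr \<alpha>1 * max (ln (A1 0 \<omega>)) 0)"
    and B1_int: "integrable M (\<lambda>\<omega>. B1 0 \<omega> powr \<alpha>1)"
    and A4_int: "integrable M (\<lambda>\<omega>. A4 0 \<omega> powr \<alpha>2)" and A4_one: "(\<integral>\<omega>. A4 0 \<omega> powr \<alpha>2 \<partial>M) = 1"
    and A4_ln: "integrable M (\<lambda>\<omega>. A4 0 \<omega> powr \<alpha>2 * max (ln (A4 0 \<omega>)) 0)"
    and B2_int: "integrable M (\<lambda>\<omega>. B2 0 \<omega> powr \<alpha>2)"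
    and A2_int: "integrable M (\<lambda>\<omega>. A2 0 \<omega> powr \<alpha>1)"
    and sol: "stationary_causal_solution M A B W"
begin

text \<open>Independence holds between times only; the entries at one time may depend on each other
  and are therefore kept together.\<close>

definition Z :: "int \<Rightarrow> 'a \<Rightarrow> (real^2^2) \<times> (real^2)" where
  "Z t \<omega> = (A t \<omega>, B t \<omega>)"

lemma Z_indep: "indep_vars (\<lambda>_. borel) Z UNIV" and Z_distr: "distr M borel (Z t) = distr M borel (Z 0)"
  using iid by (auto simp: iid_sequence_def Z_def[abs_def])

lemma Z_meas [measurable]: "Z t \<in> borel_measurable M"
  using Z_indep unfolding indep_vars_def by auto

lemma entry_meas:
  "(\<lambda>z :: (real^2^2) \<times> (real^2). fst z $ i $ j) \<in> borel_measurable borel"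
  "(\<lambda>z :: (real^2^2) \<times> (real^2). snd z $ i) \<in> borel_measurable borel"
  by (intro borel_measurable_continuous_onI continuous_intros)+

text \<open>Written as coordinates of \<open>Z t\<close>, all entries inherit measurability,
  dependence on a single time and equality of laws from the driving sequence.\<close>

lemma entries:
  "A1 t = (\<lambda>\<omega>. fst (Z t \<omega>) $ 1 $ 1)" "A2 t = (\<lambda>\<omega>. fst (Z t \<omega>) $ 1 $ 2)" "A4 t = (\<lambda>\<omega>. fst (Z t \<omega>) $ 2 $ 2)"
  "B1 t = (\<lambda>\<omega>. snd (Z t \<omega>) $ 1)" "B2 t = (\<lambda>\<omega>. snd (Z t \<omega>) $ 2)"
  by (simp_all add: Z_def A_eq B_eq fun_eq_iff)

lemma Z_compose_distr:
  assumes [measurable]: "f \<in> borel_measurable borel"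
  shows "distr M borel (\<lambda>\<omega>. f (Z t \<omega>)) = distr M borel (\<lambda>\<omega>. f (Z 0 \<omega>))"
proof -
  have "distr M borel (\<lambda>\<omega>. f (Z t \<omega>)) = distr (distr M borel (Z t)) borel f" for t
    by (simp add: distr_distr comp_def)
  then show ?thesis using Z_distr[of t] by simp
qed

lemma entry_measurable [measurable]:
  "A1 t \<in> borel_measurable M" "A2 t \<in> borel_measurable M" "A4 t \<in> borel_measurable M"
  "B1 t \<in> borel_measurable M" "B2 t \<in> borel_measurable M"
  unfolding entries by (rule measurable_compose[OF Z_meas entry_meas(1)] measurable_compose[OF Z_meas entry_meas(2)])+

lemma entry_det:
  "determined_by Z {t} (A1 t)" "determined_by Z {t} (A2 t)" "determined_by Z {t} (A4 t)"
  "determined_by Z {t} (B1 t)" "determined_by Z {t} (B2 t)"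
  unfolding entries by (rule determined_by_component[OF _ entry_meas(1)] determined_by_component[OF _ entry_meas(2)], simp)+

lemma entry_distr:
  "distr M borel (A1 t) = distr M borel (A1 0)" "distr M borel (A2 t) = distr M borel (A2 0)"
  "distr M borel (A4 t) = distr M borel (A4 0)" "distr M borel (B1 t) = distr M borel (B1 0)"
  "distr M borel (B2 t) = distr M borel (B2 0)"
  unfolding entries by (rule Z_compose_distr[OF entry_meas(1)] Z_compose_distr[OF entry_meas(2)])+

lemma all_pos: "AE \<omega> in M. \<forall>t. A1 t \<omega> > 0 \<and> A2 t \<omega> > 0 \<and> A4 t \<omega> > 0 \<and> B1 t \<omega> > 0 \<and> B2 t \<omega> > 0"
  using pos by (simp add: AE_all_countable)

lemma entry_pos:
  "AE \<omega> in M. A1 t \<omega> > 0" "AE \<omega> in M. A2 t \<omega> > 0" "AE \<omega> in M. A4 t \<omega> > 0"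
  "AE \<omega> in M. B1 t \<omega> > 0" "AE \<omega> in M. B2 t \<omega> > 0"
  using pos[of t] by (auto elim: eventually_mono)

lemma entry_nonneg:
  "AE \<omega> in M. A1 t \<omega> \<ge> 0" "AE \<omega> in M. A2 t \<omega> \<ge> 0" "AE \<omega> in M. A4 t \<omega> \<ge> 0"
  "AE \<omega> in M. B1 t \<omega> \<ge> 0" "AE \<omega> in M. B2 t \<omega> \<ge> 0"
proof -
  have *: "AE \<omega> in M. f \<omega> \<ge> 0" if "AE \<omega> in M. f \<omega> > 0" for f :: "'a \<Rightarrow> real"
    using that by eventually_elim simp
  show "AE \<omega> in M. A1 t \<omega> \<ge> 0" "AE \<omega> in M. A2 t \<omega> \<ge> 0" "AE \<omega> in M. A4 t \<omega> \<ge> 0"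
    "AE \<omega> in M. B1 t \<omega> \<ge> 0" "AE \<omega> in M. B2 t \<omega> \<ge> 0"
    by (rule *, rule entry_pos)+
qed

lemma moment_transfer:
  assumes "distr M borel Y = distr M borel Y'" "integrable M (\<lambda>\<omega>. Y' \<omega> powr p)"
    and [measurable]: "Y \<in> borel_measurable M" "Y' \<in> borel_measurable M"
  shows "integrable M (\<lambda>\<omega>. Y \<omega> powr p)" 
    "(\<integral>\<^sup>+\<omega>. ennreal (Y \<omega> powr p) \<partial>M) = ennreal (\<integral>\<omega>. Y' \<omega> powr p \<partial>M)"
proof -
  show int: "integrable M (\<lambda>\<omega>. Y \<omega> powr p)"
    by (rule integrable_distr_transfer[OF assms(1) _ _ _ assms(2)]) auto
  have "(\<integral>\<^sup>+\<omega>. ennreal (Y \<omega> powr p) \<partial>M) = (\<integral>\<^sup>+\<omega>. ennreal (Y' \<omega> powr p) \<partial>M)"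
    by (rule nn_integral_distr_eq[of Y borel Y' "\<lambda>y. ennreal (y powr p)"]) (use assms in auto)
  also have "\<dots> = ennreal (\<integral>\<omega>. Y' \<omega> powr p \<partial>M)" using assms(2) by (intro nn_integral_eq_integral) auto
  finally show "(\<integral>\<^sup>+\<omega>. ennreal (Y \<omega> powr p) \<partial>M) = ennreal (\<integral>\<omega>. Y' \<omega> powr p \<partial>M)" .
qed

text \<open>At order \<alpha>1 itself the moment is 1, so contraction is available strictly below it
  only.\<close>

lemma A1_contract:
  assumes "0 < p" "p < \<alpha>1"
  obtains \<theta> where "0 \<le> \<theta>" "\<theta> < 1" "\<And>t. (\<integral>\<^sup>+\<omega>. ennreal (A1 t \<omega> powr p) \<partial>M) \<le> ennreal \<theta>"
proof (rule that)
  note * = moment_less_one[OF _ entry_pos(1) non_arithmetic_not_one[OF A1_nonarith] A1_int A1_one assms]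
  show "0 \<le> (\<integral>\<omega>. A1 0 \<omega> powr p \<partial>M)" "(\<integral>\<omega>. A1 0 \<omega> powr p \<partial>M) < 1" using *(2) by auto
  show "(\<integral>\<^sup>+\<omega>. ennreal (A1 t \<omega> powr p) \<partial>M) \<le> ennreal (\<integral>\<omega>. A1 0 \<omega> powr p \<partial>M)" for t
    using moment_transfer(2)[OF entry_distr(1) *(1)] by simp
qed

lemma A4_contract:
  assumes "0 < p" "p < \<alpha>2"
  obtains \<theta> where "0 \<le> \<theta>" "\<theta> < 1" "\<And>t. (\<integral>\<^sup>+\<omega>. ennreal (A4 t \<omega> powr p) \<partial>M) \<le> ennreal \<theta>"
proof (rule that)
  note * = moment_less_one[OF _ entry_pos(3) non_arithmetic_not_one[OF A4_nonarith] A4_int A4_one assms]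
  show "0 \<le> (\<integral>\<omega>. A4 0 \<omega> powr p \<partial>M)" "(\<integral>\<omega>. A4 0 \<omega> powr p \<partial>M) < 1" using *(2) by auto
  show "(\<integral>\<^sup>+\<omega>. ennreal (A4 t \<omega> powr p) \<partial>M) \<le> ennreal (\<integral>\<omega>. A4 0 \<omega> powr p \<partial>M)" for t
    using moment_transfer(2)[OF entry_distr(3) *(1)] by simp
qed

primrec Y2 :: "nat \<Rightarrow> int \<Rightarrow> 'a \<Rightarrow> real" where
  "Y2 0 = (\<lambda>t \<omega>. 0)"
| "Y2 (Suc N) = (\<lambda>t \<omega>. A4 t \<omega> * Y2 N (t - 1) \<omega> + B2 t \<omega>)"

text \<open>First coordinate of the sum of the first \<open>N\<close> terms of the series. The index
  of \<open>Y2\<close> drops together with that of \<open>Y1\<close>, because one matrix is split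
  off for both coordinates at once.\<close>

primrec Y1 :: "nat \<Rightarrow> int \<Rightarrow> 'a \<Rightarrow> real" where
  "Y1 0 = (\<lambda>t \<omega>. 0)"
| "Y1 (Suc N) = (\<lambda>t \<omega>. A1 t \<omega> * Y1 N (t - 1) \<omega> + (A2 t \<omega> * Y2 N (t - 1) \<omega> + B1 t \<omega>))"

lemma partial_sum_eq:
  "(\<Sum>n<N. back_prod (\<lambda>s. A s \<omega>) t n *v B (t - int n) \<omega>) = vector [Y1 N t \<omega>, Y2 N t \<omega>]"
proof (induction N arbitrary: t)
  case 0
  then show ?case by (simp add: vec_eq_iff forall_2)
next
  case (Suc N)
  have "(\<Sum>n<Suc N. back_prod (\<lambda>s. A s \<omega>) t n *v B (t - int n) \<omega>) =
      B t \<omega> + (\<Sum>n<N. back_prod (\<lambda>s. A s \<omega>) t (Suc n) *v B (t - int (Suc n)) \<omega>)"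
    by (subst sum.lessThan_Suc_shift) simp
  also have "(\<Sum>n<N. back_prod (\<lambda>s. A s \<omega>) t (Suc n) *v B (t - int (Suc n)) \<omega>) =
      (\<Sum>n<N. A t \<omega> *v (back_prod (\<lambda>s. A s \<omega>) (t - 1) n *v B (t - 1 - int n) \<omega>))"
    by (intro sum.cong refl) (simp only: back_prod_Suc matrix_vector_mul_assoc of_nat_Suc, simp add: algebra_simps)
  also have "\<dots> = A t \<omega> *v (\<Sum>n<N. back_prod (\<lambda>s. A s \<omega>) (t - 1) n *v B (t - 1 - int n) \<omega>)"
    by (simp only: linear_sum[OF matrix_vector_mul_linear])
  also have "\<dots> = A t \<omega> *v vector [Y1 N (t - 1) \<omega>, Y2 N (t - 1) \<omega>]" by (simp only: Suc)
  also have "B t \<omega> + \<dots> = vector [Y1 (Suc N) t \<omega>, Y2 (Suc N) t \<omega>]"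
    by (simp only: A_eq B_eq triangular_mult_vector) (simp add: vec_eq_iff forall_2)
  finally show ?case .
qed

lemma Y2_meas [measurable]: "Y2 N t \<in> borel_measurable M"
  by (induction N arbitrary: t) auto

lemma Y1_meas [measurable]: "Y1 N t \<in> borel_measurable M"
  by (induction N arbitrary: t) auto

lemma Y2_det: "determined_by Z {..t} (Y2 N t)"
proof (induction N arbitrary: t)
  case (Suc N)
  have "determined_by Z {..t} (\<lambda>\<omega>. A4 t \<omega> * Y2 N (t - 1) \<omega> + B2 t \<omega>)"
    by (intro determined_by_add_mult determined_by_mono[OF entry_det(3)] determined_by_mono[OF entry_det(5)]
        determined_by_mono[OF Suc]) auto
  then show ?case by simp
qed (simp add: determined_by_const)

lemma Y1_det: "determined_by Z {..t} (Y1 N t)"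
proof (induction N arbitrary: t)
  case (Suc N)
  have "determined_by Z {..t} (\<lambda>\<omega>. A1 t \<omega> * Y1 N (t - 1) \<omega> + (A2 t \<omega> * Y2 N (t - 1) \<omega> + B1 t \<omega>))"
    by (intro determined_by_add_mult determined_by_mono[OF entry_det(1)] determined_by_mono[OF entry_det(2)]
        determined_by_mono[OF entry_det(4)] determined_by_mono[OF Suc] determined_by_mono[OF Y2_det]) auto
  then show ?case by simp
qed (simp add: determined_by_const)

lemma Y_mono:
  assumes "\<And>t. A1 t \<omega> > 0 \<and> A2 t \<omega> > 0 \<and> A4 t \<omega> > 0 \<and> B1 t \<omega> > 0 \<and> B2 t \<omega> > 0"
  shows "0 \<le> Y2 N t \<omega> \<and> Y2 N t \<omega> \<le> Y2 (Suc N) t \<omega>" "0 \<le> Y1 N t \<omega> \<and> Y1 N t \<omega> \<le> Y1 (Suc N) t \<omega>"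
proof -
  have nn: "0 \<le> A1 t \<omega>" "0 \<le> A2 t \<omega>" "0 \<le> A4 t \<omega>" "0 \<le> B1 t \<omega>" "0 \<le> B2 t \<omega>" for t
    using assms[of t] by auto
  have 2: "0 \<le> Y2 N t \<omega> \<and> Y2 N t \<omega> \<le> Y2 (Suc N) t \<omega>" for N t
  proof (induction N arbitrary: t)
    case 0
    then show ?case by (simp add: nn)
  next
    case (Suc N)
    have "A4 t \<omega> * Y2 N (t - 1) \<omega> \<le> A4 t \<omega> * Y2 (Suc N) (t - 1) \<omega>"
      using Suc[of "t - 1"] nn by (intro mult_left_mono) auto
    moreover have "0 \<le> A4 t \<omega> * Y2 N (t - 1) \<omega>" using Suc[of "t - 1"] nn by simp
    ultimately show ?case using nn by simp
  qed
  show "0 \<le> Y2 N t \<omega> \<and> Y2 N t \<omega> \<le> Y2 (Suc N) t \<omega>" by (rule 2)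
  show "0 \<le> Y1 N t \<omega> \<and> Y1 N t \<omega> \<le> Y1 (Suc N) t \<omega>"
  proof (induction N arbitrary: t)
    case 0
    then show ?case by (simp add: nn)
  next
    case (Suc N)
    have "A1 t \<omega> * Y1 N (t - 1) \<omega> \<le> A1 t \<omega> * Y1 (Suc N) (t - 1) \<omega>"
      using Suc[of "t - 1"] nn by (intro mult_left_mono) auto
    moreover have "A2 t \<omega> * Y2 N (t - 1) \<omega> \<le> A2 t \<omega> * Y2 (Suc N) (t - 1) \<omega>"
      using 2[of N "t - 1"] nn by (intro mult_left_mono) auto
    moreover have "0 \<le> A1 t \<omega> * Y1 N (t - 1) \<omega>" "0 \<le> A2 t \<omega> * Y2 N (t - 1) \<omega>"
      using Suc[of "t - 1"] 2[of N "t - 1"] nn by simp_all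
    moreover have "0 \<le> B1 t \<omega>" by (rule nn)
    ultimately show ?case by (simp del: Y2.simps)
  qed
qed

lemma AE_Y_mono:
  "AE \<omega> in M. \<forall>N. 0 \<le> Y2 N t \<omega> \<and> Y2 N t \<omega> \<le> Y2 (Suc N) t \<omega>"
  "AE \<omega> in M. \<forall>N. 0 \<le> Y1 N t \<omega> \<and> Y1 N t \<omega> \<le> Y1 (Suc N) t \<omega>"
  using all_pos by (eventually_elim, use Y_mono in blast)+

lemma Y2_moment:
  assumes p: "0 < p" "p < \<alpha>2"
  obtains D where "D \<ge> 0" "\<And>N t. (\<integral>\<^sup>+\<omega>. ennreal (Y2 N t \<omega> powr p) \<partial>M) \<le> ennreal D"
proof -
  obtain \<theta> where \<theta>: "0 \<le> \<theta>" "\<theta> < 1" "\<And>t. (\<integral>\<^sup>+\<omega>. ennreal (A4 t \<omega> powr p) \<partial>M) \<le> ennreal \<theta>"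
    using A4_contract[OF p] by blast
  have B2p: "integrable M (\<lambda>\<omega>. B2 0 \<omega> powr p)"
    by (rule integrable_powr_le[OF _ B2_int]) (use p entry_nonneg in auto)
  show thesis
  proof (rule recursion_moment_bound[where a = A4 and q = "\<lambda>N. B2" and Y = Y2 and p = p and \<theta> = \<theta> and C = "\<integral>\<omega>. B2 0 \<omega> powr p \<partial>M"])
    show "indep_rv borel (A4 t) borel (Y2 N (t - 1))" for N t
      by (rule determined_by_indep[OF Z_indep _ entry_det(3) Y2_det]) auto
    show "AE \<omega> in M. Y2 N t \<omega> \<ge> 0" for N t using AE_Y_mono(1)[of t] by eventually_elim blast
    show "(\<integral>\<^sup>+\<omega>. ennreal (B2 t \<omega> powr p) \<partial>M) \<le> ennreal (\<integral>\<omega>. B2 0 \<omega> powr p \<partial>M)" for t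
      using moment_transfer(2)[OF entry_distr(5) B2p] by simp
  qed (use \<theta> p entry_nonneg that in auto)
qed

text \<open>The order is also below \<alpha>2, so the partial sums of the second component have a
  uniform moment bound; \<open>A2 t\<close> is independent of the earlier partial sum. The factor
  \<open>2 powr p\<close> from splitting the inhomogeneous term is harmless, as it does not touch
  the contraction.\<close>

lemma Y1_moment:
  assumes p: "0 < p" "p < \<alpha>1"
  obtains D where "D \<ge> 0" "\<And>N t. (\<integral>\<^sup>+\<omega>. ennreal (Y1 N t \<omega> powr p) \<partial>M) \<le> ennreal D"
proof -
  obtain \<theta> where \<theta>: "0 \<le> \<theta>" "\<theta> < 1" "\<And>t. (\<integral>\<^sup>+\<omega>. ennreal (A1 t \<omega> powr p) \<partial>M) \<le> ennreal \<theta>"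
    using A1_contract[OF p] by blast
  have "p < \<alpha>2" using p \<alpha> by simp
  then obtain D where D: "D \<ge> 0" "\<And>N t. (\<integral>\<^sup>+\<omega>. ennreal (Y2 N t \<omega> powr p) \<partial>M) \<le> ennreal D"
    using Y2_moment[OF p(1)] by blast
  have B1p: "integrable M (\<lambda>\<omega>. B1 0 \<omega> powr p)"
    by (rule integrable_powr_le[OF _ B1_int]) (use p entry_nonneg in auto)
  have A2p: "integrable M (\<lambda>\<omega>. A2 0 \<omega> powr p)"
    by (rule integrable_powr_le[OF _ A2_int]) (use p entry_nonneg in auto)
  let ?EA = "\<integral>\<omega>. A2 0 \<omega> powr p \<partial>M" and ?EB = "\<integral>\<omega>. B1 0 \<omega> powr p \<partial>M"
  have nn: "?EA \<ge> 0" "?EB \<ge> 0" by (intro Bochner_Integration.integral_nonneg, simp)+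
  have Y2_nonneg: "AE \<omega> in M. Y2 N t \<omega> \<ge> 0" for N t using AE_Y_mono(1)[of t] by eventually_elim blast
  show thesis
  proof (rule recursion_moment_bound[where a = A1 and q = "\<lambda>N t \<omega>. A2 t \<omega> * Y2 N (t - 1) \<omega> + B1 t \<omega>" and Y = Y1
        and p = p and \<theta> = \<theta> and C = "2 powr p * (?EA * D + ?EB)"])
    show "indep_rv borel (A1 t) borel (Y1 N (t - 1))" for N t
      by (rule determined_by_indep[OF Z_indep _ entry_det(1) Y1_det]) auto
    show "AE \<omega> in M. Y1 N t \<omega> \<ge> 0" for N t using AE_Y_mono(2)[of t] by eventually_elim blast
    show "AE \<omega> in M. A2 t \<omega> * Y2 N (t - 1) \<omega> + B1 t \<omega> \<ge> 0" for N t
      using entry_nonneg(2)[of t] entry_nonneg(4)[of t] Y2_nonneg[of N "t - 1"] by eventually_elim simp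
    show "(\<integral>\<^sup>+\<omega>. ennreal ((A2 t \<omega> * Y2 N (t - 1) \<omega> + B1 t \<omega>) powr p) \<partial>M) \<le> ennreal (2 powr p * (?EA * D + ?EB))" for N t
    proof -
      have ind: "indep_rv borel (A2 t) borel (Y2 N (t - 1))"
        by (rule determined_by_indep[OF Z_indep _ entry_det(2) Y2_det]) auto
      have "(\<integral>\<^sup>+\<omega>. ennreal ((A2 t \<omega> * Y2 N (t - 1) \<omega> + B1 t \<omega>) powr p) \<partial>M) \<le>
          (\<integral>\<^sup>+\<omega>. ennreal (2 powr p) * (ennreal (A2 t \<omega> powr p) * ennreal (Y2 N (t - 1) \<omega> powr p) + ennreal (B1 t \<omega> powr p)) \<partial>M)"
      proof (rule nn_integral_mono_AE)
        show "AE \<omega> in M. ennreal ((A2 t \<omega> * Y2 N (t - 1) \<omega> + B1 t \<omega>) powr p) \<le>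
            ennreal (2 powr p) * (ennreal (A2 t \<omega> powr p) * ennreal (Y2 N (t - 1) \<omega> powr p) + ennreal (B1 t \<omega> powr p))"
          using entry_nonneg(2)[of t] entry_nonneg(4)[of t] Y2_nonneg[of N "t - 1"]
        proof eventually_elim
          case (elim \<omega>)
          have "(A2 t \<omega> * Y2 N (t - 1) \<omega> + B1 t \<omega>) powr p \<le> 2 powr p * ((A2 t \<omega> * Y2 N (t - 1) \<omega>) powr p + B1 t \<omega> powr p)"
            using elim p by (intro powr_add_le) auto
          also have "(A2 t \<omega> * Y2 N (t - 1) \<omega>) powr p = A2 t \<omega> powr p * Y2 N (t - 1) \<omega> powr p"
            using elim by (simp add: powr_mult)
          finally have "ennreal ((A2 t \<omega> * Y2 N (t - 1) \<omega> + B1 t \<omega>) powr p) \<le>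
              ennreal (2 powr p * (A2 t \<omega> powr p * Y2 N (t - 1) \<omega> powr p + B1 t \<omega> powr p))" by (rule ennreal_leI)
          then show ?case by (simp add: ennreal_mult ennreal_plus)
        qed
      qed
      also have "\<dots> = ennreal (2 powr p) * ((\<integral>\<^sup>+\<omega>. ennreal (A2 t \<omega> powr p) * ennreal (Y2 N (t - 1) \<omega> powr p) \<partial>M) + (\<integral>\<^sup>+\<omega>. ennreal (B1 t \<omega> powr p) \<partial>M))"
        by (simp add: nn_integral_cmult nn_integral_add)
      also have "(\<integral>\<^sup>+\<omega>. ennreal (A2 t \<omega> powr p) * ennreal (Y2 N (t - 1) \<omega> powr p) \<partial>M) =
          (\<integral>\<^sup>+\<omega>. ennreal (A2 t \<omega> powr p) \<partial>M) * (\<integral>\<^sup>+\<omega>. ennreal (Y2 N (t - 1) \<omega> powr p) \<partial>M)"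
        by (rule nn_integral_indep_mult[OF ind, of "\<lambda>x. ennreal (x powr p)" "\<lambda>x. ennreal (x powr p)"]) auto
      also have "(\<integral>\<^sup>+\<omega>. ennreal (A2 t \<omega> powr p) \<partial>M) = ennreal ?EA" by (rule moment_transfer(2)[OF entry_distr(2) A2p]) auto
      also have "(\<integral>\<^sup>+\<omega>. ennreal (B1 t \<omega> powr p) \<partial>M) = ennreal ?EB" by (rule moment_transfer(2)[OF entry_distr(4) B1p]) auto
      also have "ennreal (2 powr p) * (ennreal ?EA * (\<integral>\<^sup>+\<omega>. ennreal (Y2 N (t - 1) \<omega> powr p) \<partial>M) + ennreal ?EB) \<le>
          ennreal (2 powr p) * (ennreal ?EA * ennreal D + ennreal ?EB)"
        by (intro mult_left_mono add_mono D order_refl) auto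
      also have "\<dots> = ennreal (2 powr p * (?EA * D + ?EB))"
        using nn D(1) by (simp add: ennreal_mult ennreal_plus)
      finally show ?thesis .
    qed
    show "0 \<le> 2 powr p * (?EA * D + ?EB)" using nn D(1) by simp
  qed (use \<theta> p entry_nonneg that in auto)
qed

end

section \<open>Integrability of increments of powers\<close>

context prob_space
begin

lemma integrable_nn_integral_le:
  fixes f :: "'a \<Rightarrow> real"
  assumes "f \<in> borel_measurable M" "\<And>\<omega>. 0 \<le> f \<omega>" "(\<integral>\<^sup>+\<omega>. ennreal (f \<omega>) \<partial>M) \<le> ennreal D"
  shows "integrable M f"
proof (rule integrableI_nonneg)
  show "(\<integral>\<^sup>+\<omega>. ennreal (f \<omega>) \<partial>M) < \<infinity>"
    by (rule le_less_trans[OF assms(3)]) simp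
qed (use assms in auto)

text \<open>Hoelder's inequality in the pointwise form of Young, with the conjugate exponents p and
  p / (p - 1).\<close>

lemma integrable_mult_powr:
  fixes x y :: "'a \<Rightarrow> real"
  assumes [measurable]: "x \<in> borel_measurable M" "y \<in> borel_measurable M"
    and nonneg: "AE \<omega> in M. x \<omega> \<ge> 0" "AE \<omega> in M. y \<omega> \<ge> 0" and "p > 1" "s > 0"
    and int: "integrable M (\<lambda>\<omega>. y \<omega> powr p)" "integrable M (\<lambda>\<omega>. x \<omega> powr (s * (p / (p - 1))))"
  shows "integrable M (\<lambda>\<omega>. y \<omega> * x \<omega> powr s)"
proof (rule Bochner_Integration.integrable_bound)
  show "integrable M (\<lambda>\<omega>. y \<omega> powr p + x \<omega> powr (s * (p / (p - 1))))"
    using int by (rule Bochner_Integration.integrable_add)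
  show "AE \<omega> in M. norm (y \<omega> * x \<omega> powr s) \<le> norm (y \<omega> powr p + x \<omega> powr (s * (p / (p - 1))))"
    using nonneg
  proof eventually_elim
    case (elim \<omega>)
    have "y \<omega> * x \<omega> powr s \<le> y \<omega> powr p + (x \<omega> powr s) powr (p / (p - 1))"
      using elim assms by (intro Young_powr) auto
    then show ?case using elim by (simp add: powr_powr)
  qed
qed measurable

text \<open>For p \<le> 1 subadditivity leaves only the power of \<open>y\<close>. For p > 1 a mixed
  moment joins in, with \<open>x\<close> to the power p - 1; the moment of \<open>x\<close> of order
  p, infinite in the application, never appears.\<close>

lemma integrable_powr_increment:
  fixes x y :: "'a \<Rightarrow> real"
  assumes [measurable]: "x \<in> borel_measurable M" "y \<in> borel_measurable M"
    and nonneg: "AE \<omega> in M. x \<omega> \<ge> 0" "AE \<omega> in M. y \<omega> \<ge> 0" and p: "p > 0"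
    and int: "integrable M (\<lambda>\<omega>. y \<omega> powr p)" "p > 1 \<Longrightarrow> integrable M (\<lambda>\<omega>. y \<omega> * x \<omega> powr (p - 1))"
  shows "integrable M (\<lambda>\<omega>. (x \<omega> + y \<omega>) powr p - x \<omega> powr p)"
proof (cases "p > 1")
  case True
  show ?thesis
  proof (rule Bochner_Integration.integrable_bound)
    show "integrable M (\<lambda>\<omega>. p * 2 powr (p - 1) * (y \<omega> * x \<omega> powr (p - 1) + y \<omega> powr p))"
      using int True by (intro integrable_mult_right Bochner_Integration.integrable_add) auto
    show "AE \<omega> in M. norm ((x \<omega> + y \<omega>) powr p - x \<omega> powr p) \<le>
        norm (p * 2 powr (p - 1) * (y \<omega> * x \<omega> powr (p - 1) + y \<omega> powr p))"
      using nonneg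
    proof eventually_elim
      case (elim \<omega>)
      have "x \<omega> powr p \<le> (x \<omega> + y \<omega>) powr p" using elim p by (intro powr_mono2) auto
      then show ?case using powr_increment_le[OF elim True] by simp
    qed
  qed measurable
next
  case False
  show ?thesis
  proof (rule Bochner_Integration.integrable_bound[OF int(1)])
    show "AE \<omega> in M. norm ((x \<omega> + y \<omega>) powr p - x \<omega> powr p) \<le> norm (y \<omega> powr p)"
      using nonneg
    proof eventually_elim
      case (elim \<omega>)
      have "x \<omega> powr p \<le> (x \<omega> + y \<omega>) powr p" using elim p by (intro powr_mono2) auto
      then show ?case using powr_add_subadditive[OF elim p] False by simp
    qed
  qed measurable
qed

end

section \<open>Identification of the stationary solution with the series\<close>

context triangular_recursion
begin

definition L1 :: "int \<Rightarrow> 'a \<Rightarrow> real" where "L1 t \<omega> = lim (\<lambda>N. Y1 N t \<omega>)"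
definition L2 :: "int \<Rightarrow> 'a \<Rightarrow> real" where "L2 t \<omega> = lim (\<lambda>N. Y2 N t \<omega>)"

lemma L_meas [measurable]: "L1 t \<in> borel_measurable M" "L2 t \<in> borel_measurable M"
  unfolding L1_def[abs_def] L2_def[abs_def] by measurable

lemma L2_moment:
  assumes p: "0 < p" "p < \<alpha>2"
  obtains D where "D \<ge> 0" "\<And>t. (\<integral>\<^sup>+\<omega>. ennreal (L2 t \<omega> powr p) \<partial>M) \<le> ennreal D"
    "\<And>t. AE \<omega> in M. convergent (\<lambda>N. Y2 N t \<omega>)"
proof -
  obtain D where D: "D \<ge> 0" "\<And>N t. (\<integral>\<^sup>+\<omega>. ennreal (Y2 N t \<omega> powr p) \<partial>M) \<le> ennreal D"
    using Y2_moment[OF p] by blast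
  show thesis
    by (rule that[OF D(1)], unfold L2_def)
       (rule monotone_moment_limit[OF Y2_meas AE_Y_mono(1) p(1) D(2)])+
qed

lemma L1_moment:
  assumes p: "0 < p" "p < \<alpha>1"
  obtains D where "D \<ge> 0" "\<And>t. (\<integral>\<^sup>+\<omega>. ennreal (L1 t \<omega> powr p) \<partial>M) \<le> ennreal D"
    "\<And>t. AE \<omega> in M. convergent (\<lambda>N. Y1 N t \<omega>)"
proof -
  obtain D where D: "D \<ge> 0" "\<And>N t. (\<integral>\<^sup>+\<omega>. ennreal (Y1 N t \<omega> powr p) \<partial>M) \<le> ennreal D"
    using Y1_moment[OF p] by blast
  show thesis
    by (rule that[OF D(1)], unfold L1_def)
       (rule monotone_moment_limit[OF Y1_meas AE_Y_mono(2) p(1) D(2)])+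
qed

lemma Y2_tendsto: "AE \<omega> in M. (\<lambda>N. Y2 N t \<omega>) \<longlonglongrightarrow> L2 t \<omega>"
proof -
  have p: "0 < \<alpha>2 / 2" "\<alpha>2 / 2 < \<alpha>2" using \<alpha> by auto
  obtain D where "\<And>t. AE \<omega> in M. convergent (\<lambda>N. Y2 N t \<omega>)" using L2_moment[OF p] by blast
  from this[of t] show ?thesis by eventually_elim (simp add: L2_def convergent_LIMSEQ_iff)
qed

lemma Y1_tendsto: "AE \<omega> in M. (\<lambda>N. Y1 N t \<omega>) \<longlonglongrightarrow> L1 t \<omega>"
proof -
  have p: "0 < \<alpha>1 / 2" "\<alpha>1 / 2 < \<alpha>1" using \<alpha> by auto
  obtain D where "\<And>t. AE \<omega> in M. convergent (\<lambda>N. Y1 N t \<omega>)" using L1_moment[OF p] by blast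
  from this[of t] show ?thesis by eventually_elim (simp add: L1_def convergent_LIMSEQ_iff)
qed

lemma L2_rec: "AE \<omega> in M. L2 t \<omega> = A4 t \<omega> * L2 (t - 1) \<omega> + B2 t \<omega>"
  using Y2_tendsto[of t] Y2_tendsto[of "t - 1"]
proof eventually_elim
  case (elim \<omega>)
  have "(\<lambda>N. Y2 (Suc N) t \<omega>) \<longlonglongrightarrow> A4 t \<omega> * L2 (t - 1) \<omega> + B2 t \<omega>"
    unfolding Y2.simps by (intro tendsto_intros elim)
  moreover have "(\<lambda>N. Y2 (Suc N) t \<omega>) \<longlonglongrightarrow> L2 t \<omega>" using elim(1) by (rule LIMSEQ_Suc)
  ultimately show ?case by (rule LIMSEQ_unique[symmetric])
qed

lemma L1_rec: "AE \<omega> in M. L1 t \<omega> = A1 t \<omega> * L1 (t - 1) \<omega> + (A2 t \<omega> * L2 (t - 1) \<omega> + B1 t \<omega>)"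
  using Y1_tendsto[of t] Y1_tendsto[of "t - 1"] Y2_tendsto[of "t - 1"]
proof eventually_elim
  case (elim \<omega>)
  have "(\<lambda>N. Y1 (Suc N) t \<omega>) \<longlonglongrightarrow> A1 t \<omega> * L1 (t - 1) \<omega> + (A2 t \<omega> * L2 (t - 1) \<omega> + B1 t \<omega>)"
    unfolding Y1.simps by (intro tendsto_intros elim)
  moreover have "(\<lambda>N. Y1 (Suc N) t \<omega>) \<longlonglongrightarrow> L1 t \<omega>" using elim(1) by (rule LIMSEQ_Suc)
  ultimately show ?case by (rule LIMSEQ_unique[symmetric])
qed

lemma L_nonneg: "AE \<omega> in M. L1 t \<omega> \<ge> 0" "AE \<omega> in M. L2 t \<omega> \<ge> 0"
proof -
  show "AE \<omega> in M. L1 t \<omega> \<ge> 0"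
    using Y1_tendsto[of t] AE_Y_mono(2)[of t] by eventually_elim (rule LIMSEQ_le_const, blast+)
  show "AE \<omega> in M. L2 t \<omega> \<ge> 0"
    using Y2_tendsto[of t] AE_Y_mono(1)[of t] by eventually_elim (rule LIMSEQ_le_const, blast+)
qed

lemma W_stationary: "strictly_stationary M W"
  and W_rec: "AE \<omega> in M. W t \<omega> = A t \<omega> *v W (t - 1) \<omega> + B t \<omega>"
  using sol by (simp_all add: stationary_causal_solution_def)

lemma W_det: "determined_by Z {..t} (W t)"
  using sol unfolding stationary_causal_solution_def determined_by_def Z_def by blast

lemma W_meas [measurable]: "W t \<in> borel_measurable M"
  using W_stationary by (simp add: strictly_stationary_def)

lemma component_meas [measurable]: "(\<lambda>v :: real^2. v $ i) \<in> borel_measurable borel"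
  by (intro borel_measurable_continuous_onI continuous_intros)

lemma W_component_meas [measurable]: "(\<lambda>\<omega>. W t \<omega> $ i) \<in> borel_measurable M"
  by measurable

lemma W_component_stationary: "strictly_stationary M (\<lambda>t \<omega>. W t \<omega> $ i)"
  by (rule strictly_stationary_compose[OF W_stationary component_meas])

lemma W_component_det: "determined_by Z {..t} (\<lambda>\<omega>. W t \<omega> $ i)"
  by (rule determined_by_compose[OF W_det component_meas])

lemma W_component_rec:
  "AE \<omega> in M. W t \<omega> $ 1 = A1 t \<omega> * W (t - 1) \<omega> $ 1 + (A2 t \<omega> * W (t - 1) \<omega> $ 2 + B1 t \<omega>)"
  "AE \<omega> in M. W t \<omega> $ 2 = A4 t \<omega> * W (t - 1) \<omega> $ 2 + B2 t \<omega>"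
proof -
  have *: "A t \<omega> *v W (t - 1) \<omega> + B t \<omega> =
      vector [A1 t \<omega> * W (t - 1) \<omega> $ 1 + (A2 t \<omega> * W (t - 1) \<omega> $ 2 + B1 t \<omega>), A4 t \<omega> * W (t - 1) \<omega> $ 2 + B2 t \<omega>]" for \<omega>
    by (subst (1) vector2_eq[of "W (t - 1) \<omega>"]) (simp only: A_eq B_eq triangular_mult_vector, simp add: vec_eq_iff forall_2)
  show "AE \<omega> in M. W t \<omega> $ 1 = A1 t \<omega> * W (t - 1) \<omega> $ 1 + (A2 t \<omega> * W (t - 1) \<omega> $ 2 + B1 t \<omega>)"
    using W_rec[of t] by eventually_elim (simp add: *)
  show "AE \<omega> in M. W t \<omega> $ 2 = A4 t \<omega> * W (t - 1) \<omega> $ 2 + B2 t \<omega>"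
    using W_rec[of t] by eventually_elim (simp add: *)
qed

text \<open>All variables share one law, and a single law on the line is tight.\<close>

lemma tight_W: "tight_family (\<lambda>t \<omega>. W t \<omega> $ i)"
  by (rule tight_family_identically_distributed[OF W_component_meas strictly_stationary_distr[OF W_component_stationary]])

lemma tight_L: "tight_family L1" "tight_family L2"
proof -
  obtain D where D: "D \<ge> 0" "\<And>t. (\<integral>\<^sup>+\<omega>. ennreal (L1 t \<omega> powr (\<alpha>1 / 2)) \<partial>M) \<le> ennreal D"
    by (rule L1_moment[of "\<alpha>1 / 2"]) (use \<alpha> in auto)
  show "tight_family L1"
  proof (rule tight_family_moment[OF L_meas(1) _ _ D(1)])
    show "0 < \<alpha>1 / 2" using \<alpha> by simp
    fix t
    have "AE \<omega> in M. ennreal (\<bar>L1 t \<omega>\<bar> powr (\<alpha>1 / 2)) = ennreal (L1 t \<omega> powr (\<alpha>1 / 2))"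
      using L_nonneg(1)[of t] by eventually_elim simp
    then have "(\<integral>\<^sup>+\<omega>. ennreal (\<bar>L1 t \<omega>\<bar> powr (\<alpha>1 / 2)) \<partial>M) = (\<integral>\<^sup>+\<omega>. ennreal (L1 t \<omega> powr (\<alpha>1 / 2)) \<partial>M)"
      by (rule nn_integral_cong_AE)
    then show "(\<integral>\<^sup>+\<omega>. ennreal (\<bar>L1 t \<omega>\<bar> powr (\<alpha>1 / 2)) \<partial>M) \<le> ennreal D"
      using D(2)[of t] by (simp only:)
  qed
  obtain D' where D': "D' \<ge> 0" "\<And>t. (\<integral>\<^sup>+\<omega>. ennreal (L2 t \<omega> powr (\<alpha>2 / 2)) \<partial>M) \<le> ennreal D'"
    by (rule L2_moment[of "\<alpha>2 / 2"]) (use \<alpha> in auto)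
  show "tight_family L2"
  proof (rule tight_family_moment[OF L_meas(2) _ _ D'(1)])
    show "0 < \<alpha>2 / 2" using \<alpha> by simp
    fix t
    have "AE \<omega> in M. ennreal (\<bar>L2 t \<omega>\<bar> powr (\<alpha>2 / 2)) = ennreal (L2 t \<omega> powr (\<alpha>2 / 2))"
      using L_nonneg(2)[of t] by eventually_elim simp
    then have "(\<integral>\<^sup>+\<omega>. ennreal (\<bar>L2 t \<omega>\<bar> powr (\<alpha>2 / 2)) \<partial>M) = (\<integral>\<^sup>+\<omega>. ennreal (L2 t \<omega> powr (\<alpha>2 / 2)) \<partial>M)"
      by (rule nn_integral_cong_AE)
    then show "(\<integral>\<^sup>+\<omega>. ennreal (\<bar>L2 t \<omega>\<bar> powr (\<alpha>2 / 2)) \<partial>M) \<le> ennreal D'"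
      using D'(2)[of t] by (simp only:)
  qed
qed

text \<open>The difference of two solutions of the same recursion solves the homogeneous one, and it
  is tight: the solution by stationarity, the limit by its moment.\<close>

lemma W2_eq: "AE \<omega> in M. W t \<omega> $ 2 = L2 t \<omega>"
proof -
  have p: "0 < \<alpha>2 / 2" "\<alpha>2 / 2 < \<alpha>2" using \<alpha> by auto
  obtain \<theta> where \<theta>: "0 \<le> \<theta>" "\<theta> < 1" "\<And>t. (\<integral>\<^sup>+\<omega>. ennreal (A4 t \<omega> powr (\<alpha>2 / 2)) \<partial>M) \<le> ennreal \<theta>"
    using A4_contract[OF p] by blast
  have "AE \<omega> in M. W t \<omega> $ 2 - L2 t \<omega> = 0"
  proof (rule homogeneous_recursion_zero[OF Z_indep entry_det(3) _ _ entry_nonneg(3) _ _ p(1) \<theta>(3,1,2)])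
    show "AE \<omega> in M. W t \<omega> $ 2 - L2 t \<omega> = A4 t \<omega> * (W (t - 1) \<omega> $ 2 - L2 (t - 1) \<omega>)" for t
      using W_component_rec(2)[of t] L2_rec[of t] by eventually_elim (simp add: algebra_simps)
    show "tight_family (\<lambda>t \<omega>. W t \<omega> $ 2 - L2 t \<omega>)"
      by (rule tight_family_diff[OF tight_W tight_L(2)]) measurable
  qed measurable
  then show ?thesis by eventually_elim simp
qed

text \<open>The inhomogeneous terms contain the second components and cancel only after these have
  been identified.\<close>

lemma W1_eq: "AE \<omega> in M. W t \<omega> $ 1 = L1 t \<omega>"
proof -
  have p: "0 < \<alpha>1 / 2" "\<alpha>1 / 2 < \<alpha>1" using \<alpha> by auto
  obtain \<theta> where \<theta>: "0 \<le> \<theta>" "\<theta> < 1" "\<And>t. (\<integral>\<^sup>+\<omega>. ennreal (A1 t \<omega> powr (\<alpha>1 / 2)) \<partial>M) \<le> ennreal \<theta>"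
    using A1_contract[OF p] by blast
  have "AE \<omega> in M. W t \<omega> $ 1 - L1 t \<omega> = 0"
  proof (rule homogeneous_recursion_zero[OF Z_indep entry_det(1) _ _ entry_nonneg(1) _ _ p(1) \<theta>(3,1,2)])
    show "AE \<omega> in M. W t \<omega> $ 1 - L1 t \<omega> = A1 t \<omega> * (W (t - 1) \<omega> $ 1 - L1 (t - 1) \<omega>)" for t
      using W_component_rec(1)[of t] L1_rec[of t] W2_eq[of "t - 1"] by eventually_elim (simp add: algebra_simps)
    show "tight_family (\<lambda>t \<omega>. W t \<omega> $ 1 - L1 t \<omega>)"
      by (rule tight_family_diff[OF tight_W tight_L(1)]) measurable
  qed measurable
  then show ?thesis by eventually_elim simp
qed

lemma solution_sums:
  "AE \<omega> in M. (\<lambda>n. back_prod (\<lambda>s. A s \<omega>) t n *v B (t - int n) \<omega>) sums W t \<omega>"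
  using Y1_tendsto[of t] Y2_tendsto[of t] W1_eq[of t] W2_eq[of t]
proof eventually_elim
  case (elim \<omega>)
  have "(\<lambda>N. vector [Y1 N t \<omega>, Y2 N t \<omega>] :: real^2) \<longlonglongrightarrow> W t \<omega>"
  proof (rule vec_tendstoI)
    fix i :: 2
    show "(\<lambda>N. (vector [Y1 N t \<omega>, Y2 N t \<omega>] :: real^2) $ i) \<longlonglongrightarrow> W t \<omega> $ i"
    proof (cases "i = 1")
      case True
      then show ?thesis using elim(1,3) by simp
    next
      case False
      then have "i = 2" using exhaust_2[of i] by blast
      then show ?thesis using elim(2,4) by simp
    qed
  qed
  then show ?case unfolding sums_def partial_sum_eq .
qed

lemma W_nonneg: "AE \<omega> in M. W t \<omega> $ 1 \<ge> 0" "AE \<omega> in M. W t \<omega> $ 2 \<ge> 0"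
proof -
  show "AE \<omega> in M. W t \<omega> $ 1 \<ge> 0" using L_nonneg(1)[of t] W1_eq[of t] by eventually_elim simp
  show "AE \<omega> in M. W t \<omega> $ 2 \<ge> 0" using L_nonneg(2)[of t] W2_eq[of t] by eventually_elim simp
qed

text \<open>Inherited from the limit of the partial sums; stationarity alone would not give any
  moment.\<close>

lemma W2_int:
  assumes "0 < p" "p < \<alpha>2"
  shows "integrable M (\<lambda>\<omega>. W t \<omega> $ 2 powr p)"
proof -
  obtain D where D: "D \<ge> 0" "\<And>t. (\<integral>\<^sup>+\<omega>. ennreal (L2 t \<omega> powr p) \<partial>M) \<le> ennreal D"
    by (rule L2_moment[OF assms]) (rule that)
  have "integrable M (\<lambda>\<omega>. L2 t \<omega> powr p)"
    by (rule integrable_nn_integral_le[OF _ _ D(2)[of t]]) auto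
  moreover have "AE \<omega> in M. W t \<omega> $ 2 powr p = L2 t \<omega> powr p" using W2_eq[of t] by eventually_elim simp
  ultimately show ?thesis by (subst integrable_cong_AE[where g = "\<lambda>\<omega>. L2 t \<omega> powr p"]) auto
qed

lemma W1_int:
  assumes "0 < p" "p < \<alpha>1"
  shows "integrable M (\<lambda>\<omega>. W t \<omega> $ 1 powr p)"
proof -
  obtain D where D: "D \<ge> 0" "\<And>t. (\<integral>\<^sup>+\<omega>. ennreal (L1 t \<omega> powr p) \<partial>M) \<le> ennreal D"
    by (rule L1_moment[OF assms]) (rule that)
  have "integrable M (\<lambda>\<omega>. L1 t \<omega> powr p)"
    by (rule integrable_nn_integral_le[OF _ _ D(2)[of t]]) auto
  moreover have "AE \<omega> in M. W t \<omega> $ 1 powr p = L1 t \<omega> powr p" using W1_eq[of t] by eventually_elim simp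
  ultimately show ?thesis by (subst integrable_cong_AE[where g = "\<lambda>\<omega>. L1 t \<omega> powr p"]) auto
qed

section \<open>The two components as scalar recursions\<close>

lemma indep_past:
  fixes Y X :: "'a \<Rightarrow> real"
  assumes "determined_by Z {t} Y" "determined_by Z {..t-1} X" "Y \<in> borel_measurable M" "X \<in> borel_measurable M"
  shows "indep_rv borel Y borel X"
  by (rule determined_by_indep[OF Z_indep _ assms]) auto

lemma integrable_indep_mult:
  fixes Y X :: "'a \<Rightarrow> real"
  assumes det: "determined_by Z {t} Y" "determined_by Z {..t-1} X"
    and [measurable]: "Y \<in> borel_measurable M" "X \<in> borel_measurable M"
    and nonneg: "AE \<omega> in M. Y \<omega> \<ge> 0" "AE \<omega> in M. X \<omega> \<ge> 0" and int: "integrable M Y" "integrable M X"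
  shows "integrable M (\<lambda>\<omega>. Y \<omega> * X \<omega>)"
proof -
  have "integrable M (\<lambda>\<omega>. \<bar>Y \<omega>\<bar> * \<bar>X \<omega>\<bar>)"
    by (rule indep_rv_integrable_mult[OF indep_past[OF det], of abs abs]) (use int in auto)
  moreover have "AE \<omega> in M. Y \<omega> * X \<omega> = \<bar>Y \<omega>\<bar> * \<bar>X \<omega>\<bar>" using nonneg by eventually_elim simp
  ultimately show ?thesis by (subst integrable_cong_AE[where g = "\<lambda>\<omega>. \<bar>Y \<omega>\<bar> * \<bar>X \<omega>\<bar>"]) auto
qed

text \<open>The auxiliary order \<alpha>2 / 2 is just one choice below \<alpha>2. The only
  substantial condition is integrability of the increment of powers.\<close>

lemma component2: "scalar_recursion M Z A4 B2 (\<lambda>t \<omega>. W t \<omega> $ 2) \<alpha>2 (\<alpha>2 / 2)"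
proof -
  have \<alpha>2: "\<alpha>2 > 0" using \<alpha> by simp
  have incr: "integrable M (\<lambda>\<omega>. (A4 0 \<omega> * W (- 1) \<omega> $ 2 + B2 0 \<omega>) powr \<alpha>2 - (A4 0 \<omega> * W (- 1) \<omega> $ 2) powr \<alpha>2)"
  proof (rule integrable_powr_increment)
    show "AE \<omega> in M. 0 \<le> A4 0 \<omega> * W (- 1) \<omega> $ 2"
      using entry_nonneg(3)[of 0] W_nonneg(2)[of "-1"] by eventually_elim simp
    assume gt: "\<alpha>2 > 1"
    \<comment> \<open>Independence splits off \<open>W (- 1)\<close>, where the order \<alpha>2 - 1
      is subcritical. \<open>B2 0\<close> and \<open>A4 0\<close> may be dependent; Hoelder's
      inequality with exponent \<alpha>2 uses exactly their moments of order \<alpha>2.\<close>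
    have "integrable M (\<lambda>\<omega>. (B2 0 \<omega> * A4 0 \<omega> powr (\<alpha>2 - 1)) * W (- 1) \<omega> $ 2 powr (\<alpha>2 - 1))"
    proof (rule integrable_indep_mult[of 0])
      show "determined_by Z {0} (\<lambda>\<omega>. B2 0 \<omega> * A4 0 \<omega> powr (\<alpha>2 - 1))"
        by (intro determined_by_add_mult entry_det determined_by_compose[OF entry_det(3)]) simp
      show "determined_by Z {..0 - 1} (\<lambda>\<omega>. W (- 1) \<omega> $ 2 powr (\<alpha>2 - 1))"
        using determined_by_compose[OF W_component_det[of "-1" 2], of "\<lambda>x. x powr (\<alpha>2 - 1)"] by simp
      show "integrable M (\<lambda>\<omega>. B2 0 \<omega> * A4 0 \<omega> powr (\<alpha>2 - 1))"
        by (rule integrable_mult_powr[where p = \<alpha>2]) (use gt entry_nonneg B2_int A4_int in auto)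
      show "AE \<omega> in M. 0 \<le> B2 0 \<omega> * A4 0 \<omega> powr (\<alpha>2 - 1)"
        using entry_nonneg(5)[of 0] by eventually_elim simp
    qed (use gt W2_int in auto)
    moreover have "AE \<omega> in M. B2 0 \<omega> * (A4 0 \<omega> * W (- 1) \<omega> $ 2) powr (\<alpha>2 - 1) =
        (B2 0 \<omega> * A4 0 \<omega> powr (\<alpha>2 - 1)) * W (- 1) \<omega> $ 2 powr (\<alpha>2 - 1)"
      using entry_nonneg(3)[of 0] W_nonneg(2)[of "-1"] by eventually_elim (simp add: powr_mult)
    ultimately show "integrable M (\<lambda>\<omega>. B2 0 \<omega> * (A4 0 \<omega> * W (- 1) \<omega> $ 2) powr (\<alpha>2 - 1))"
      by (subst integrable_cong_AE[where g = "\<lambda>\<omega>. (B2 0 \<omega> * A4 0 \<omega> powr (\<alpha>2 - 1)) * W (- 1) \<omega> $ 2 powr (\<alpha>2 - 1)"]) auto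
  qed (use entry_nonneg B2_int \<alpha>2 in auto)
  show ?thesis
  proof (unfold_locales)
    show "determined_by Z {..t} (B2 t)" for t by (rule determined_by_mono[OF entry_det(5)]) simp
    show "distr M borel (\<lambda>\<omega>. W t \<omega> $ 2) = distr M borel (\<lambda>\<omega>. W 0 \<omega> $ 2)" for t
      by (rule strictly_stationary_distr[OF W_component_stationary])
    show "integrable M (\<lambda>\<omega>. B2 t \<omega> powr \<alpha>2)" for t
      by (rule moment_transfer(1)[OF entry_distr(5) B2_int]) auto
    show "integrable M (\<lambda>\<omega>. W (- 1) \<omega> $ 2 powr (\<alpha>2 / 2))" by (rule W2_int) (use \<alpha>2 in auto)
    show "0 < \<alpha>2 / 2" "\<alpha>2 / 2 < \<alpha>2" using \<alpha>2 by auto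
  qed (fact Z_indep entry_det(3) W_component_det entry_measurable(3) entry_measurable(5) W_component_meas
      entry_pos(3) entry_pos(5) W_nonneg(2) W_component_rec(2) entry_distr(3) A4_nonarith A4_int A4_one A4_ln incr)+
qed

text \<open>The inhomogeneous term shares the past with the first component. The strict inequality
  \<alpha>1 < \<alpha>2 gives it a moment of order \<alpha>1 and keeps the mixed moments of the two
  components finite.\<close>

lemma component1: "scalar_recursion M Z A1 (\<lambda>t \<omega>. A2 t \<omega> * W (t - 1) \<omega> $ 2 + B1 t \<omega>) (\<lambda>t \<omega>. W t \<omega> $ 1) \<alpha>1 (\<alpha>1 / 2)"
proof -
  have Q_nonneg: "AE \<omega> in M. 0 \<le> A2 t \<omega> * W (t - 1) \<omega> $ 2 + B1 t \<omega>" for t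
    using entry_nonneg(2)[of t] entry_nonneg(4)[of t] W_nonneg(2)[of "t - 1"] by eventually_elim simp
  have Q_int: "integrable M (\<lambda>\<omega>. (A2 t \<omega> * W (t - 1) \<omega> $ 2 + B1 t \<omega>) powr \<alpha>1)" for t
  proof (rule Bochner_Integration.integrable_bound)
    have "integrable M (\<lambda>\<omega>. A2 t \<omega> powr \<alpha>1 * W (t - 1) \<omega> $ 2 powr \<alpha>1)"
    proof (rule integrable_indep_mult[of t])
      show "determined_by Z {t} (\<lambda>\<omega>. A2 t \<omega> powr \<alpha>1)"
        by (rule determined_by_compose[OF entry_det(2)]) simp
      show "determined_by Z {..t - 1} (\<lambda>\<omega>. W (t - 1) \<omega> $ 2 powr \<alpha>1)"
        by (rule determined_by_compose[OF W_component_det]) simp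
      show "integrable M (\<lambda>\<omega>. A2 t \<omega> powr \<alpha>1)" by (rule moment_transfer(1)[OF entry_distr(2) A2_int]) auto
      show "integrable M (\<lambda>\<omega>. W (t - 1) \<omega> $ 2 powr \<alpha>1)" by (rule W2_int) (use \<alpha> in auto)
    qed auto
    moreover have "integrable M (\<lambda>\<omega>. B1 t \<omega> powr \<alpha>1)" by (rule moment_transfer(1)[OF entry_distr(4) B1_int]) auto
    ultimately show "integrable M (\<lambda>\<omega>. 2 powr \<alpha>1 * (A2 t \<omega> powr \<alpha>1 * W (t - 1) \<omega> $ 2 powr \<alpha>1 + B1 t \<omega> powr \<alpha>1))"
      by (intro integrable_mult_right Bochner_Integration.integrable_add)
    show "AE \<omega> in M. norm ((A2 t \<omega> * W (t - 1) \<omega> $ 2 + B1 t \<omega>) powr \<alpha>1) \<le>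
        norm (2 powr \<alpha>1 * (A2 t \<omega> powr \<alpha>1 * W (t - 1) \<omega> $ 2 powr \<alpha>1 + B1 t \<omega> powr \<alpha>1))"
      using entry_nonneg(2)[of t] entry_nonneg(4)[of t] W_nonneg(2)[of "t - 1"]
    proof eventually_elim
      case (elim \<omega>)
      then show ?case
        using powr_add_le[of "A2 t \<omega> * W (t - 1) \<omega> $ 2" "B1 t \<omega>" \<alpha>1] \<alpha> by (simp add: powr_mult)
    qed
  qed measurable
  have incr: "integrable M (\<lambda>\<omega>. (A1 0 \<omega> * W (- 1) \<omega> $ 1 + (A2 0 \<omega> * W (- 1) \<omega> $ 2 + B1 0 \<omega>)) powr \<alpha>1 - (A1 0 \<omega> * W (- 1) \<omega> $ 1) powr \<alpha>1)"
  proof (rule integrable_powr_increment)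
    show "AE \<omega> in M. 0 \<le> A1 0 \<omega> * W (- 1) \<omega> $ 1"
      using entry_nonneg(1)[of 0] W_nonneg(1)[of "-1"] by eventually_elim simp
    show "AE \<omega> in M. 0 \<le> A2 0 \<omega> * W (- 1) \<omega> $ 2 + B1 0 \<omega>" using Q_nonneg[of 0] by simp
    show "integrable M (\<lambda>\<omega>. (A2 0 \<omega> * W (- 1) \<omega> $ 2 + B1 0 \<omega>) powr \<alpha>1)" using Q_int[of 0] by simp
    assume gt: "\<alpha>1 > 1"
    let ?s = "\<alpha>1 - 1"
    \<comment> \<open>Any exponent strictly between the two orders: p < \<alpha>2 secures the moment
      of the second component, and p > \<alpha>1 is equivalent to the conjugate power (\<alpha>1 -
      1) p / (p - 1) of the first being below \<alpha>1.\<close>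
    define p where "p = (\<alpha>1 + \<alpha>2) / 2"
    have p: "\<alpha>1 < p" "p < \<alpha>2" "p > 1" using \<alpha> gt by (auto simp: p_def)
    have exponent: "0 < ?s * (p / (p - 1))" "?s * (p / (p - 1)) < \<alpha>1"
    proof -
      show "0 < ?s * (p / (p - 1))" using gt p by simp
      have "?s * p < \<alpha>1 * (p - 1)" using p by (simp add: algebra_simps)
      then show "?s * (p / (p - 1)) < \<alpha>1" using p by (simp add: pos_divide_less_eq)
    qed
    have det: "determined_by Z {..0 - 1} (\<lambda>\<omega>. W (- 1) \<omega> $ 1 powr ?s)"
      using determined_by_compose[OF W_component_det[of "-1" 1], of "\<lambda>x. x powr ?s"] by simp
    \<comment> \<open>Independence separates time 0 from time -1 but neither pair within one time:
      Hoelder's inequality is used twice, with exponent \<alpha>1 for the entries and exponent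
      \<open>p\<close> for the components of \<open>W (- 1)\<close>.\<close>
    have 1: "integrable M (\<lambda>\<omega>. (A2 0 \<omega> * A1 0 \<omega> powr ?s) * (W (- 1) \<omega> $ 2 * W (- 1) \<omega> $ 1 powr ?s))"
    proof (rule integrable_indep_mult[of 0])
      show "determined_by Z {0} (\<lambda>\<omega>. A2 0 \<omega> * A1 0 \<omega> powr ?s)"
        by (intro determined_by_add_mult entry_det determined_by_compose[OF entry_det(1)]) simp
      show "determined_by Z {..0 - 1} (\<lambda>\<omega>. W (- 1) \<omega> $ 2 * W (- 1) \<omega> $ 1 powr ?s)"
        using determined_by_add_mult(2)[OF _ det, of "\<lambda>\<omega>. W (- 1) \<omega> $ 2"] W_component_det[of "-1" 2] by simp
      show "integrable M (\<lambda>\<omega>. A2 0 \<omega> * A1 0 \<omega> powr ?s)"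
        by (rule integrable_mult_powr[where p = \<alpha>1]) (use gt entry_nonneg A2_int A1_int in auto)
      show "integrable M (\<lambda>\<omega>. W (- 1) \<omega> $ 2 * W (- 1) \<omega> $ 1 powr ?s)"
        by (rule integrable_mult_powr[where p = p]) (use gt p exponent \<alpha> W_nonneg W2_int W1_int in auto)
      show "AE \<omega> in M. 0 \<le> A2 0 \<omega> * A1 0 \<omega> powr ?s"
        using entry_nonneg(2)[of 0] by eventually_elim simp
      show "AE \<omega> in M. 0 \<le> W (- 1) \<omega> $ 2 * W (- 1) \<omega> $ 1 powr ?s"
        using W_nonneg(2)[of "-1"] by eventually_elim simp
    qed measurable
    have 2: "integrable M (\<lambda>\<omega>. (B1 0 \<omega> * A1 0 \<omega> powr ?s) * W (- 1) \<omega> $ 1 powr ?s)"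
    proof (rule integrable_indep_mult[of 0, OF _ det])
      show "determined_by Z {0} (\<lambda>\<omega>. B1 0 \<omega> * A1 0 \<omega> powr ?s)"
        by (intro determined_by_add_mult entry_det determined_by_compose[OF entry_det(1)]) simp
      show "integrable M (\<lambda>\<omega>. B1 0 \<omega> * A1 0 \<omega> powr ?s)"
        by (rule integrable_mult_powr[where p = \<alpha>1]) (use gt entry_nonneg B1_int A1_int in auto)
      show "AE \<omega> in M. 0 \<le> B1 0 \<omega> * A1 0 \<omega> powr ?s"
        using entry_nonneg(4)[of 0] by eventually_elim simp
    qed (use gt W1_int in auto)
    let ?g = "\<lambda>\<omega>. (A2 0 \<omega> * A1 0 \<omega> powr ?s) * (W (- 1) \<omega> $ 2 * W (- 1) \<omega> $ 1 powr ?s) +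
        (B1 0 \<omega> * A1 0 \<omega> powr ?s) * W (- 1) \<omega> $ 1 powr ?s"
    have "integrable M ?g" using 1 2 by (rule Bochner_Integration.integrable_add)
    moreover have "AE \<omega> in M. (A2 0 \<omega> * W (- 1) \<omega> $ 2 + B1 0 \<omega>) * (A1 0 \<omega> * W (- 1) \<omega> $ 1) powr ?s = ?g \<omega>"
      using entry_nonneg(1)[of 0] W_nonneg(1)[of "-1"] by eventually_elim (simp add: powr_mult algebra_simps)
    ultimately show "integrable M (\<lambda>\<omega>. (A2 0 \<omega> * W (- 1) \<omega> $ 2 + B1 0 \<omega>) * (A1 0 \<omega> * W (- 1) \<omega> $ 1) powr ?s)"
      by (subst integrable_cong_AE[where g = ?g]) auto
  qed (use \<alpha> in auto)
  show ?thesis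
  proof (unfold_locales)
    show "determined_by Z {..t} (\<lambda>\<omega>. A2 t \<omega> * W (t - 1) \<omega> $ 2 + B1 t \<omega>)" for t
      by (intro determined_by_add_mult determined_by_mono[OF entry_det(2)] determined_by_mono[OF entry_det(4)]
          determined_by_mono[OF W_component_det]) auto
    show "AE \<omega> in M. 0 < A2 t \<omega> * W (t - 1) \<omega> $ 2 + B1 t \<omega>" for t
      using entry_nonneg(2)[of t] entry_pos(4)[of t] W_nonneg(2)[of "t - 1"]
      by eventually_elim (simp add: add_nonneg_pos)
    show "distr M borel (\<lambda>\<omega>. W t \<omega> $ 1) = distr M borel (\<lambda>\<omega>. W 0 \<omega> $ 1)" for t
      by (rule strictly_stationary_distr[OF W_component_stationary])
    show "integrable M (\<lambda>\<omega>. W (- 1) \<omega> $ 1 powr (\<alpha>1 / 2))" by (rule W1_int) (use \<alpha> in auto)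
    show "(\<lambda>\<omega>. A2 t \<omega> * W (t - 1) \<omega> $ 2 + B1 t \<omega>) \<in> borel_measurable M" for t by measurable
    show "integrable M (\<lambda>\<omega>. (A1 0 \<omega> * W (- 1) \<omega> $ 1 + (A2 0 \<omega> * W (0 - 1) \<omega> $ 2 + B1 0 \<omega>)) powr \<alpha>1 - (A1 0 \<omega> * W (- 1) \<omega> $ 1) powr \<alpha>1)"
      using incr by simp
    show "0 < \<alpha>1 / 2" "\<alpha>1 / 2 < \<alpha>1" using \<alpha> by auto
  qed (fact Z_indep entry_det(1) W_component_det entry_measurable(1) W_component_meas
      entry_pos(1) W_nonneg(1) W_component_rec(1) entry_distr(1) A1_nonarith A1_int A1_one A1_ln Q_int)+
qed

lemma spectral_measures:
  assumes "h \<ge> 1"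
  shows "\<exists>S. is_tilted_direction_law M h (forward_products A1 h) \<alpha>1 S \<and>
      has_spectral_measure M h (\<lambda>\<omega>. tuple h (\<lambda>k. W (int k) \<omega> $ 1)) \<alpha>1 S"
    "\<exists>S. is_tilted_direction_law M h (forward_products A4 h) \<alpha>2 S \<and>
      has_spectral_measure M h (\<lambda>\<omega>. tuple h (\<lambda>k. W (int k) \<omega> $ 2)) \<alpha>2 S"
  using scalar_recursion.spectral_measure[OF component1 assms] scalar_recursion.spectral_measure[OF component2 assms] .

lemma regularly_varying_components:
  "regularly_varying_series M (\<lambda>t \<omega>. W t \<omega> $ 1) \<alpha>1" "regularly_varying_series M (\<lambda>t \<omega>. W t \<omega> $ 2) \<alpha>2"
  unfolding regularly_varying_series_def multivariate_regularly_varying_def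
  using W_component_stationary spectral_measures by blast+

end

theorem lemma3p3:
  fixes M :: "'a measure"
    and A1 A2 A4 B1 B2 :: "int \<Rightarrow> 'a \<Rightarrow> real"
    and A :: "int \<Rightarrow> 'a \<Rightarrow> real^2^2"
    and B W :: "int \<Rightarrow> 'a \<Rightarrow> real^2"
    and \<alpha>1 \<alpha>2 :: real
  assumes "prob_space M"
    and "\<And>t \<omega>. A t \<omega> = vector [vector [A1 t \<omega>, A2 t \<omega>], vector [0, A4 t \<omega>]]"
    and "\<And>t \<omega>. B t \<omega> = vector [B1 t \<omega>, B2 t \<omega>]"
    and "iid_sequence M (\<lambda>t \<omega>. (A t \<omega>, B t \<omega>))"
    and "\<And>t. AE \<omega> in M. A1 t \<omega> > 0 \<and> A2 t \<omega> > 0 \<and> A4 t \<omega> > 0 \<and> B1 t \<omega> > 0 \<and> B2 t \<omega> > 0"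
    and "non_arithmetic M (\<lambda>\<omega>. ln (A1 0 \<omega>))"
    and "non_arithmetic M (\<lambda>\<omega>. ln (A4 0 \<omega>))"
    and "0 < \<alpha>1" and "\<alpha>1 < \<alpha>2"
    and "integrable M (\<lambda>\<omega>. A1 0 \<omega> powr \<alpha>1)"
    and "(\<integral>\<omega>. A1 0 \<omega> powr \<alpha>1 \<partial>M) = 1"
    and "integrable M (\<lambda>\<omega>. A1 0 \<omega> powr \<alpha>1 * max (ln (A1 0 \<omega>)) 0)"
    and "integrable M (\<lambda>\<omega>. B1 0 \<omega> powr \<alpha>1)"
    and "integrable M (\<lambda>\<omega>. A4 0 \<omega> powr \<alpha>2)"
    and "(\<integral>\<omega>. A4 0 \<omega> powr \<alpha>2 \<partial>M) = 1"
    and "integrable M (\<lambda>\<omega>. A4 0 \<omega> powr \<alpha>2 * max (ln (A4 0 \<omega>)) 0)"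
    and "integrable M (\<lambda>\<omega>. B2 0 \<omega> powr \<alpha>2)"
    and "integrable M (\<lambda>\<omega>. A2 0 \<omega> powr \<alpha>1)"
    and "stationary_causal_solution M A B W"
  shows "(\<forall>t. AE \<omega> in M.
            (\<lambda>n. back_prod (\<lambda>s. A s \<omega>) t n *v B (t - int n) \<omega>) sums W t \<omega>) \<and>
         regularly_varying_series M (\<lambda>t \<omega>. W t \<omega> $ 1) \<alpha>1 \<and>
         regularly_varying_series M (\<lambda>t \<omega>. W t \<omega> $ 2) \<alpha>2 \<and>
         (\<forall>h\<ge>1. \<exists>S. is_tilted_direction_law M h (forward_products A1 h) \<alpha>1 S \<and>
            has_spectral_measure M h (\<lambda>\<omega>. tuple h (\<lambda>k. W (int k) \<omega> $ 1)) \<alpha>1 S) \<and>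
         (\<forall>h\<ge>1. \<exists>S. is_tilted_direction_law M h (forward_products A4 h) \<alpha>2 S \<and>
            has_spectral_measure M h (\<lambda>\<omega>. tuple h (\<lambda>k. W (int k) \<omega> $ 2)) \<alpha>2 S)"
proof -
  interpret triangular_recursion M A1 A2 A4 B1 B2 A B W \<alpha>1 \<alpha>2
    using assms by (simp add: triangular_recursion_def triangular_recursion_axioms_def)
  show ?thesis
    using solution_sums regularly_varying_components spectral_measures by blast
qed

end
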